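(* Let $\Gamma$ be a metric graph with a fixed model $G=(V,E)$ without self-loops, and let $|D_0|$ be a complete linear system on $\Gamma$ with its induced cell structure. For any generic divisor $D\in|D_0|$, $$\dim\Delta_D\ \ge\ r(D),$$ where $\Delta_D$ is the unique cell of $|D_0|$ containing $D$ in its relative interior.
   Context: Metric graph: a compact length space (infinite distances between different components are allowed) in which every point $x$ has a neighbourhood that is a star of finitely many ($=\mathrm{val}(x)$) half-open segments glued at $x$. A model $G=(V,E)$ is given by a finite $V\subset\Gamma$ with $\Gamma\setminus V$ a disjoint union of open intervals (the edges $e\in E$, of lengths $l(e)$). A divisor is a finite formal sum $D=\sum_x D(x)\,x$ with $D(x)\in\mathbb Z$; it is effective ($D\ge0$) if all $D(x)\ge 0$; $\deg D=\sum_x D(x)$. A rational function is a continuous piecewise linear $f:\Gamma\to\mathbb R$ with integer slopes (finitely many pieces); $\mathrm{ord}_x(f)$ is the sum of the outgoing slopes of $f$ at $x$, and $\mathrm{div}(f)=\sum_x\mathrm{ord}_x(f)\,x$. $D\sim D'$ iff $D-D'=\mathrm{div}(f)$ for some rational $f$; the complete linear system of $D$ is $|D|=\{D'\ge0: D'\sim D\}$. Rank: $r(D)=-1$ if $|D|=\emptyset$; otherwise $r(D)$ is the largest $d\ge 0$ such that $|D-E|\ne\emptyset$ for every effective divisor $E$ of degree $d$. Cell structure of $|D_0|$: orient each edge $e$ and identify it with $[0,l(e)]$. For data $m_V:V\to\mathbb N$, $m_E:E\to\bigcup_{k\ge0}\mathbb N_{>0}^k$, $s:E\to\mathbb Z$,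 the associated open cell is the set of $D'=D_0+\mathrm{div}(f)\in|D_0|$ such that $D'(v)=m_V(v)$ for all $v\in V$; on the interior of each edge $e$, $D'$ equals $\sum_i m_E(e)_i\,x_i$ with $0<x_1<\dots<x_k<l(e)$; and the slope of $f$ at the origin of $e$ along $e$ is $s(e)$. The cells of $|D_0|$ are the closures of the nonempty open cells (the open cell being the relative interior); in the coordinates given by the positions $x_i$ of the chips along edges they are polyhedra, and the dimension of a cell is its dimension as a polyhedron. They make $|D_0|$ an abstract polyhedral complex. $D\in|D_0|$ is generic if it lies in the relative interior of an inclusion-maximal cell, i.e. if $\Delta_D$ is inclusion-maximal.
   Formalization: The metric graph is assumed to have at least one edge; for a finite set of isolated points the claim can fail (one point v, D = 3v: the cell has dimension 0 but r(D) = 3), and for the empty graph the rank is undefined. *)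

theory Defs
  imports "HOL-Analysis.Analysis" "HOL-Library.Function_Algebras"
begin

text \<open>Distances are \<open>ennreal\<close>-valued, so that different components may be at distance \<open>\<infinity>\<close>; they are
  only meaningful between elements of \<open>points X\<close>.\<close>

record 'a ext_space =
  points :: "'a set"
  edist :: "'a \<Rightarrow> 'a \<Rightarrow> ennreal"

definition ext_metric :: "('a, 'z) ext_space_scheme \<Rightarrow> bool" where
  "ext_metric X \<longleftrightarrow>
     (\<forall>x\<in>points X. \<forall>y\<in>points X. edist X x y = 0 \<longleftrightarrow> x = y) \<and>
     (\<forall>x\<in>points X. \<forall>y\<in>points X. edist X x y = edist X y x) \<and>
     (\<forall>x\<in>points X. \<forall>y\<in>points X. \<forall>z\<in>points X. edist X x z \<le> edist X x y + edist X y z)"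

definition etopology :: "('a, 'z) ext_space_scheme \<Rightarrow> 'a topology" where
  "etopology X = topology (\<lambda>U. U \<subseteq> points X \<and>
     (\<forall>x\<in>U. \<exists>r>0. \<forall>y\<in>points X. edist X x y < r \<longrightarrow> y \<in> U))"

lemma openin_etopology:
  "openin (etopology X) U \<longleftrightarrow> U \<subseteq> points X \<and>
     (\<forall>x\<in>U. \<exists>r>0. \<forall>y\<in>points X. edist X x y < r \<longrightarrow> y \<in> U)"
proof -
  have "istopology (\<lambda>U. U \<subseteq> points X \<and>
     (\<forall>x\<in>U. \<exists>r>0. \<forall>y\<in>points X. edist X x y < r \<longrightarrow> y \<in> U))"
    unfolding istopology_def
  proof (intro conjI allI impI, goal_cases)
    case (2 S T)
    show ?case
    proof (intro ballI)
      fix x assume "x \<in> S \<inter> T"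
      then obtain r s where "r > 0" "\<forall>y\<in>points X. edist X x y < r \<longrightarrow> y \<in> S"
        and "s > 0" "\<forall>y\<in>points X. edist X x y < s \<longrightarrow> y \<in> T"
        using 2 by blast
      then show "\<exists>r>0. \<forall>y\<in>points X. edist X x y < r \<longrightarrow> y \<in> S \<inter> T"
        by (intro exI[of _ "min r s"]) auto
    qed
  next
    case (4 \<K>)
    then show ?case by (meson UnionE UnionI)
  qed auto
  then show ?thesis
    by (simp add: etopology_def topology_inverse')
qed

definition curve :: "('a, 'z) ext_space_scheme \<Rightarrow> 'a \<Rightarrow> 'a \<Rightarrow> (real \<Rightarrow> 'a) \<Rightarrow> bool" where
  "curve X x y \<gamma> \<longleftrightarrow>
     continuous_map (top_of_set {0..1}) (etopology X) \<gamma> \<and> \<gamma> 0 = x \<and> \<gamma> 1 = y"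

definition curve_length :: "('a, 'z) ext_space_scheme \<Rightarrow> (real \<Rightarrow> 'a) \<Rightarrow> ennreal" where
  "curve_length X \<gamma> =
     (SUP (n, t) \<in> {(n :: nat, t :: nat \<Rightarrow> real). t 0 = 0 \<and> t n = 1 \<and> (\<forall>i<n. t i \<le> t (Suc i))}.
        \<Sum>i<n. edist X (\<gamma> (t i)) (\<gamma> (t (Suc i))))"

definition length_space :: "('a, 'z) ext_space_scheme \<Rightarrow> bool" where
  "length_space X \<longleftrightarrow> ext_metric X \<and>
     (\<forall>x\<in>points X. \<forall>y\<in>points X. edist X x y = (INF \<gamma> \<in> Collect (curve X x y). curve_length X \<gamma>))"

text \<open>An open neighbourhood of \<open>x\<close> that is isometric to \<open>n\<close> copies of \<open>[0, r)\<close> glued at \<open>0\<close>;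
  \<open>n\<close> is the valence of \<open>x\<close>.\<close>

definition star_nbhd ::
  "('a, 'z) ext_space_scheme \<Rightarrow> 'a \<Rightarrow> nat \<Rightarrow> real \<Rightarrow> (nat \<Rightarrow> real \<Rightarrow> 'a) \<Rightarrow> bool" where
  "star_nbhd X x n r \<sigma> \<longleftrightarrow> r > 0 \<and>
     openin (etopology X) (insert x (\<Union>i<n. \<sigma> i ` {0..<r})) \<and>
     (\<forall>i<n. \<sigma> i 0 = x) \<and>
     (\<forall>i<n. \<forall>j<n. \<forall>s\<in>{0..<r}. \<forall>t\<in>{0..<r}.
        edist X (\<sigma> i s) (\<sigma> j t) = ennreal (if i = j then \<bar>s - t\<bar> else s + t))"

definition metric_graph :: "('a, 'z) ext_space_scheme \<Rightarrow> bool" where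
  "metric_graph X \<longleftrightarrow> length_space X \<and> compact_space (etopology X) \<and>
     (\<forall>x\<in>points X. \<exists>n r \<sigma>. star_nbhd X x n r \<sigma>)"

text \<open>\<open>param M e\<close> is the identification of the (oriented, closed) edge \<open>e\<close> with \<open>[0, len M e]\<close>.\<close>

record ('a, 'e) modelled_graph = "'a ext_space" +
  verts :: "'a set"
  edges :: "'e set"
  len :: "'e \<Rightarrow> real"
  param :: "'e \<Rightarrow> real \<Rightarrow> 'a"

text \<open>Since \<open>V\<close> and \<open>E\<close> are finite and closed edges are compact, the open edges are automatically
  open in \<open>\<Gamma>\<close>, so that \<open>\<Gamma> - V\<close> is their topological disjoint union. The last condition says that the
  parametrisation of an edge is by arc length.\<close>

definition model :: "('a, 'e) modelled_graph \<Rightarrow> bool" where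
  "model M \<longleftrightarrow>
     finite (verts M) \<and> verts M \<subseteq> points M \<and> finite (edges M) \<and>
     (\<Union>e\<in>edges M. param M e ` {0<..<len M e}) = points M - verts M \<and>
     disjoint_family_on (\<lambda>e. param M e ` {0<..<len M e}) (edges M) \<and>
     (\<forall>e\<in>edges M. len M e > 0 \<and>
        continuous_map (top_of_set {0..len M e}) (etopology M) (param M e) \<and>
        param M e 0 \<in> verts M \<and> param M e (len M e) \<in> verts M \<and>
        inj_on (param M e) {0<..<len M e} \<and>
        (\<forall>t\<in>{0<..<len M e}. \<exists>\<delta>>0. \<forall>s\<in>ball t \<delta> \<inter> {0<..<len M e}. \<forall>s'\<in>ball t \<delta> \<inter> {0<..<len M e}.
           edist M (param M e s) (param M e s') = ennreal \<bar>s - s'\<bar>))"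

definition loopless :: "('a, 'e) modelled_graph \<Rightarrow> bool" where
  "loopless M \<longleftrightarrow> (\<forall>e\<in>edges M. param M e 0 \<noteq> param M e (len M e))"

text \<open>Divisors are functions vanishing outside a finite subset of \<open>\<Gamma>\<close>, with pointwise addition.\<close>

definition divisor :: "('a, 'z) ext_space_scheme \<Rightarrow> ('a \<Rightarrow> int) \<Rightarrow> bool" where
  "divisor X D \<longleftrightarrow> finite {x. D x \<noteq> 0} \<and> {x. D x \<noteq> 0} \<subseteq> points X"

definition effective :: "('a, 'z) ext_space_scheme \<Rightarrow> ('a \<Rightarrow> int) \<Rightarrow> bool" where
  "effective X D \<longleftrightarrow> divisor X D \<and> (\<forall>x. D x \<ge> 0)"

definition deg :: "('a \<Rightarrow> int) \<Rightarrow> int" where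
  "deg D = (\<Sum>x | D x \<noteq> 0. D x)"

definition piecewise_linear :: "real \<Rightarrow> (real \<Rightarrow> real) \<Rightarrow> bool" where
  "piecewise_linear L g \<longleftrightarrow> (\<exists>B. finite B \<and>
     (\<forall>a b. 0 \<le> a \<and> a < b \<and> b \<le> L \<and> {a<..<b} \<inter> B = {} \<longrightarrow>
        (\<exists>(m :: int) c. \<forall>t\<in>{a<..<b}. g t = of_int m * t + c)))"

definition rational_function :: "('a, 'e) modelled_graph \<Rightarrow> ('a \<Rightarrow> real) \<Rightarrow> bool" where
  "rational_function M f \<longleftrightarrow> continuous_map (etopology M) euclideanreal f \<and>
     (\<forall>e\<in>edges M. piecewise_linear (len M e) (f \<circ> param M e))"

text \<open>Outgoing slopes at \<open>t\<close>, in the direction of increasing and of decreasing parameter.\<close>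

definition slope_right :: "(real \<Rightarrow> real) \<Rightarrow> real \<Rightarrow> int" where
  "slope_right g t = (THE m. \<forall>\<^sub>F s in at_right t. g s = g t + of_int m * (s - t))"

definition slope_left :: "(real \<Rightarrow> real) \<Rightarrow> real \<Rightarrow> int" where
  "slope_left g t = (THE m. \<forall>\<^sub>F s in at_left t. g s = g t + of_int m * (t - s))"

text \<open>The directions at \<open>x\<close> are given by the parameters \<open>t\<close> with \<open>param M e t = x\<close>: such a \<open>t\<close> contributes
  an increasing direction unless \<open>t = len M e\<close>, and a decreasing one unless \<open>t = 0\<close>.\<close>

definition ord_at :: "('a, 'e) modelled_graph \<Rightarrow> ('a \<Rightarrow> real) \<Rightarrow> 'a \<Rightarrow> int" where
  "ord_at M f x = (\<Sum>e\<in>edges M.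
     (\<Sum>t | t \<in> {0..<len M e} \<and> param M e t = x. slope_right (f \<circ> param M e) t) +
     (\<Sum>t | t \<in> {0<..len M e} \<and> param M e t = x. slope_left (f \<circ> param M e) t))"

definition principal :: "('a, 'e) modelled_graph \<Rightarrow> ('a \<Rightarrow> real) \<Rightarrow> ('a \<Rightarrow> int)" where
  "principal M f = (\<lambda>x. ord_at M f x)"

definition lin_equiv :: "('a, 'e) modelled_graph \<Rightarrow> ('a \<Rightarrow> int) \<Rightarrow> ('a \<Rightarrow> int) \<Rightarrow> bool" where
  "lin_equiv M D D' \<longleftrightarrow> (\<exists>f. rational_function M f \<and> D - D' = principal M f)"

definition linear_system :: "('a, 'e) modelled_graph \<Rightarrow> ('a \<Rightarrow> int) \<Rightarrow> ('a \<Rightarrow> int) set" where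
  "linear_system M D = {D'. effective M D' \<and> lin_equiv M D' D}"

definition div_rank :: "('a, 'e) modelled_graph \<Rightarrow> ('a \<Rightarrow> int) \<Rightarrow> int" where
  "div_rank M D = (if linear_system M D = {} then -1
     else int (GREATEST k. \<forall>E. effective M E \<and> deg E = int k \<longrightarrow> linear_system M (D - E) \<noteq> {}))"

record ('a, 'e) cell_data =
  vert_mult :: "'a \<Rightarrow> nat"
  edge_mult :: "'e \<Rightarrow> nat list"
  init_slope :: "'e \<Rightarrow> int"

text \<open>\<open>x e i\<close> is the position of the \<open>i\<close>-th group of chips on the edge \<open>e\<close>; unused coordinates are \<open>0\<close>.
  The values of the cell data outside \<open>verts M\<close> and \<open>edges M\<close> are irrelevant.\<close>

definition chip_positions ::
  "('a, 'e) modelled_graph \<Rightarrow> ('a, 'e) cell_data \<Rightarrow> ('a \<Rightarrow> int) \<Rightarrow> ('e \<Rightarrow> nat \<Rightarrow> real) \<Rightarrow> bool" where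
  "chip_positions M c D x \<longleftrightarrow>
     (\<forall>v\<in>verts M. D v = int (vert_mult c v)) \<and>
     (\<forall>e\<in>edges M.
        (\<forall>m\<in>set (edge_mult c e). m > 0) \<and>
        (\<forall>i<length (edge_mult c e). x e i \<in> {0<..<len M e}) \<and>
        (\<forall>i j. i < j \<and> j < length (edge_mult c e) \<longrightarrow> x e i < x e j) \<and>
        (\<forall>t\<in>{0<..<len M e}. D (param M e t) =
           (\<Sum>i<length (edge_mult c e). if x e i = t then int (edge_mult c e ! i) else 0))) \<and>
     (\<forall>e i. e \<notin> edges M \<or> i \<ge> length (edge_mult c e) \<longrightarrow> x e i = 0)"

definition open_cell ::
  "('a, 'e) modelled_graph \<Rightarrow> ('a \<Rightarrow> int) \<Rightarrow> ('a, 'e) cell_data \<Rightarrow> ('a \<Rightarrow> int) set" where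
  "open_cell M D0 c = {D \<in> linear_system M D0. (\<exists>x. chip_positions M c D x) \<and>
     (\<exists>f. rational_function M f \<and> D = D0 + principal M f \<and>
        (\<forall>e\<in>edges M. slope_right (f \<circ> param M e) 0 = init_slope c e))}"

text \<open>\<open>|D0|\<close> is topologised as a subset of the symmetric product \<open>\<Gamma>\<^sup>n / S\<^sub>n\<close>: two effective divisors
  are \<open>\<epsilon>\<close>-close if they are sums of the same number of points that are pairwise \<open>\<epsilon>\<close>-close.\<close>

definition close_divisors ::
  "('a, 'z) ext_space_scheme \<Rightarrow> real \<Rightarrow> ('a \<Rightarrow> int) \<Rightarrow> ('a \<Rightarrow> int) \<Rightarrow> bool" where
  "close_divisors X \<epsilon> D D' \<longleftrightarrow> (\<exists>(n :: nat) p q.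
     (\<forall>i<n. p i \<in> points X \<and> q i \<in> points X \<and> edist X (p i) (q i) < ennreal \<epsilon>) \<and>
     D = (\<lambda>x. int (card {i. i < n \<and> p i = x})) \<and>
     D' = (\<lambda>x. int (card {i. i < n \<and> q i = x})))"

definition cell ::
  "('a, 'e) modelled_graph \<Rightarrow> ('a \<Rightarrow> int) \<Rightarrow> ('a, 'e) cell_data \<Rightarrow> ('a \<Rightarrow> int) set" where
  "cell M D0 c = {D \<in> linear_system M D0. \<forall>\<epsilon>>0. \<exists>D'\<in>open_cell M D0 c. close_divisors M \<epsilon> D D'}"

definition maximal_cell ::
  "('a, 'e) modelled_graph \<Rightarrow> ('a \<Rightarrow> int) \<Rightarrow> ('a, 'e) cell_data \<Rightarrow> bool" where
  "maximal_cell M D0 c \<longleftrightarrow> open_cell M D0 c \<noteq> {} \<and>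
     (\<forall>c'. open_cell M D0 c' \<noteq> {} \<and> cell M D0 c \<subseteq> cell M D0 c' \<longrightarrow> cell M D0 c' = cell M D0 c)"

definition generic :: "('a, 'e) modelled_graph \<Rightarrow> ('a \<Rightarrow> int) \<Rightarrow> ('a \<Rightarrow> int) \<Rightarrow> bool" where
  "generic M D0 D \<longleftrightarrow> (\<exists>c. maximal_cell M D0 c \<and> D \<in> open_cell M D0 c)"

text \<open>The cell as a polyhedron in the coordinates given by the positions of the chips. The closure is
  taken in the product topology; all but finitely many coordinates vanish.\<close>

definition cell_polyhedron ::
  "('a, 'e) modelled_graph \<Rightarrow> ('a \<Rightarrow> int) \<Rightarrow> ('a, 'e) cell_data \<Rightarrow> ('e \<Rightarrow> nat \<Rightarrow> real) set" where
  "cell_polyhedron M D0 c = closure {x. \<exists>D\<in>open_cell M D0 c. chip_positions M c D x}"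

definition coord_scale :: "real \<Rightarrow> ('e \<Rightarrow> nat \<Rightarrow> real) \<Rightarrow> ('e \<Rightarrow> nat \<Rightarrow> real)" where
  "coord_scale r x = (\<lambda>e i. r * x e i)"

lemma vector_space_coord_scale: "vector_space coord_scale"
  by unfold_locales (auto simp: coord_scale_def fun_eq_iff algebra_simps)

text \<open>The dimension of a nonempty polyhedron is that of the space spanned by differences of its points
  (\<open>aff_dim\<close> is not available here, the number of coordinates being dependent on \<open>c\<close>).\<close>

definition polyhedron_dim :: "('e \<Rightarrow> nat \<Rightarrow> real) set \<Rightarrow> nat" where
  "polyhedron_dim P = vector_space.dim coord_scale {x - y | x y. x \<in> P \<and> y \<in> P}"

definition cell_dim :: "('a, 'e) modelled_graph \<Rightarrow> ('a \<Rightarrow> int) \<Rightarrow> ('a, 'e) cell_data \<Rightarrow> nat" where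
  "cell_dim M D0 c = polyhedron_dim (cell_polyhedron M D0 c)"

end

(* Suppose D + div f >= 0 and let B be the set where f attains its maximum on a component of the graph.
   Then D has enough chips on the boundary of B to fire B, that is, to move one chip by a small distance
   along every direction leaving B. For each divisor in the open cell of D the corresponding set can be
   fired, and all the results lie in one open cell, whose closure therefore contains the cell of D. If a
   boundary point of B were a vertex, or a chip leaving B in two directions, then firing would increase
   the number of occupied points inside the edges, so that the new cell would be strictly larger. Hence,
   for generic D, the set B is bounded by chips that leave it in one direction only, and so it is a union
   of pieces, a piece being a component of the graph minus the chips of D inside the edges.

   Fix a component of the graph containing an edge, with n pieces, and let E be the sum of one unoccupied
   point in each. If r(D) >= n, there is f with D + div f >= E; but B contains one of these points, where
   D and div f vanish. Hence r(D) <= n - 1. Conversely, every function that is constant on pieces is the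
   derivative of a potential that moves the chips of D inside its cell; modulo the functions that are
   constant on components, these directions are independent, and the dimension of the cell is at least
   n - 1. *)

theory Submission
  imports Defs "HOL-Combinatorics.Permutations"
begin

section \<open>Topology and piecewise linear functions\<close>

lemma topspace_etopology [simp]: "topspace (etopology X) = points X"
proof
  show "topspace (etopology X) \<subseteq> points X"
    using openin_topspace[of "etopology X"] by (simp only: openin_etopology)
  have "openin (etopology X) (points X)"
    unfolding openin_etopology by (auto intro: exI[of _ 1])
  then show "points X \<subseteq> topspace (etopology X)"
    by (rule openin_subset)
qed

lemma edist_refl: "ext_metric X \<Longrightarrow> x \<in> points X \<Longrightarrow> edist X x x = 0"
  by (simp add: ext_metric_def)

lemma edist_pos: "ext_metric X \<Longrightarrow> x \<in> points X \<Longrightarrow> y \<in> points X \<Longrightarrow> x \<noteq> y \<Longrightarrow> edist X x y > 0"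
  unfolding ext_metric_def by (metis not_gr_zero)

lemma edist_sym: "ext_metric X \<Longrightarrow> x \<in> points X \<Longrightarrow> y \<in> points X \<Longrightarrow> edist X x y = edist X y x"
  unfolding ext_metric_def by blast

lemma edist_triangle:
  "ext_metric X \<Longrightarrow> x \<in> points X \<Longrightarrow> y \<in> points X \<Longrightarrow> z \<in> points X \<Longrightarrow>
    edist X x z \<le> edist X x y + edist X y z"
  unfolding ext_metric_def by blast

lemma openin_eball:
  assumes "ext_metric X" "x \<in> points X"
  shows "openin (etopology X) {y \<in> points X. edist X x y < r}"
  unfolding openin_etopology
proof (intro conjI ballI)
  fix y assume y: "y \<in> {y \<in> points X. edist X x y < r}"
  have "\<forall>z\<in>points X. edist X y z < r - edist X x y \<longrightarrow> edist X x z < r"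
  proof (intro ballI impI)
    fix z assume z: "z \<in> points X" "edist X y z < r - edist X x y"
    have "edist X x z \<le> edist X x y + edist X y z"
      using assms y z unfolding ext_metric_def by blast
    also have "\<dots> < r"
      using y z less_diff_eq_ennreal[where a = "edist X y z" and b = r and c = "edist X x y"]
        order_less_le_trans[of "edist X x y" r top]
      by (simp add: add.commute)
    finally show "edist X x z < r" .
  qed
  moreover have "r - edist X x y > 0"
    using y by (simp add: diff_gr0_ennreal order_le_less_trans)
  ultimately show "\<exists>s>0. \<forall>z\<in>points X. edist X y z < s \<longrightarrow> z \<in> {y \<in> points X. edist X x y < r}"
    by (intro exI[of _ "r - edist X x y"]) auto
qed auto

lemma ennreal_half:
  fixes d :: ennreal
  assumes "d > 0"
  obtains r where "r > 0" "ennreal r + ennreal r \<le> d"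
proof (cases "d = \<infinity>")
  case True
  then show ?thesis using that[of 1] by simp
next
  case False
  then obtain c where c: "d = ennreal c" "c > 0"
    using assms by (metis ennreal_cases ennreal_less_zero_iff infinity_ennreal_def)
  show ?thesis using that[of "c / 2"] c
    by (simp add: ennreal_plus[symmetric] del: ennreal_plus)
qed

lemma Hausdorff_etopology:
  assumes "ext_metric X"
  shows "Hausdorff_space (etopology X)"
  unfolding Hausdorff_space_def topspace_etopology
proof (intro allI impI)
  fix x y assume xy: "x \<in> points X \<and> y \<in> points X \<and> x \<noteq> y"
  then have "edist X x y > 0"
    using edist_pos[OF assms] by blast
  then obtain r where r: "r > 0" "ennreal r + ennreal r \<le> edist X x y"
    by (rule ennreal_half)
  define U where "U = (\<lambda>z. {w \<in> points X. edist X z w < ennreal r})"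
  have "openin (etopology X) (U x)" "openin (etopology X) (U y)"
    using xy openin_eball[OF assms] by (auto simp: U_def)
  moreover have "x \<in> U x" "y \<in> U y"
    using xy assms r by (simp_all add: U_def edist_refl)
  moreover have "disjnt (U x) (U y)"
  proof (rule ccontr)
    assume "\<not> disjnt (U x) (U y)"
    then obtain z where z: "z \<in> points X" "edist X x z < ennreal r" "edist X y z < ennreal r"
      unfolding disjnt_iff U_def by blast
    have "edist X x y \<le> edist X x z + edist X y z"
      using edist_triangle[OF assms, of x z y] edist_sym[OF assms, of y z] xy z by simp
    also have "\<dots> < ennreal r + ennreal r"
      using z by (intro add_strict_mono)
    finally show False using r by simp
  qed
  ultimately show "\<exists>U V. openin (etopology X) U \<and> openin (etopology X) V \<and> x \<in> U \<and> y \<in> V \<and> disjnt U V"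
    by blast
qed

lemma eventually_at_right_interval:
  fixes t :: real assumes "t < b" shows "\<forall>\<^sub>F s in at_right t. s \<in> {t<..<b}"
  using assms by (auto simp: eventually_at_right_field intro: exI[of _ b])

lemma eventually_at_left_interval:
  fixes t :: real assumes "b < t" shows "\<forall>\<^sub>F s in at_left t. s \<in> {b<..<t}"
  using assms by (auto simp: eventually_at_left_field intro: exI[of _ b])

lemma slope_right_eqI:
  assumes "\<forall>\<^sub>F s in at_right t. g s = g t + of_int m * (s - t)"
  shows "slope_right g t = m"
  unfolding slope_right_def
proof (rule the_equality)
  fix m' assume "\<forall>\<^sub>F s in at_right t. g s = g t + of_int m' * (s - t)"
  with assms eventually_at_right_interval[of t "t + 1", simplified]
  have "\<forall>\<^sub>F s in at_right t. s > t \<and> of_int m * (s - t) = of_int m' * (s - t)"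
    by eventually_elim auto
  then show "m' = m"
    using eventually_happens'[OF trivial_limit_at_right_real] by force
qed (fact assms)

lemma slope_left_eqI:
  assumes "\<forall>\<^sub>F s in at_left t. g s = g t + of_int m * (t - s)"
  shows "slope_left g t = m"
  unfolding slope_left_def
proof (rule the_equality)
  fix m' assume "\<forall>\<^sub>F s in at_left t. g s = g t + of_int m' * (t - s)"
  with assms eventually_at_left_interval[of "t - 1" t, simplified]
  have "\<forall>\<^sub>F s in at_left t. s < t \<and> of_int m * (t - s) = of_int m' * (t - s)"
    by eventually_elim auto
  then show "m' = m"
    using eventually_happens'[OF trivial_limit_at_left_real] by force
qed (fact assms)

lemma finite_gap_right:
  fixes t :: real assumes "finite B" "t < L"
  obtains b where "t < b" "b \<le> L" "{t<..<b} \<inter> B = {}"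
proof -
  define b where "b = Min (insert L {x \<in> B. x > t})"
  have fin: "finite (insert L {x \<in> B. x > t})" using assms by simp
  have "t < b" "b \<le> L" unfolding b_def using assms fin by auto
  moreover have "{t<..<b} \<inter> B = {}"
    unfolding b_def using fin by (auto simp: Min_gr_iff)
  ultimately show ?thesis using that by blast
qed

lemma finite_gap_left:
  fixes t :: real assumes "finite B" "L < t"
  obtains b where "b < t" "L \<le> b" "{b<..<t} \<inter> B = {}"
proof -
  define b where "b = Max (insert L {x \<in> B. x < t})"
  have fin: "finite (insert L {x \<in> B. x < t})" using assms by simp
  have "b < t" "L \<le> b" unfolding b_def using assms fin by auto
  moreover have "{b<..<t} \<inter> B = {}"
    unfolding b_def using fin by (auto simp: Max_less_iff)
  ultimately show ?thesis using that by blast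
qed

lemma piecewise_linear_slope_right:
  assumes "piecewise_linear L g" "continuous_on {0..L} g" "0 \<le> t" "t < L"
  shows "\<forall>\<^sub>F s in at_right t. g s = g t + of_int (slope_right g t) * (s - t)"
proof -
  from assms(1) obtain B where B: "finite B"
    "\<And>a b. 0 \<le> a \<and> a < b \<and> b \<le> L \<and> {a<..<b} \<inter> B = {} \<Longrightarrow>
        \<exists>(m :: int) c. \<forall>t\<in>{a<..<b}. g t = of_int m * t + c"
    unfolding piecewise_linear_def by blast
  obtain b where b: "t < b" "b \<le> L" "{t<..<b} \<inter> B = {}"
    using finite_gap_right[OF B(1) assms(4)] .
  with B(2)[of t b] assms(3) obtain m :: int and c where m: "\<forall>s\<in>{t<..<b}. g s = of_int m * s + c"
    by auto
  have ev: "\<forall>\<^sub>F s in at_right t. g s = of_int m * s + c"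
    using eventually_at_right_interval[OF b(1)] by eventually_elim (use m in auto)
  have "(g \<longlongrightarrow> g t) (at t within {0..L})"
    using assms by (auto simp: continuous_on_def)
  then have "(g \<longlongrightarrow> g t) (at t within {t..b})"
    by (rule tendsto_within_subset) (use assms b in auto)
  then have "(g \<longlongrightarrow> g t) (at_right t)"
    using b by (simp add: at_within_Icc_at_right)
  moreover have "((\<lambda>s. of_int m * s + c) \<longlongrightarrow> of_int m * t + c) (at_right t)"
    by (intro tendsto_intros)
  then have "(g \<longlongrightarrow> of_int m * t + c) (at_right t)"
    using ev by (subst tendsto_cong) auto
  ultimately have gt: "g t = of_int m * t + c"
    using tendsto_unique trivial_limit_at_right_real by blast
  have "\<forall>\<^sub>F s in at_right t. g s = g t + of_int m * (s - t)"
    using ev by eventually_elim (simp add: gt algebra_simps)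
  then show ?thesis using slope_right_eqI[of g t m] by simp
qed

lemma piecewise_linear_slope_left:
  assumes "piecewise_linear L g" "continuous_on {0..L} g" "0 < t" "t \<le> L"
  shows "\<forall>\<^sub>F s in at_left t. g s = g t + of_int (slope_left g t) * (t - s)"
proof -
  from assms(1) obtain B where B: "finite B"
    "\<And>a b. 0 \<le> a \<and> a < b \<and> b \<le> L \<and> {a<..<b} \<inter> B = {} \<Longrightarrow>
        \<exists>(m :: int) c. \<forall>t\<in>{a<..<b}. g t = of_int m * t + c"
    unfolding piecewise_linear_def by blast
  obtain b where b: "b < t" "0 \<le> b" "{b<..<t} \<inter> B = {}"
    using finite_gap_left[OF B(1) assms(3)] .
  with B(2)[of b t] assms(4) obtain m :: int and c where m: "\<forall>s\<in>{b<..<t}. g s = of_int m * s + c"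
    by auto
  have ev: "\<forall>\<^sub>F s in at_left t. g s = of_int m * s + c"
    using eventually_at_left_interval[OF b(1)] by eventually_elim (use m in auto)
  have "(g \<longlongrightarrow> g t) (at t within {0..L})"
    using assms by (auto simp: continuous_on_def)
  then have "(g \<longlongrightarrow> g t) (at t within {b..t})"
    by (rule tendsto_within_subset) (use assms b in auto)
  then have "(g \<longlongrightarrow> g t) (at_left t)"
    using b by (simp add: at_within_Icc_at_left)
  moreover have "((\<lambda>s. of_int m * s + c) \<longlongrightarrow> of_int m * t + c) (at_left t)"
    by (intro tendsto_intros)
  then have "(g \<longlongrightarrow> of_int m * t + c) (at_left t)"
    using ev by (subst tendsto_cong) auto
  ultimately have gt: "g t = of_int m * t + c"
    using tendsto_unique trivial_limit_at_left_real by blast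
  have "\<forall>\<^sub>F s in at_left t. g s = g t + of_int (- m) * (t - s)"
    using ev by eventually_elim (simp add: gt algebra_simps)
  then show ?thesis using slope_left_eqI[of g t "- m"] by simp
qed

lemma piecewise_linear_max_const:
  assumes pl: "piecewise_linear L g" and cont: "continuous_on {0..L} g"
    and ab: "0 \<le> a" "a < b" "b \<le> L"
    and conv: "\<And>t. a < t \<Longrightarrow> t < b \<Longrightarrow> slope_right g t + slope_left g t \<ge> 0"
    and le: "\<And>t. a < t \<Longrightarrow> t < b \<Longrightarrow> g t \<le> m"
    and t0: "a < t0" "t0 < b" "g t0 = m"
    and t: "a \<le> t" "t \<le> b"
  shows "g t = m"
proof -
  define S where "S = {t \<in> {a<..<b}. g t = m}"
  have near: "\<forall>\<^sub>F s in nhds t. s \<in> S" if t: "t \<in> S" for t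
  proof -
    have tt: "a < t" "t < b" "g t = m" using t by (auto simp: S_def)
    have R: "\<forall>\<^sub>F s in at_right t. g s = g t + of_int (slope_right g t) * (s - t)"
      using piecewise_linear_slope_right[OF pl cont, of t] tt(1,2) ab by simp
    have L: "\<forall>\<^sub>F s in at_left t. g s = g t + of_int (slope_left g t) * (t - s)"
      using piecewise_linear_slope_left[OF pl cont, of t] tt(1,2) ab by simp
    from R eventually_at_right_interval[OF tt(2)]
    have "\<forall>\<^sub>F s in at_right t. of_int (slope_right g t) * (s - t) \<le> 0 \<and> s > t"
    proof eventually_elim
      case (elim s) then show ?case using le[of s] tt by auto
    qed
    then have "slope_right g t \<le> 0"
      using eventually_happens'[OF trivial_limit_at_right_real] by (force simp: mult_le_0_iff)
    moreover from L eventually_at_left_interval[OF tt(1)]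
    have "\<forall>\<^sub>F s in at_left t. of_int (slope_left g t) * (t - s) \<le> 0 \<and> s < t"
    proof eventually_elim
      case (elim s) then show ?case using le[of s] tt by auto
    qed
    then have "slope_left g t \<le> 0"
      using eventually_happens'[OF trivial_limit_at_left_real] by (force simp: mult_le_0_iff)
    ultimately have z: "slope_right g t = 0" "slope_left g t = 0"
      using conv[OF tt(1,2)] by auto
    have "\<forall>\<^sub>F s in at_right t. s \<in> S"
      using R eventually_at_right_interval[OF tt(2)]
      by eventually_elim (use z tt in \<open>auto simp: S_def\<close>)
    moreover have "\<forall>\<^sub>F s in at_left t. s \<in> S"
      using L eventually_at_left_interval[OF tt(1)]
      by eventually_elim (use z tt in \<open>auto simp: S_def\<close>)
    ultimately have "\<forall>\<^sub>F s in at t. s \<in> S"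
      by (simp add: eventually_at_split)
    then show ?thesis using t by (simp add: eventually_nhds_conv_at)
  qed
  have "open S"
    by (rule open_subopen[THEN iffD2]) (use near[unfolded eventually_nhds] in \<open>metis subsetI\<close>)
  then have "openin (top_of_set {a<..<b}) S"
    by (rule open_openin_trans[OF open_greaterThanLessThan]) (auto simp: S_def)
  moreover have cont': "continuous_on {a<..<b} g"
    by (rule continuous_on_subset[OF cont]) (use ab in auto)
  have "closedin (top_of_set {a<..<b}) S"
    using continuous_closedin_preimage_constant[OF cont', of m] by (simp add: S_def)
  moreover have "connected {a<..<b}" by simp
  moreover have "t0 \<in> S" "S \<subseteq> {a<..<b}" using t0 by (auto simp: S_def)
  ultimately have S: "S = {a<..<b}"
    unfolding connected_clopen by blast
  have "continuous_on {a..b} g"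
    by (rule continuous_on_subset[OF cont]) (use ab in auto)
  moreover have "\<And>x. x \<in> {a<..<b} \<Longrightarrow> g x = m" using S unfolding S_def by blast
  ultimately show ?thesis
    using continuous_constant_on_closure[of "{a<..<b}" g m t] ab t
    by (simp add: closure_greaterThanLessThan)
qed

definition ord_edge :: "(real \<Rightarrow> real) \<Rightarrow> real \<Rightarrow> real \<Rightarrow> int" where
  "ord_edge g L t = (if t < L then slope_right g t else 0) + (if 0 < t then slope_left g t else 0)"

definition hinge :: "real \<Rightarrow> real \<Rightarrow> real" where
  "hinge y t = max 0 (t - y)"

lemma hinge_right: "\<forall>\<^sub>F s in at_right t. hinge y s = hinge y t + of_bool (y \<le> t) * (s - t)"
proof (cases "y \<le> t")
  case True
  with eventually_at_right_interval[of t "t + 1", simplified] show ?thesis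
    by (auto simp: hinge_def elim: eventually_mono)
next
  case False
  with eventually_at_right_interval[of t y] show ?thesis
    by (auto simp: hinge_def elim!: eventually_mono)
qed

lemma hinge_left: "\<forall>\<^sub>F s in at_left t. hinge y s = hinge y t + - of_bool (y < t) * (t - s)"
proof (cases "y < t")
  case True
  with eventually_at_left_interval[of y t] show ?thesis
    by (auto simp: hinge_def elim!: eventually_mono)
next
  case False
  with eventually_at_left_interval[of "t - 1" t, simplified] show ?thesis
    by (auto simp: hinge_def elim!: eventually_mono)
qed

lemma continuous_on_hinge: "continuous_on S (hinge y)"
  unfolding hinge_def by (intro continuous_intros)

definition moves :: "'i set \<Rightarrow> ('i \<Rightarrow> int) \<Rightarrow> ('i \<Rightarrow> real) \<Rightarrow> ('i \<Rightarrow> real) \<Rightarrow> real \<Rightarrow> real" where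
  "moves A w p q t = (\<Sum>a\<in>A. of_int (w a) * (hinge (q a) t - hinge (p a) t))"

lemma moves_right:
  assumes "finite A"
  shows "\<forall>\<^sub>F s in at_right t. moves A w p q s =
    moves A w p q t + of_int (\<Sum>a\<in>A. w a * (of_bool (q a \<le> t) - of_bool (p a \<le> t))) * (s - t)"
proof -
  have "\<forall>\<^sub>F s in at_right t. \<forall>a\<in>A.
      hinge (q a) s = hinge (q a) t + of_bool (q a \<le> t) * (s - t) \<and>
      hinge (p a) s = hinge (p a) t + of_bool (p a \<le> t) * (s - t)"
    using assms by (intro eventually_ball_finite ballI eventually_conj hinge_right)
  then show ?thesis
  proof eventually_elim
    case (elim s)
    then show ?case
      by (simp add: moves_def sum_distrib_right sum.distrib[symmetric])
        (intro sum.cong refl, auto simp: algebra_simps)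
  qed
qed

lemma moves_left:
  assumes "finite A"
  shows "\<forall>\<^sub>F s in at_left t. moves A w p q s =
    moves A w p q t + of_int (- (\<Sum>a\<in>A. w a * (of_bool (q a < t) - of_bool (p a < t)))) * (t - s)"
proof -
  have "\<forall>\<^sub>F s in at_left t. \<forall>a\<in>A.
      hinge (q a) s = hinge (q a) t + - of_bool (q a < t) * (t - s) \<and>
      hinge (p a) s = hinge (p a) t + - of_bool (p a < t) * (t - s)"
    using assms by (intro eventually_ball_finite ballI eventually_conj hinge_left)
  then show ?thesis
  proof eventually_elim
    case (elim s)
    then show ?case
      by (simp add: moves_def sum_distrib_right sum.distrib[symmetric] sum_negf[symmetric])
        (intro sum.cong refl, auto simp: algebra_simps)
  qed
qed

lemma piecewise_linear_moves:
  assumes "finite A"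
  shows "piecewise_linear L (\<lambda>t. c + moves A w p q t)"
  unfolding piecewise_linear_def
proof (intro exI[of _ "q ` A \<union> p ` A"] conjI allI impI)
  show "finite (q ` A \<union> p ` A)" using assms by simp
  fix a b assume ab: "0 \<le> a \<and> a < b \<and> b \<le> L \<and> {a<..<b} \<inter> (q ` A \<union> p ` A) = {}"
  have h: "hinge y t = of_bool (y \<le> a) * t + of_bool (y \<le> a) * (- y)"
    if "y \<in> q ` A \<union> p ` A" "t \<in> {a<..<b}" for y t
  proof -
    have "y \<notin> {a<..<b}" using ab that by blast
    then show ?thesis using that by (auto simp: hinge_def)
  qed
  show "\<exists>(m :: int) d. \<forall>t\<in>{a<..<b}. c + moves A w p q t = of_int m * t + d"
  proof (intro exI ballI)
    fix t assume t: "t \<in> {a<..<b}"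
    have "moves A w p q t = (\<Sum>i\<in>A. of_int (w i) *
        ((of_bool (q i \<le> a) * t + of_bool (q i \<le> a) * (- q i)) -
         (of_bool (p i \<le> a) * t + of_bool (p i \<le> a) * (- p i))))"
      unfolding moves_def using h t by (intro sum.cong refl) simp
    also have "\<dots> = of_int (\<Sum>i\<in>A. w i * (of_bool (q i \<le> a) - of_bool (p i \<le> a))) * t +
        (\<Sum>i\<in>A. of_int (w i) * (of_bool (q i \<le> a) * (- q i) - of_bool (p i \<le> a) * (- p i)))"
      unfolding of_int_sum sum_distrib_right sum.distrib[symmetric]
      by (intro sum.cong refl) (auto simp: algebra_simps)
    finally show "c + moves A w p q t =
      of_int (\<Sum>i\<in>A. w i * (of_bool (q i \<le> a) - of_bool (p i \<le> a))) * t +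
      (c + (\<Sum>i\<in>A. of_int (w i) * (of_bool (q i \<le> a) * (- q i) - of_bool (p i \<le> a) * (- p i))))"
      by simp
  qed
qed

lemma piecewise_linear_cong:
  assumes "piecewise_linear L g" "\<And>t. t \<in> {0..L} \<Longrightarrow> f t = g t"
  shows "piecewise_linear L f"
proof -
  from assms(1) obtain B where B: "finite B"
    "\<And>a b. 0 \<le> a \<and> a < b \<and> b \<le> L \<and> {a<..<b} \<inter> B = {} \<Longrightarrow>
        \<exists>(m :: int) c. \<forall>t\<in>{a<..<b}. g t = of_int m * t + c"
    unfolding piecewise_linear_def by blast
  have "\<exists>(m :: int) c. \<forall>t\<in>{a<..<b}. f t = of_int m * t + c"
    if ab: "0 \<le> a \<and> a < b \<and> b \<le> L \<and> {a<..<b} \<inter> B = {}" for a b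
  proof -
    from B(2)[OF ab] obtain m :: int and c where "\<forall>t\<in>{a<..<b}. g t = of_int m * t + c" by blast
    then have "\<forall>t\<in>{a<..<b}. f t = of_int m * t + c" using assms(2) ab by auto
    then show ?thesis by blast
  qed
  then show ?thesis unfolding piecewise_linear_def using B(1) by blast
qed

lemma piecewise_linear_add:
  assumes "piecewise_linear L f" "piecewise_linear L g"
  shows "piecewise_linear L (\<lambda>t. f t + g t)"
proof -
  from assms(1) obtain A where A: "finite A"
    "\<And>a b. 0 \<le> a \<and> a < b \<and> b \<le> L \<and> {a<..<b} \<inter> A = {} \<Longrightarrow>
        \<exists>(m :: int) c. \<forall>t\<in>{a<..<b}. f t = of_int m * t + c"
    unfolding piecewise_linear_def by blast
  from assms(2) obtain B where B: "finite B"
    "\<And>a b. 0 \<le> a \<and> a < b \<and> b \<le> L \<and> {a<..<b} \<inter> B = {} \<Longrightarrow>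
        \<exists>(m :: int) c. \<forall>t\<in>{a<..<b}. g t = of_int m * t + c"
    unfolding piecewise_linear_def by blast
  show ?thesis
    unfolding piecewise_linear_def
  proof (intro exI[of _ "A \<union> B"] conjI allI impI)
    fix a b assume ab: "0 \<le> a \<and> a < b \<and> b \<le> L \<and> {a<..<b} \<inter> (A \<union> B) = {}"
    then obtain m m' :: int and c c' where "\<forall>t\<in>{a<..<b}. f t = of_int m * t + c"
      "\<forall>t\<in>{a<..<b}. g t = of_int m' * t + c'"
      using A(2)[of a b] B(2)[of a b] by (auto simp: Int_Un_distrib)
    then have "\<forall>t\<in>{a<..<b}. f t + g t = of_int (m + m') * t + (c + c')"
      by (simp add: algebra_simps)
    then show "\<exists>(m :: int) c. \<forall>t\<in>{a<..<b}. f t + g t = of_int m * t + c" by blast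
  qed (use A B in simp)
qed

section \<open>Principal divisors\<close>

locale metrized_model =
  fixes M :: "('a, 'e) modelled_graph"
  assumes metric: "ext_metric M" and model: "model M"
begin

lemma finite_verts: "finite (verts M)" and finite_edges: "finite (edges M)"
  and verts_subset: "verts M \<subseteq> points M"
  using model by (auto simp: model_def)

lemma len_pos: "e \<in> edges M \<Longrightarrow> len M e > 0"
  and param_continuous: "e \<in> edges M \<Longrightarrow>
    continuous_map (top_of_set {0..len M e}) (etopology M) (param M e)"
  and param_0: "e \<in> edges M \<Longrightarrow> param M e 0 \<in> verts M"
  and param_len: "e \<in> edges M \<Longrightarrow> param M e (len M e) \<in> verts M"
  using model by (auto simp: model_def)

lemma param_points: "e \<in> edges M \<Longrightarrow> t \<in> {0..len M e} \<Longrightarrow> param M e t \<in> points M"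
  using continuous_map_image_subset_topspace[OF param_continuous] by fastforce

lemma param_interior:
  assumes "e \<in> edges M" "t \<in> {0<..<len M e}"
  shows "param M e t \<notin> verts M"
proof -
  have "param M e t \<in> (\<Union>e\<in>edges M. param M e ` {0<..<len M e})" using assms by blast
  then show ?thesis using model by (auto simp: model_def)
qed

lemma param_inj:
  assumes "e \<in> edges M" "e' \<in> edges M" "t \<in> {0<..<len M e}" "t' \<in> {0..len M e'}"
    and eq: "param M e t = param M e' t'"
  shows "e = e'" "t = t'"
proof -
  have "param M e' t' \<notin> verts M" using param_interior assms by metis
  then have t': "t' \<in> {0<..<len M e'}"
    using assms(4) param_0[OF assms(2)] param_len[OF assms(2)] by (cases "t' = 0 \<or> t' = len M e'") auto
  have "disjoint_family_on (\<lambda>e. param M e ` {0<..<len M e}) (edges M)"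
    using model by (simp add: model_def)
  then show e: "e = e'"
    using assms t' unfolding disjoint_family_on_def by (metis IntI empty_iff imageI)
  have "inj_on (param M e) {0<..<len M e}" using model assms by (auto simp: model_def)
  then show "t = t'" using t' assms e by (auto dest: inj_onD)
qed

lemma points_cases:
  assumes "x \<in> points M"
  obtains "x \<in> verts M" | e t where "e \<in> edges M" "t \<in> {0<..<len M e}" "x = param M e t"
proof -
  have "(\<Union>e\<in>edges M. param M e ` {0<..<len M e}) = points M - verts M"
    using model by (simp add: model_def)
  then show ?thesis using that assms by blast
qed

lemma finite_fibre:
  assumes "e \<in> edges M"
  shows "finite {t \<in> {0..len M e}. param M e t = x}"
proof (cases "\<exists>t\<in>{0<..<len M e}. param M e t = x")
  case True
  then obtain t where t: "t \<in> {0<..<len M e}" "param M e t = x" by blast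
  then have "{t \<in> {0..len M e}. param M e t = x} \<subseteq> {t}"
    using param_inj(2)[OF assms assms t(1)] by force
  then show ?thesis by (rule finite_subset) simp
next
  case False
  then have "{t \<in> {0..len M e}. param M e t = x} \<subseteq> {0, len M e}" by fastforce
  then show ?thesis by (rule finite_subset) simp
qed

lemma fibre_interior:
  assumes "e \<in> edges M" "t \<in> {0<..<len M e}" "e' \<in> edges M"
  shows "{s \<in> {0..len M e'}. param M e' s = param M e t} = (if e' = e then {t} else {})"
  using param_inj[OF assms(1,3,2)] assms by (auto dest: sym)

lemma rational_function_edge:
  assumes "rational_function M f" "e \<in> edges M"
  shows "piecewise_linear (len M e) (f \<circ> param M e)" "continuous_on {0..len M e} (f \<circ> param M e)"
  using assms continuous_map_compose[OF param_continuous[OF assms(2)], of euclideanreal f]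
  by (auto simp: rational_function_def)

lemma ord_at_eq:
  "ord_at M f x = (\<Sum>e\<in>edges M. \<Sum>t | t \<in> {0..len M e} \<and> param M e t = x.
     ord_edge (f \<circ> param M e) (len M e) t)"
  unfolding ord_at_def
proof (rule sum.cong[OF refl])
  fix e assume e: "e \<in> edges M"
  let ?T = "{t. t \<in> {0..len M e} \<and> param M e t = x}"
  have "(\<Sum>t | t \<in> {0..<len M e} \<and> param M e t = x. slope_right (f \<circ> param M e) t) =
      (\<Sum>t\<in>?T. if t < len M e then slope_right (f \<circ> param M e) t else 0)"
    using finite_fibre[OF e] by (intro sum.mono_neutral_cong_left) auto
  moreover have "(\<Sum>t | t \<in> {0<..len M e} \<and> param M e t = x. slope_left (f \<circ> param M e) t) =
      (\<Sum>t\<in>?T. if 0 < t then slope_left (f \<circ> param M e) t else 0)"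
    using finite_fibre[OF e] by (intro sum.mono_neutral_cong_left) auto
  ultimately show "(\<Sum>t | t \<in> {0..<len M e} \<and> param M e t = x. slope_right (f \<circ> param M e) t) +
      (\<Sum>t | t \<in> {0<..len M e} \<and> param M e t = x. slope_left (f \<circ> param M e) t) =
      (\<Sum>t\<in>?T. ord_edge (f \<circ> param M e) (len M e) t)"
    by (simp add: ord_edge_def sum.distrib)
qed

lemma ord_at_interior:
  assumes "e \<in> edges M" "t \<in> {0<..<len M e}"
  shows "ord_at M f (param M e t) = slope_right (f \<circ> param M e) t + slope_left (f \<circ> param M e) t"
proof -
  have "ord_at M f (param M e t) =
      (\<Sum>e'\<in>edges M. if e' = e then ord_edge (f \<circ> param M e) (len M e) t else 0)"
    unfolding ord_at_eq by (intro sum.cong refl) (simp add: fibre_interior[OF assms] del: atLeastAtMost_iff)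
  then show ?thesis
    using assms finite_edges by (simp add: ord_edge_def)
qed

lemma ord_at_outside:
  assumes "x \<notin> points M" shows "ord_at M f x = 0"
proof -
  have "{t. t \<in> {0..len M e} \<and> param M e t = x} = {}" if "e \<in> edges M" for e
    using param_points[OF that] assms by blast
  then have "(\<Sum>t | t \<in> {0..len M e} \<and> param M e t = x. ord_edge (f \<circ> param M e) (len M e) t) = 0"
    if "e \<in> edges M" for e
    using that by (simp only: sum.empty)
  then show ?thesis unfolding ord_at_eq by (rule sum.neutral[OF ballI])
qed

lemma slopes_add:
  assumes "rational_function M f" "rational_function M g" "e \<in> edges M"
  shows "0 \<le> t \<Longrightarrow> t < len M e \<Longrightarrow> slope_right ((\<lambda>x. f x + g x) \<circ> param M e) t =
      slope_right (f \<circ> param M e) t + slope_right (g \<circ> param M e) t" (is "_ \<Longrightarrow> _ \<Longrightarrow> ?R")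
    and "0 < t \<Longrightarrow> t \<le> len M e \<Longrightarrow> slope_left ((\<lambda>x. f x + g x) \<circ> param M e) t =
      slope_left (f \<circ> param M e) t + slope_left (g \<circ> param M e) t" (is "_ \<Longrightarrow> _ \<Longrightarrow> ?L")
proof -
  note F = rational_function_edge[OF assms(1,3)] and G = rational_function_edge[OF assms(2,3)]
  show ?R if "0 \<le> t" "t < len M e"
    using piecewise_linear_slope_right[OF F that] piecewise_linear_slope_right[OF G that]
    by (intro slope_right_eqI, eventually_elim) (simp add: algebra_simps)
  show ?L if "0 < t" "t \<le> len M e"
    using piecewise_linear_slope_left[OF F that] piecewise_linear_slope_left[OF G that]
    by (intro slope_left_eqI, eventually_elim) (simp add: algebra_simps)
qed

lemma rational_function_add:
  assumes "rational_function M f" "rational_function M g"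
  shows "rational_function M (\<lambda>x. f x + g x)"
  unfolding rational_function_def
proof (intro conjI ballI)
  show "continuous_map (etopology M) euclideanreal (\<lambda>x. f x + g x)"
    using assms by (intro continuous_map_add) (auto simp: rational_function_def)
  fix e assume "e \<in> edges M"
  then show "piecewise_linear (len M e) ((\<lambda>x. f x + g x) \<circ> param M e)"
    using piecewise_linear_add[of "len M e" "f \<circ> param M e" "g \<circ> param M e"] assms
    by (simp add: rational_function_def comp_def)
qed

lemma principal_add:
  assumes "rational_function M f" "rational_function M g"
  shows "principal M (\<lambda>x. f x + g x) = principal M f + principal M g"
proof
  fix x
  show "principal M (\<lambda>x. f x + g x) x = (principal M f + principal M g) x"
    unfolding principal_def ord_at_eq plus_fun_apply sum.distrib[symmetric]
    by (intro sum.cong refl) (auto simp: ord_edge_def slopes_add[OF assms])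
qed

lemma glue:
  assumes cont: "\<And>e. e \<in> edges M \<Longrightarrow> continuous_on {0..len M e} (g e)"
    and ends: "\<And>e. e \<in> edges M \<Longrightarrow> g e 0 = u (param M e 0)"
      "\<And>e. e \<in> edges M \<Longrightarrow> g e (len M e) = u (param M e (len M e))"
  obtains f where "continuous_map (etopology M) euclideanreal f"
    "\<And>e t. e \<in> edges M \<Longrightarrow> t \<in> {0..len M e} \<Longrightarrow> f (param M e t) = g e t"
proof -
  define f where "f = (\<lambda>x. if x \<in> verts M then u x else
    (case (SOME (e, t). e \<in> edges M \<and> t \<in> {0<..<len M e} \<and> x = param M e t) of (e, t) \<Rightarrow> g e t))"
  have f: "f (param M e t) = g e t" if e: "e \<in> edges M" and t: "t \<in> {0..len M e}" for e t
  proof (cases "t = 0 \<or> t = len M e")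
    case True
    then show ?thesis using ends param_0 param_len e by (auto simp: f_def)
  next
    case False
    then have t': "t \<in> {0<..<len M e}" using t by auto
    have "(SOME (e', t'). e' \<in> edges M \<and> t' \<in> {0<..<len M e'} \<and> param M e t = param M e' t') = (e, t)"
    proof (rule some_equality)
      fix y assume "case y of (e', t') \<Rightarrow>
        e' \<in> edges M \<and> t' \<in> {0<..<len M e'} \<and> param M e t = param M e' t'"
      then obtain e' t' where "y = (e', t')" "e' \<in> edges M" "t' \<in> {0..len M e'}" "param M e t = param M e' t'"
        by auto
      then show "y = (e, t)" using param_inj[OF e _ t', of e' t'] by simp
    qed (use e t' in simp)
    then show ?thesis using param_interior[OF e t'] by (simp add: f_def)
  qed
  have "continuous_map (etopology M) euclideanreal f"
    unfolding continuous_map_closedin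
  proof (intro conjI allI impI)
    fix C :: "real set" assume "closedin euclideanreal C"
    then have C: "closed C" by simp
    have "closedin (etopology M) (param M e ` {t \<in> {0..len M e}. g e t \<in> C})" if e: "e \<in> edges M" for e
    proof -
      have "closed {t \<in> {0..len M e}. g e t \<in> C}"
        using continuous_closed_preimage[OF cont[OF e] _ C] by (simp add: vimage_def Int_def)
      then have "compact ({0..len M e} \<inter> {t \<in> {0..len M e}. g e t \<in> C})"
        by (rule compact_Int_closed[OF compact_Icc])
      then have "compactin (top_of_set {0..len M e}) {t \<in> {0..len M e}. g e t \<in> C}"
        unfolding compactin_subtopology
        by (simp add: compactin_euclidean_iff Int_absorb1 subset_iff)
      then show ?thesis
        using compactin_imp_closedin[OF Hausdorff_etopology[OF metric]]
          image_compactin[OF _ param_continuous[OF e]] by blast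
    qed
    moreover have "closedin (etopology M) {v \<in> verts M. u v \<in> C}"
      using finite_verts verts_subset
      by (intro compactin_imp_closedin[OF Hausdorff_etopology[OF metric]] finite_imp_compactin) auto
    ultimately have "closedin (etopology M)
       ({v \<in> verts M. u v \<in> C} \<union> (\<Union>e\<in>edges M. param M e ` {t \<in> {0..len M e}. g e t \<in> C}))"
      using finite_edges by (intro closedin_Un closedin_Union) auto
    also have "{v \<in> verts M. u v \<in> C} \<union> (\<Union>e\<in>edges M. param M e ` {t \<in> {0..len M e}. g e t \<in> C}) =
        {x \<in> topspace (etopology M). f x \<in> C}"
    proof (intro set_eqI iffI)
      fix x assume "x \<in> {v \<in> verts M. u v \<in> C} \<union> (\<Union>e\<in>edges M. param M e ` {t \<in> {0..len M e}. g e t \<in> C})"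
      then show "x \<in> {x \<in> topspace (etopology M). f x \<in> C}"
      proof
        assume "x \<in> {v \<in> verts M. u v \<in> C}"
        then show ?thesis using verts_subset by (auto simp: f_def)
      next
        assume "x \<in> (\<Union>e\<in>edges M. param M e ` {t \<in> {0..len M e}. g e t \<in> C})"
        then obtain e t where "e \<in> edges M" "t \<in> {0..len M e}" "g e t \<in> C" "x = param M e t" by blast
        then show ?thesis using f[of e t] param_points[of e t] by simp
      qed
    next
      fix x assume x: "x \<in> {x \<in> topspace (etopology M). f x \<in> C}"
      then have "x \<in> points M" by simp
      then show "x \<in> {v \<in> verts M. u v \<in> C} \<union> (\<Union>e\<in>edges M. param M e ` {t \<in> {0..len M e}. g e t \<in> C})"
      proof (cases rule: points_cases)
        case 1
        then show ?thesis using x by (auto simp: f_def)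
      next
        case (2 e t)
        then have "g e t \<in> C" using f[of e t] x by simp
        then have "x \<in> param M e ` {t \<in> {0..len M e}. g e t \<in> C}" using 2 by auto
        then show ?thesis using 2 by blast
      qed
    qed
    finally show "closedin (etopology M) {x \<in> topspace (etopology M). f x \<in> C}" .
  qed simp
  then show ?thesis using f that by blast
qed

text \<open>\<open>u\<close> prescribes the values of \<open>g\<close> at the vertices.\<close>

lemma principal_moves:
  assumes A: "finite A" "\<And>a. a \<in> A \<Longrightarrow> ed a \<in> edges M"
    and pq: "\<And>a. a \<in> A \<Longrightarrow> p a \<in> {0..len M (ed a)}" "\<And>a. a \<in> A \<Longrightarrow> q a \<in> {0..len M (ed a)}"
    and u: "\<And>e. e \<in> edges M \<Longrightarrow> u (param M e 0) - u (param M e (len M e)) =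
       (\<Sum>a | a \<in> A \<and> ed a = e. of_int (w a) * (q a - p a))"
  obtains g where "rational_function M g"
    "\<And>x. principal M g x = (\<Sum>a\<in>A. w a *
       (of_bool (param M (ed a) (q a) = x) - of_bool (param M (ed a) (p a) = x)))"
    "\<And>e. e \<in> edges M \<Longrightarrow> slope_right (g \<circ> param M e) 0 =
       (\<Sum>a | a \<in> A \<and> ed a = e. w a * (of_bool (q a = 0) - of_bool (p a = 0)))"
proof -
  define Ae where "Ae e = {a. a \<in> A \<and> ed a = e}" for e
  have Ae: "finite (Ae e)" for e using A by (simp add: Ae_def)
  define h where "h e t = u (param M e 0) + moves (Ae e) w p q t" for e t
  have cont: "continuous_on {0..len M e} (h e)" for e
    unfolding h_def moves_def by (intro continuous_intros continuous_on_hinge)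
  have h0: "h e 0 = u (param M e 0)" for e
    unfolding h_def moves_def using pq by (auto simp: Ae_def hinge_def intro!: sum.neutral)
  have hL: "h e (len M e) = u (param M e (len M e))" if e: "e \<in> edges M" for e
  proof -
    have "moves (Ae e) w p q (len M e) = (\<Sum>a\<in>Ae e. - (of_int (w a) * (q a - p a)))"
      unfolding moves_def using pq by (intro sum.cong refl) (auto simp: Ae_def hinge_def algebra_simps)
    then show ?thesis using u[OF e] by (simp add: h_def sum_negf Ae_def)
  qed
  obtain g where g: "continuous_map (etopology M) euclideanreal g"
    "\<And>e t. e \<in> edges M \<Longrightarrow> t \<in> {0..len M e} \<Longrightarrow> g (param M e t) = h e t"
    using glue[OF cont h0 hL] by metis
  have right: "slope_right (g \<circ> param M e) t =
      (\<Sum>a\<in>Ae e. w a * (of_bool (q a \<le> t) - of_bool (p a \<le> t)))"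
    if e: "e \<in> edges M" and t: "0 \<le> t" "t < len M e" for e t
  proof (rule slope_right_eqI)
    from moves_right[OF Ae[of e], where t = t and w = w and p = p and q = q] eventually_at_right_interval[OF t(2)]
    show "\<forall>\<^sub>F s in at_right t. (g \<circ> param M e) s = (g \<circ> param M e) t +
        of_int (\<Sum>a\<in>Ae e. w a * (of_bool (q a \<le> t) - of_bool (p a \<le> t))) * (s - t)"
      by eventually_elim (use g(2)[OF e] t in \<open>simp add: h_def\<close>)
  qed
  have left: "slope_left (g \<circ> param M e) t =
      - (\<Sum>a\<in>Ae e. w a * (of_bool (q a < t) - of_bool (p a < t)))"
    if e: "e \<in> edges M" and t: "0 < t" "t \<le> len M e" for e t
  proof (rule slope_left_eqI)
    from moves_left[OF Ae[of e], where t = t and w = w and p = p and q = q] eventually_at_left_interval[OF t(1)]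
    show "\<forall>\<^sub>F s in at_left t. (g \<circ> param M e) s = (g \<circ> param M e) t +
        of_int (- (\<Sum>a\<in>Ae e. w a * (of_bool (q a < t) - of_bool (p a < t)))) * (t - s)"
      by eventually_elim (use g(2)[OF e] t in \<open>simp add: h_def\<close>)
  qed
  have ord: "ord_edge (g \<circ> param M e) (len M e) t =
      (\<Sum>a\<in>Ae e. w a * (of_bool (q a = t) - of_bool (p a = t)))"
    if e: "e \<in> edges M" and t: "t \<in> {0..len M e}" for e t
  proof -
    have R: "(if t < len M e then slope_right (g \<circ> param M e) t else 0) =
        (\<Sum>a\<in>Ae e. w a * (of_bool (q a \<le> t) - of_bool (p a \<le> t)))"
    proof (cases "t < len M e")
      case False
      then have "(\<Sum>a\<in>Ae e. w a * (of_bool (q a \<le> t) - of_bool (p a \<le> t))) = 0"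
        using t pq by (intro sum.neutral) (auto simp: Ae_def)
      then show ?thesis using False by simp
    qed (use right[OF e, of t] t in simp)
    have L: "(if 0 < t then slope_left (g \<circ> param M e) t else 0) =
        (\<Sum>a\<in>Ae e. - (w a * (of_bool (q a < t) - of_bool (p a < t))))"
    proof (cases "0 < t")
      case False
      then have "(\<Sum>a\<in>Ae e. - (w a * (of_bool (q a < t) - of_bool (p a < t)))) = 0"
        using t pq by (intro sum.neutral) (force simp: Ae_def)
      then show ?thesis using False by simp
    qed (use left[OF e, of t] t in \<open>simp add: sum_negf\<close>)
    show ?thesis
      unfolding ord_edge_def R L sum.distrib[symmetric]
      by (intro sum.cong refl) (auto simp: algebra_simps)
  qed
  have "rational_function M g"
    unfolding rational_function_def
  proof (intro conjI ballI)
    fix e assume e: "e \<in> edges M"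
    show "piecewise_linear (len M e) (g \<circ> param M e)"
      by (rule piecewise_linear_cong[OF piecewise_linear_moves[OF Ae]]) (use g(2)[OF e] in \<open>simp add: h_def\<close>)
  qed (fact g(1))
  moreover have "principal M g x = (\<Sum>a\<in>A. w a *
       (of_bool (param M (ed a) (q a) = x) - of_bool (param M (ed a) (p a) = x)))" for x
  proof -
    let ?T = "\<lambda>e. {t. t \<in> {0..len M e} \<and> param M e t = x}"
    have "(\<Sum>t\<in>?T e. ord_edge (g \<circ> param M e) (len M e) t) =
        (\<Sum>a\<in>Ae e. w a * (of_bool (param M (ed a) (q a) = x) - of_bool (param M (ed a) (p a) = x)))"
      if e: "e \<in> edges M" for e
    proof -
      have ind: "(\<Sum>t\<in>?T e. of_bool (y = t)) = (of_bool (param M e y = x) :: int)" if "y \<in> {0..len M e}" for y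
      proof -
        have "(\<Sum>t\<in>?T e. of_bool (y = t)) = (\<Sum>t\<in>?T e. if t = y then 1 else (0::int))"
          by (intro sum.cong) auto
        also have "\<dots> = of_bool (param M e y = x)"
          using finite_fibre[OF e] that by (subst sum.delta) auto
        finally show ?thesis .
      qed
      have "(\<Sum>t\<in>?T e. ord_edge (g \<circ> param M e) (len M e) t) =
          (\<Sum>t\<in>?T e. \<Sum>a\<in>Ae e. w a * (of_bool (q a = t) - of_bool (p a = t)))"
        using ord[OF e] by (intro sum.cong refl) auto
      also have "\<dots> = (\<Sum>a\<in>Ae e. w a * ((\<Sum>t\<in>?T e. of_bool (q a = t)) - (\<Sum>t\<in>?T e. of_bool (p a = t))))"
        by (subst sum.swap) (simp only: sum_distrib_left sum_subtractf right_diff_distrib)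
      also have "\<dots> = (\<Sum>a\<in>Ae e. w a * (of_bool (param M (ed a) (q a) = x) - of_bool (param M (ed a) (p a) = x)))"
      proof (rule sum.cong[OF refl])
        fix a assume "a \<in> Ae e"
        then have "ed a = e" "p a \<in> {0..len M e}" "q a \<in> {0..len M e}"
          using pq[of a] by (auto simp: Ae_def)
        then show "w a * ((\<Sum>t\<in>?T e. of_bool (q a = t)) - (\<Sum>t\<in>?T e. of_bool (p a = t))) =
            w a * (of_bool (param M (ed a) (q a) = x) - of_bool (param M (ed a) (p a) = x))"
          by (simp only: ind)
      qed
      finally show ?thesis .
    qed
    then have "principal M g x = (\<Sum>e\<in>edges M. \<Sum>a | a \<in> A \<and> ed a = e. w a *
        (of_bool (param M (ed a) (q a) = x) - of_bool (param M (ed a) (p a) = x)))"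
      unfolding principal_def ord_at_eq by (intro sum.cong refl) (simp_all only: Ae_def)
    also have "\<dots> = (\<Sum>a\<in>A. w a *
        (of_bool (param M (ed a) (q a) = x) - of_bool (param M (ed a) (p a) = x)))"
      by (rule sum.group) (use A finite_edges in auto)
    finally show ?thesis .
  qed
  moreover have "slope_right (g \<circ> param M e) 0 =
       (\<Sum>a | a \<in> A \<and> ed a = e. w a * (of_bool (q a = 0) - of_bool (p a = 0)))" if e: "e \<in> edges M" for e
  proof -
    have "(q a \<le> 0) = (q a = 0)" "(p a \<le> 0) = (p a = 0)" if "a \<in> Ae e" for a
      using pq[of a] that by (auto simp: Ae_def)
    then show ?thesis using right[OF e, of 0] len_pos[OF e]
      unfolding Ae_def[symmetric] by simp
  qed
  ultimately show ?thesis using that by blast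
qed

lemma principal_zero: "rational_function M (\<lambda>_. 0)" "principal M (\<lambda>_. 0) = 0"
proof -
  obtain g where g: "rational_function M g" "\<And>x. principal M g x = 0"
    by (rule principal_moves[of "{}" undefined undefined undefined "\<lambda>_. 0"]) auto
  show z: "rational_function M (\<lambda>_. 0)"
    unfolding rational_function_def piecewise_linear_def
    by (auto intro!: exI[of _ "{}"] exI[of _ "0::int"] exI[of _ "0::real"])
  show "principal M (\<lambda>_. 0) = 0"
    using principal_add[OF z z] by (simp add: fun_eq_iff)
qed

end

section \<open>Closeness of divisors and open cells\<close>

lemma close_divisors_zero: "close_divisors X \<epsilon> (\<lambda>_. 0) (\<lambda>_. 0)"
  unfolding close_divisors_def by (intro exI[of _ 0]) auto

lemma close_divisors_add_point:
  assumes "close_divisors X \<epsilon> D D'" "x \<in> points X" "y \<in> points X" "edist X x y < ennreal \<epsilon>"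
  shows "close_divisors X \<epsilon> (\<lambda>z. D z + of_bool (x = z)) (\<lambda>z. D' z + of_bool (y = z))"
proof -
  from assms(1) obtain n :: nat and p q where
    pq: "\<forall>i<n. p i \<in> points X \<and> q i \<in> points X \<and> edist X (p i) (q i) < ennreal \<epsilon>"
      "D = (\<lambda>x. int (card {i. i < n \<and> p i = x}))" "D' = (\<lambda>x. int (card {i. i < n \<and> q i = x}))"
    unfolding close_divisors_def by blast
  have count: "int (card {i. i < Suc n \<and> (r(n := y)) i = z}) = int (card {i. i < n \<and> r i = z}) + of_bool (y = z)"
    for r :: "nat \<Rightarrow> 'a" and y z
  proof -
    have "{i. i < Suc n \<and> (r(n := y)) i = z} = (if y = z then insert n else id) {i. i < n \<and> r i = z}"
      by (auto simp: less_Suc_eq)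
    then show ?thesis by simp
  qed
  show ?thesis
    unfolding close_divisors_def
  proof (intro exI conjI)
    show "\<forall>i<Suc n. (p(n := x)) i \<in> points X \<and> (q(n := y)) i \<in> points X \<and>
        edist X ((p(n := x)) i) ((q(n := y)) i) < ennreal \<epsilon>"
      using pq(1) assms by (simp add: less_Suc_eq)
  qed (simp_all only: count pq)
qed

lemma close_divisors_moves:
  assumes "close_divisors X \<epsilon> R R'" "finite A"
    and "\<And>a. a \<in> A \<Longrightarrow> p a \<in> points X \<and> q a \<in> points X \<and> edist X (p a) (q a) < ennreal \<epsilon>"
  shows "close_divisors X \<epsilon> (\<lambda>z. R z + (\<Sum>a\<in>A. of_bool (p a = z))) (\<lambda>z. R' z + (\<Sum>a\<in>A. of_bool (q a = z)))"
  using assms(2,3)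
proof (induction A rule: finite_induct)
  case empty
  then show ?case using assms(1) by simp
next
  case (insert a A)
  then have "close_divisors X \<epsilon>
      (\<lambda>z. (R z + (\<Sum>a\<in>A. of_bool (p a = z))) + of_bool (p a = z))
      (\<lambda>z. (R' z + (\<Sum>a\<in>A. of_bool (q a = z))) + of_bool (q a = z))"
    by (intro close_divisors_add_point) auto
  then show ?case using insert.hyps by (simp add: add_ac del: sum_of_bool_eq)
qed

lemma close_divisors_refl:
  assumes "ext_metric X" "effective X D" "\<epsilon> > 0"
  shows "close_divisors X \<epsilon> D D"
proof -
  let ?S = "{x. D x \<noteq> 0}"
  have S: "finite ?S" "?S \<subseteq> points X" and pos: "\<And>x. D x \<ge> 0"
    using assms by (auto simp: effective_def divisor_def)
  let ?A = "Sigma ?S (\<lambda>x. {..<nat (D x)})"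
  have "close_divisors X \<epsilon> (\<lambda>z. 0 + (\<Sum>a\<in>?A. of_bool (fst a = z))) (\<lambda>z. 0 + (\<Sum>a\<in>?A. of_bool (fst a = z)))"
    using S assms by (intro close_divisors_moves close_divisors_zero) (auto simp: edist_refl subset_iff)
  moreover have "(\<Sum>a\<in>?A. of_bool (fst a = z)) = D z" for z
  proof -
    have "(\<Sum>a\<in>?A. of_bool (fst a = z)) = (\<Sum>x\<in>?S. \<Sum>i<nat (D x). (of_bool (x = z) :: int))"
      using S by (subst sum.Sigma) (auto simp: split_def)
    also have "\<dots> = (\<Sum>x\<in>?S. if x = z then D x else 0)"
      using pos by (intro sum.cong) auto
    also have "\<dots> = D z" using S by (simp add: sum.delta)
    finally show ?thesis .
  qed
  ultimately show ?thesis by simp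
qed

lemma close_divisors_trans:
  assumes X: "ext_metric X" and "close_divisors X \<epsilon> D D1" "close_divisors X \<delta> D1 D2" "\<epsilon> > 0" "\<delta> > 0"
  shows "close_divisors X (\<epsilon> + \<delta>) D D2"
proof -
  from assms(2) obtain n :: nat and p q where
    pq: "\<forall>i<n. p i \<in> points X \<and> q i \<in> points X \<and> edist X (p i) (q i) < ennreal \<epsilon>"
      "D = (\<lambda>x. int (card {i. i < n \<and> p i = x}))" "D1 = (\<lambda>x. int (card {i. i < n \<and> q i = x}))"
    unfolding close_divisors_def by blast
  from assms(3) obtain n' :: nat and q' r where
    qr: "\<forall>i<n'. q' i \<in> points X \<and> r i \<in> points X \<and> edist X (q' i) (r i) < ennreal \<delta>"
      "D1 = (\<lambda>x. int (card {i. i < n' \<and> q' i = x}))" "D2 = (\<lambda>x. int (card {i. i < n' \<and> r i = x}))"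
    unfolding close_divisors_def by blast
  have cnt: "count (image_mset f (mset_set {..<k})) x = card {i. i < k \<and> f i = x}" for f :: "nat \<Rightarrow> 'a" and k x
    by (simp add: count_image_mset' conj_commute eq_commute[of x])
  have "card {i. i < n \<and> q i = x} = card {i. i < n' \<and> q' i = x}" for x
    using fun_cong[OF trans[OF pq(3)[symmetric] qr(2)], of x] by simp
  then have m: "image_mset q (mset_set {..<n}) = image_mset q' (mset_set {..<n'})"
    by (intro multiset_eqI) (simp only: cnt)
  then have [simp]: "n' = n" by (metis card_lessThan size_image_mset size_mset_set)
  obtain \<pi> where \<pi>: "\<pi> permutes {..<n}" "\<forall>i\<in>{..<n}. q i = q' (\<pi> i)"
    using image_mset_eq_implies_permutes[of "{..<n}" q q'] m by auto
  have \<pi>n: "\<pi> i < n" if "i < n" for i using permutes_in_image[OF \<pi>(1)] that by auto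
  show ?thesis
    unfolding close_divisors_def
  proof (rule exI[of _ n], rule exI[of _ p], rule exI[of _ "r \<circ> \<pi>"], intro conjI allI impI)
    fix i assume i: "i < n"
    show "p i \<in> points X" "(r \<circ> \<pi>) i \<in> points X" using pq qr i \<pi>n by auto
    have "edist X (p i) (r (\<pi> i)) \<le> edist X (p i) (q i) + edist X (q' (\<pi> i)) (r (\<pi> i))"
      using edist_triangle[OF X, of "p i" "q i" "r (\<pi> i)"] pq qr i \<pi>n \<pi>(2) by simp
    also have "\<dots> < ennreal \<epsilon> + ennreal \<delta>"
      using pq(1) qr(1) i \<pi>n by (intro add_strict_mono) auto
    finally show "edist X (p i) ((r \<circ> \<pi>) i) < ennreal (\<epsilon> + \<delta>)"
      using assms by simp
  next
    have "card {i. i < n \<and> r i = x} = card {i. i < n \<and> (r \<circ> \<pi>) i = x}" for x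
    proof (rule bij_betw_same_card[symmetric], rule bij_betw_subset[OF permutes_imp_bij[OF \<pi>(1)]])
      show "{i. i < n \<and> (r \<circ> \<pi>) i = x} \<subseteq> {..<n}" by auto
      show "\<pi> ` {i. i < n \<and> (r \<circ> \<pi>) i = x} = {i. i < n \<and> r i = x}"
      proof
        show "{i. i < n \<and> r i = x} \<subseteq> \<pi> ` {i. i < n \<and> (r \<circ> \<pi>) i = x}"
        proof
          fix i assume i: "i \<in> {i. i < n \<and> r i = x}"
          then obtain j where "j \<in> {..<n}" "i = \<pi> j" using permutes_image[OF \<pi>(1)] by blast
          then show "i \<in> \<pi> ` {i. i < n \<and> (r \<circ> \<pi>) i = x}" using i by auto
        qed
      qed (use \<pi>n in auto)
    qed
    then show "D2 = (\<lambda>x. int (card {i. i < n \<and> (r \<circ> \<pi>) i = x}))" using qr by simp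
  qed (use pq in auto)
qed

lemma finite_separation:
  assumes X: "ext_metric X" and "finite F" "F \<subseteq> points X"
  obtains r where "r > 0" "\<And>x y. x \<in> F \<Longrightarrow> y \<in> F \<Longrightarrow> x \<noteq> y \<Longrightarrow> ennreal r + ennreal r \<le> edist X x y"
proof -
  define T where "T = insert \<infinity> ((\<lambda>(x, y). edist X x y) ` {(x, y). x \<in> F \<and> y \<in> F \<and> x \<noteq> y})"
  have "finite {(x, y). x \<in> F \<and> y \<in> F \<and> x \<noteq> y}"
    by (rule finite_subset[of _ "F \<times> F"]) (use assms in auto)
  then have T: "finite T" "T \<noteq> {}" by (auto simp: T_def)
  have "\<forall>d\<in>T. d > 0" using edist_pos[OF X] assms(3) by (auto simp: T_def subset_iff)
  then have "Min T > 0" using T by (simp add: Min_gr_iff)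
  then obtain r where r: "r > 0" "ennreal r + ennreal r \<le> Min T" by (rule ennreal_half)
  moreover have "ennreal r + ennreal r \<le> edist X x y" if "x \<in> F" "y \<in> F" "x \<noteq> y" for x y
  proof -
    have "edist X x y \<in> T" using that by (auto simp: T_def)
    then show ?thesis using r(2) T(1) by (meson Min_le order_trans)
  qed
  ultimately show ?thesis using that by blast
qed

lemma close_divisors_support_card:
  assumes X: "ext_metric X" and V: "finite V" "V \<subseteq> points X"
    and F: "finite F" "F \<subseteq> points X - V" "\<And>x. x \<in> F \<Longrightarrow> D x \<noteq> 0"
  obtains \<eta> where "\<eta> > 0"
    "\<And>D'. close_divisors X \<eta> D D' \<Longrightarrow> card F \<le> card {x \<in> points X - V. D' x \<noteq> 0}"
proof -
  obtain r where r: "r > 0"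
    "\<And>x y. x \<in> F \<union> V \<Longrightarrow> y \<in> F \<union> V \<Longrightarrow> x \<noteq> y \<Longrightarrow> ennreal r + ennreal r \<le> edist X x y"
    using finite_separation[OF X, of "F \<union> V"] V F by auto
  have "card F \<le> card {x \<in> points X - V. D' x \<noteq> 0}" if "close_divisors X r D D'" for D'
  proof -
    from that obtain n :: nat and p q where
      pq: "\<And>i. i < n \<Longrightarrow> p i \<in> points X" "\<And>i. i < n \<Longrightarrow> q i \<in> points X"
        "\<And>i. i < n \<Longrightarrow> edist X (p i) (q i) < ennreal r"
        "D = (\<lambda>x. int (card {i. i < n \<and> p i = x}))" "D' = (\<lambda>x. int (card {i. i < n \<and> q i = x}))"
      unfolding close_divisors_def by blast
    have "\<exists>i<n. p i = x" if "x \<in> F" for x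
      using F(3)[OF that] pq(4) by (force simp: card_eq_0_iff)
    then obtain k where k: "\<And>x. x \<in> F \<Longrightarrow> k x < n" "\<And>x. x \<in> F \<Longrightarrow> p (k x) = x" by metis
    have d: "edist X x (q (k x)) < ennreal r" if "x \<in> F" for x using pq(3)[OF k(1)] k(2) that by metis
    have "inj_on (\<lambda>x. q (k x)) F"
    proof (rule inj_onI, rule ccontr)
      fix x y assume xy: "x \<in> F" "y \<in> F" "q (k x) = q (k y)" "x \<noteq> y"
      have mem: "x \<in> points X" "y \<in> points X" "q (k x) \<in> points X" using xy F pq k by auto
      have "edist X x y \<le> edist X x (q (k x)) + edist X y (q (k y))"
        using edist_triangle[OF X mem(1,3,2)] edist_sym[OF X mem(2,3)] xy by simp
      also have "\<dots> < ennreal r + ennreal r" using d xy by (intro add_strict_mono)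
      finally show False using r(2)[of x y] xy by simp
    qed
    moreover have "(\<lambda>x. q (k x)) ` F \<subseteq> {x \<in> points X - V. D' x \<noteq> 0}"
    proof safe
      fix x assume x: "x \<in> F"
      show "q (k x) \<in> points X" using pq k x by auto
      show "False" if "q (k x) \<in> V"
      proof -
        have "x \<noteq> q (k x)" using that x F by auto
        then have "ennreal r + ennreal r \<le> edist X x (q (k x))" using r(2) that x by blast
        moreover have "ennreal r \<le> ennreal r + ennreal r" by simp
        ultimately show False using d[OF x] by (meson leD order_trans)
      qed
      assume z: "D' (q (k x)) = 0"
      have "k x \<in> {i. i < n \<and> q i = q (k x)}" using k x by simp
      moreover have "card {i. i < n \<and> q i = q (k x)} = 0" using z unfolding pq(5) by (simp only: of_nat_eq_0_iff)
      ultimately show False by (subst (asm) card_0_eq) auto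
    qed
    moreover have "finite {x \<in> points X - V. D' x \<noteq> 0}"
    proof (rule finite_subset)
      show "{x \<in> points X - V. D' x \<noteq> 0} \<subseteq> q ` {..<n}"
      proof
        fix x assume "x \<in> {x \<in> points X - V. D' x \<noteq> 0}"
        then have "card {i. i < n \<and> q i = x} \<noteq> 0" unfolding pq(5) by simp
        then have "{i. i < n \<and> q i = x} \<noteq> {}" by force
        then show "x \<in> q ` {..<n}" by blast
      qed
    qed simp
    ultimately show ?thesis by (metis card_image card_mono)
  qed
  then show ?thesis using r(1) that by blast
qed

context metrized_model
begin

lemma linear_system_step:
  assumes "D \<in> linear_system M D0" "rational_function M f" "D = D0 + principal M f"
    and g: "rational_function M g" "finite {x. principal M g x \<noteq> 0}"
    and nonneg: "\<And>x. x \<in> points M \<Longrightarrow> D x + principal M g x \<ge> 0"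
  shows "D + principal M g \<in> linear_system M D0"
    "rational_function M (\<lambda>x. f x + g x)" "D + principal M g = D0 + principal M (\<lambda>x. f x + g x)"
proof -
  show r: "rational_function M (\<lambda>x. f x + g x)"
    by (rule rational_function_add) fact+
  show eq: "D + principal M g = D0 + principal M (\<lambda>x. f x + g x)"
    by (simp add: principal_add[OF assms(2) g(1)] assms(3) add.assoc)
  have D: "finite {x. D x \<noteq> 0}" "{x. D x \<noteq> 0} \<subseteq> points M"
    using assms(1) by (auto simp: linear_system_def effective_def divisor_def)
  have out: "(D + principal M g) x = 0" if "x \<notin> points M" for x
    using that D ord_at_outside[OF that] by (auto simp: principal_def)
  have "finite {x. (D + principal M g) x \<noteq> 0}"
    by (rule finite_subset[OF _ finite_UnI[OF D(1) g(2)]]) auto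
  moreover have "(D + principal M g) x \<ge> 0" for x
    using out[of x] nonneg[of x] by (cases "x \<in> points M") auto
  ultimately have "effective M (D + principal M g)"
    using out by (auto simp: effective_def divisor_def)
  moreover have "lin_equiv M (D + principal M g) D0"
    unfolding lin_equiv_def using r eq by (intro exI[of _ "\<lambda>x. f x + g x"]) auto
  ultimately show "D + principal M g \<in> linear_system M D0"
    by (simp add: linear_system_def)
qed

lemma cell_data_exists:
  assumes "D \<in> linear_system M D0"
  obtains c x where "chip_positions M c D x" "\<And>e. init_slope c e = s e"
proof -
  have eff: "finite {x. D x \<noteq> 0}" "\<And>x. D x \<ge> 0"
    using assms by (auto simp: linear_system_def effective_def divisor_def)
  define T where "T e = {t \<in> {0<..<len M e}. D (param M e t) \<noteq> 0}" for e
  have T: "finite (T e)" if "e \<in> edges M" for e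
  proof (rule finite_imageD)
    show "finite (param M e ` T e)" by (rule finite_subset[OF _ eff(1)]) (auto simp: T_def)
    show "inj_on (param M e) (T e)"
      using param_inj[OF that that] by (auto intro!: inj_onI simp: T_def)
  qed
  define l where "l e = sorted_list_of_set (T e)" for e
  define x where "x e i = (if e \<in> edges M \<and> i < length (l e) then l e ! i else 0)" for e i
  define c where "c = \<lparr>vert_mult = (\<lambda>v. nat (D v)),
    edge_mult = (\<lambda>e. map (\<lambda>t. nat (D (param M e t))) (l e)), init_slope = s\<rparr>"
  have l: "set (l e) = T e" "sorted_wrt (<) (l e)" if "e \<in> edges M" for e
    using T[OF that] by (simp_all add: l_def strict_sorted_iff)
  have mem: "l e ! i \<in> T e" if "e \<in> edges M" "i < length (l e)" for e i
    using nth_mem[OF that(2)] l(1)[OF that(1)] by simp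
  have "chip_positions M c D x"
    unfolding chip_positions_def
  proof (intro conjI ballI allI impI)
    fix v show "D v = int (vert_mult c v)" using eff by (simp add: c_def)
  next
    fix e m assume e: "e \<in> edges M" and "m \<in> set (edge_mult c e)"
    then obtain t where "t \<in> T e" "m = nat (D (param M e t))" using l(1)[OF e] by (auto simp: c_def)
    then show "m > 0" using eff(2)[of "param M e t"] by (auto simp: T_def)
  next
    fix e i assume e: "e \<in> edges M" and "i < length (edge_mult c e)"
    then show "x e i \<in> {0<..<len M e}" using mem[OF e, of i] by (simp add: c_def x_def T_def)
  next
    fix e i j assume e: "e \<in> edges M" and "i < j \<and> j < length (edge_mult c e)"
    then show "x e i < x e j"
      using sorted_wrt_nth_less[OF l(2)[OF e], of i j] by (simp add: c_def x_def)
  next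
    fix e t assume e: "e \<in> edges M" and t: "t \<in> {0<..<len M e}"
    have "(\<Sum>i<length (edge_mult c e). if x e i = t then int (edge_mult c e ! i) else 0) =
        (\<Sum>i<length (l e). if l e ! i = t then D (param M e t) else 0)"
      using e eff by (intro sum.cong) (auto simp: c_def x_def)
    also have "\<dots> = (\<Sum>y\<in>T e. if y = t then D (param M e t) else 0)"
    proof (rule sum.reindex_bij_betw)
      show "bij_betw ((!) (l e)) {..<length (l e)} (T e)"
        using l[OF e] by (intro bij_betw_nth) (simp_all add: strict_sorted_iff)
    qed
    also have "\<dots> = D (param M e t)"
      using T[OF e] t by (subst sum.delta) (simp_all add: T_def)
    finally show "D (param M e t) = (\<Sum>i<length (edge_mult c e). if x e i = t then int (edge_mult c e ! i) else 0)"
      by simp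
  next
    fix e i assume "e \<notin> edges M \<or> i \<ge> length (edge_mult c e)"
    then show "x e i = 0" by (auto simp: x_def c_def)
  qed
  then show ?thesis using that[of c x] by (simp add: c_def)
qed

lemma open_cell_transfer:
  assumes c: "chip_positions M c D x"
    and D1: "D1 \<in> linear_system M D0" "rational_function M f1" "D1 = D0 + principal M f1"
      "\<And>e. e \<in> edges M \<Longrightarrow> slope_right (f1 \<circ> param M e) 0 = init_slope c e"
    and V: "\<And>v. v \<in> verts M \<Longrightarrow> D1 v = D v"
    and q: "\<And>e a. e \<in> edges M \<Longrightarrow> a \<in> J e \<Longrightarrow> q e a \<in> {0<..<len M e}"
    and p: "\<And>e a. e \<in> edges M \<Longrightarrow> a \<in> J e \<Longrightarrow> p e a \<in> {0<..<len M e}"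
    and iso: "\<And>e a b. e \<in> edges M \<Longrightarrow> a \<in> J e \<Longrightarrow> b \<in> J e \<Longrightarrow> p e a < p e b \<longleftrightarrow> q e a < q e b"
    and val: "\<And>e a. e \<in> edges M \<Longrightarrow> a \<in> J e \<Longrightarrow> D1 (param M e (q e a)) = D (param M e (p e a))"
    and supp: "\<And>e t. e \<in> edges M \<Longrightarrow> t \<in> {0<..<len M e} \<Longrightarrow> t \<notin> p e ` J e \<Longrightarrow> D (param M e t) = 0"
      "\<And>e t. e \<in> edges M \<Longrightarrow> t \<in> {0<..<len M e} \<Longrightarrow> t \<notin> q e ` J e \<Longrightarrow> D1 (param M e t) = 0"
  shows "D1 \<in> open_cell M D0 c"
proof -
  let ?n = "\<lambda>e. length (edge_mult c e)"
  have cV: "\<And>v. v \<in> verts M \<Longrightarrow> D v = int (vert_mult c v)"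
    and pos: "\<And>e m. e \<in> edges M \<Longrightarrow> m \<in> set (edge_mult c e) \<Longrightarrow> m > 0"
    and xin: "\<And>e i. e \<in> edges M \<Longrightarrow> i < ?n e \<Longrightarrow> x e i \<in> {0<..<len M e}"
    and xless: "\<And>e i j. e \<in> edges M \<Longrightarrow> i < j \<Longrightarrow> j < ?n e \<Longrightarrow> x e i < x e j"
    and Dval: "\<And>e t. e \<in> edges M \<Longrightarrow> t \<in> {0<..<len M e} \<Longrightarrow>
      D (param M e t) = (\<Sum>i<?n e. if x e i = t then int (edge_mult c e ! i) else 0)"
    using c unfolding chip_positions_def by blast+
  have "\<exists>a. a \<in> J e \<and> p e a = x e i" if e: "e \<in> edges M" and i: "i < ?n e" for e i
  proof (rule ccontr)
    assume "\<nexists>a. a \<in> J e \<and> p e a = x e i"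
    then have "D (param M e (x e i)) = 0" using supp(1)[OF e xin[OF e i]] by force
    moreover have "D (param M e (x e i)) \<ge> (if x e i = x e i then int (edge_mult c e ! i) else 0)"
      unfolding Dval[OF e xin[OF e i]] using i by (intro member_le_sum) auto
    ultimately show False using pos[OF e nth_mem[OF i]] by simp
  qed
  then obtain a where a: "\<And>e i. e \<in> edges M \<Longrightarrow> i < ?n e \<Longrightarrow> a e i \<in> J e"
    "\<And>e i. e \<in> edges M \<Longrightarrow> i < ?n e \<Longrightarrow> p e (a e i) = x e i" by metis
  have eq: "p e a = p e b \<longleftrightarrow> q e a = q e b" if "e \<in> edges M" "a \<in> J e" "b \<in> J e" for e a b
    using iso[OF that] iso[OF that(1,3,2)] by (metis linorder_neq_iff)
  define y where "y e i = (if e \<in> edges M \<and> i < ?n e then q e (a e i) else 0)" for e i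
  have "chip_positions M c D1 y"
    unfolding chip_positions_def
  proof (intro conjI ballI allI impI)
    fix v assume "v \<in> verts M" then show "D1 v = int (vert_mult c v)" using V cV by simp
  next
    fix e m assume "e \<in> edges M" "m \<in> set (edge_mult c e)" then show "m > 0" by (rule pos)
  next
    fix e i assume "e \<in> edges M" "i < ?n e"
    then show "y e i \<in> {0<..<len M e}" using q a by (simp add: y_def del: greaterThanLessThan_iff)
  next
    fix e i j assume e: "e \<in> edges M" and ij: "i < j \<and> j < ?n e"
    then show "y e i < y e j" using iso[OF e a(1)[OF e] a(1)[OF e], of i j] a(2)[OF e] xless[OF e, of i j]
      by (simp add: y_def)
  next
    fix e t assume e: "e \<in> edges M" and t: "t \<in> {0<..<len M e}"
    show "D1 (param M e t) = (\<Sum>i<?n e. if y e i = t then int (edge_mult c e ! i) else 0)"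
    proof (cases "t \<in> q e ` J e")
      case False
      then have "y e i \<noteq> t" if "i < ?n e" for i using a(1)[OF e that] e that by (auto simp: y_def)
      then have "(\<Sum>i<?n e. if y e i = t then int (edge_mult c e ! i) else 0) = 0"
        by (intro sum.neutral) auto
      then show ?thesis using supp(2)[OF e t False] by simp
    next
      case True
      then obtain b where b: "b \<in> J e" "t = q e b" by blast
      have "D (param M e (p e b)) = (\<Sum>i<?n e. if y e i = t then int (edge_mult c e ! i) else 0)"
      proof -
        have "(x e i = p e b) = (y e i = t)" if "i < ?n e" for i
          using eq[OF e a(1)[OF e that] b(1)] a(2)[OF e that] b(2) e that by (simp add: y_def)
        then show ?thesis unfolding Dval[OF e p[OF e b(1)]] by (intro sum.cong) auto
      qed
      then show ?thesis using val[OF e b(1)] b(2) by simp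
    qed
  next
    fix e i assume "e \<notin> edges M \<or> i \<ge> ?n e" then show "y e i = 0" by (auto simp: y_def)
  qed
  then show ?thesis
    unfolding open_cell_def using D1 by blast
qed

end

section \<open>Pieces and the dimension of a cell\<close>

text \<open>Pieces are described by the functions that are constant on them instead of by paths; the values at
  the chips inside the edges are unconstrained. For \<open>D = 0\<close> the pieces are the connected components.\<close>

definition chip_const :: "('a, 'e) modelled_graph \<Rightarrow> ('a \<Rightarrow> int) \<Rightarrow> ('a \<Rightarrow> real) \<Rightarrow> bool" where
  "chip_const M D h \<longleftrightarrow> (\<forall>e\<in>edges M. \<forall>a b. 0 \<le> a \<and> a \<le> b \<and> b \<le> len M e \<and>
     (\<forall>t. a \<le> t \<and> t \<le> b \<and> 0 < t \<and> t < len M e \<longrightarrow> D (param M e t) = 0) \<longrightarrow>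
     h (param M e a) = h (param M e b))"

definition same_piece :: "('a, 'e) modelled_graph \<Rightarrow> ('a \<Rightarrow> int) \<Rightarrow> 'a \<Rightarrow> 'a \<Rightarrow> bool" where
  "same_piece M D x y \<longleftrightarrow> (\<forall>h. chip_const M D h \<longrightarrow> h x = h y)"

lemma chip_constD:
  assumes "chip_const M D h" "e \<in> edges M" "0 \<le> a" "a \<le> b" "b \<le> len M e"
    "\<And>t. a \<le> t \<Longrightarrow> t \<le> b \<Longrightarrow> 0 < t \<Longrightarrow> t < len M e \<Longrightarrow> D (param M e t) = 0"
  shows "h (param M e a) = h (param M e b)"
  using assms unfolding chip_const_def by blast

lemma same_piece_refl: "same_piece M D x x"
  by (simp add: same_piece_def)

lemma same_piece_sym: "same_piece M D x y \<longleftrightarrow> same_piece M D y x"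
  by (auto simp: same_piece_def)

lemma same_piece_trans: "same_piece M D x y \<Longrightarrow> same_piece M D y z \<Longrightarrow> same_piece M D x z"
  unfolding same_piece_def by metis

lemma chip_const_same_piece: "chip_const M D (\<lambda>x. of_bool (same_piece M D x y))"
  unfolding chip_const_def
proof (intro ballI allI impI)
  fix e a b assume e: "e \<in> edges M" and ab: "0 \<le> a \<and> a \<le> b \<and> b \<le> len M e \<and>
     (\<forall>t. a \<le> t \<and> t \<le> b \<and> 0 < t \<and> t < len M e \<longrightarrow> D (param M e t) = 0)"
  then have "same_piece M D (param M e a) (param M e b)"
    unfolding same_piece_def chip_const_def by blast
  then have "same_piece M D (param M e a) y \<longleftrightarrow> same_piece M D (param M e b) y"
    using same_piece_trans[of M D] same_piece_sym[of M D "param M e a"] by blast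
  then show "(of_bool (same_piece M D (param M e a) y) :: real) = of_bool (same_piece M D (param M e b) y)"
    by simp
qed

lemma chip_const_sum:
  assumes "\<And>i. i \<in> I \<Longrightarrow> chip_const M D (h i)"
  shows "chip_const M D (\<lambda>x. \<Sum>i\<in>I. c i * h i x)"
  using assms unfolding chip_const_def by (intro ballI allI impI sum.cong refl arg_cong2[of _ _ _ _ "(*)"]) blast

definition breakpoint :: "real \<Rightarrow> nat \<Rightarrow> (nat \<Rightarrow> real) \<Rightarrow> nat \<Rightarrow> real" where
  "breakpoint L n x j = (if j = 0 then 0 else if j \<le> n then x (j - 1) else L)"

lemma breakpoint_simps [simp]:
  "breakpoint L n x 0 = 0" "breakpoint L n x (Suc n) = L"
  "i < n \<Longrightarrow> breakpoint L n x (Suc i) = x i"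
  by (auto simp: breakpoint_def)

lemma breakpoint_locate:
  assumes "0 \<le> t" "t < breakpoint L n x (Suc k)"
  shows "\<exists>j\<le>k. breakpoint L n x j \<le> t \<and> t < breakpoint L n x (Suc j)"
  using assms(2)
proof (induction k)
  case 0
  then show ?case using assms(1) by simp
next
  case (Suc k)
  show ?case
  proof (cases "t < breakpoint L n x (Suc k)")
    case True
    then show ?thesis using Suc.IH le_SucI by blast
  next
    case False
    then show ?thesis using Suc.prems by (intro exI[of _ "Suc k"]) auto
  qed
qed

lemma increasing_less:
  fixes f :: "nat \<Rightarrow> 'b :: order"
  assumes "\<And>j. j \<le> n \<Longrightarrow> f j < f (Suc j)" "i < j" "j \<le> Suc n"
  shows "f i < f j"
  using assms(2,3)
proof (induction j)
  case (Suc j)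
  then show ?case using assms(1)[of j] by (cases "i = j") (auto intro: less_trans)
qed simp

abbreviation brk :: "('a, 'e) modelled_graph \<Rightarrow> ('a, 'e) cell_data \<Rightarrow> ('e \<Rightarrow> nat \<Rightarrow> real) \<Rightarrow> 'e \<Rightarrow> nat \<Rightarrow> real" where
  "brk M c x e \<equiv> breakpoint (len M e) (length (edge_mult c e)) (x e)"

definition midpt :: "('a, 'e) modelled_graph \<Rightarrow> ('a, 'e) cell_data \<Rightarrow> ('e \<Rightarrow> nat \<Rightarrow> real) \<Rightarrow> 'e \<Rightarrow> nat \<Rightarrow> real" where
  "midpt M c x e j = (brk M c x e j + brk M c x e (Suc j)) / 2"

text \<open>The velocity of the chips when the potential of each piece grows at the rate \<open>h\<close>: a chip of
  multiplicity \<open>m\<close> that moves by \<open>\<delta>\<close> lowers the potential across it by \<open>m \<delta>\<close>.\<close>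

definition velocity ::
  "('a, 'e) modelled_graph \<Rightarrow> ('a, 'e) cell_data \<Rightarrow> ('e \<Rightarrow> nat \<Rightarrow> real) \<Rightarrow> ('a \<Rightarrow> real) \<Rightarrow> ('e \<Rightarrow> nat \<Rightarrow> real)" where
  "velocity M c x h = (\<lambda>e i. if e \<in> edges M \<and> i < length (edge_mult c e)
     then (h (param M e (midpt M c x e i)) - h (param M e (midpt M c x e (Suc i)))) / real (edge_mult c e ! i)
     else 0)"

lemma velocity_sum:
  "velocity M c x (\<lambda>y. \<Sum>s\<in>S. a s * h s y) e i = (\<Sum>s\<in>S. a s * velocity M c x (h s) e i)"
proof (cases "e \<in> edges M \<and> i < length (edge_mult c e)")
  case True
  then show ?thesis
    by (simp add: velocity_def sum_subtractf[symmetric] sum_divide_distrib right_diff_distrib)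
next
  case False
  show ?thesis unfolding velocity_def if_not_P[OF False] by simp
qed

lemma eventually_affine_pos:
  fixes a b :: "'i \<Rightarrow> real"
  assumes "finite S" "\<And>s. s \<in> S \<Longrightarrow> a s > 0"
  shows "\<forall>\<^sub>F r in at_right 0. \<forall>s\<in>S. a s + r * b s > 0"
proof (intro eventually_ball_finite ballI assms(1))
  fix s assume "s \<in> S"
  have "((\<lambda>r. a s + r * b s) \<longlongrightarrow> a s + 0 * b s) (at_right 0)"
    by (intro tendsto_intros)
  then show "\<forall>\<^sub>F r in at_right 0. a s + r * b s > 0"
    using assms(2)[OF \<open>s \<in> S\<close>] by (auto dest: order_tendstoD(1))
qed

context metrized_model
begin

context
  fixes c D x
  assumes chips: "chip_positions M c D x"
begin

lemma mult_pos: "e \<in> edges M \<Longrightarrow> i < length (edge_mult c e) \<Longrightarrow> edge_mult c e ! i > 0"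
  using chips nth_mem[of i "edge_mult c e"] by (auto simp: chip_positions_def)

lemma chip_interior: "e \<in> edges M \<Longrightarrow> i < length (edge_mult c e) \<Longrightarrow> x e i \<in> {0<..<len M e}"
  using chips unfolding chip_positions_def by blast

lemma chip_value: "e \<in> edges M \<Longrightarrow> t \<in> {0<..<len M e} \<Longrightarrow> D (param M e t) =
    (\<Sum>i<length (edge_mult c e). if x e i = t then int (edge_mult c e ! i) else 0)"
  using chips unfolding chip_positions_def by blast

lemma brk_less:
  assumes e: "e \<in> edges M" and j: "j \<le> length (edge_mult c e)"
  shows "brk M c x e j < brk M c x e (Suc j)"
proof -
  let ?n = "length (edge_mult c e)"
  have less: "\<And>i j. i < j \<Longrightarrow> j < ?n \<Longrightarrow> x e i < x e j"
    using chips e unfolding chip_positions_def by blast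
  show ?thesis
    using less[of "j - 1" j] chip_interior[OF e, of j] chip_interior[OF e, of "j - 1"] len_pos[OF e] j
    by (cases j; cases "j = ?n") (auto simp: breakpoint_def)
qed

lemma brk_strict:
  assumes "e \<in> edges M" "i < j" "j \<le> Suc (length (edge_mult c e))"
  shows "brk M c x e i < brk M c x e j"
  using increasing_less[of "length (edge_mult c e)" "brk M c x e" i j] brk_less assms by blast

lemma brk_range:
  assumes "e \<in> edges M" "j \<le> Suc (length (edge_mult c e))"
  shows "brk M c x e j \<in> {0..len M e}"
  using brk_strict[OF assms(1), of 0 j] brk_strict[OF assms(1), of j "Suc (length (edge_mult c e))"] assms
    len_pos[OF assms(1)]
  by (cases "j = 0"; cases "j = Suc (length (edge_mult c e))") auto

lemma chip_free:
  assumes e: "e \<in> edges M" and j: "j \<le> length (edge_mult c e)"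
    and t: "brk M c x e j < t" "t < brk M c x e (Suc j)"
  shows "D (param M e t) = 0"
proof -
  let ?n = "length (edge_mult c e)"
  have tin: "t \<in> {0<..<len M e}" using brk_range[OF e, of j] brk_range[OF e, of "Suc j"] j t by auto
  have "x e i \<noteq> t" if "i < ?n" for i
  proof (cases "Suc i \<le> j")
    case True
    then have "brk M c x e (Suc i) \<le> brk M c x e j"
      using brk_strict[OF e, of "Suc i" j] j by (cases "Suc i = j") auto
    then show ?thesis using t that by simp
  next
    case False
    then have "brk M c x e (Suc j) \<le> brk M c x e (Suc i)"
      using brk_strict[OF e, of "Suc j" "Suc i"] that by (cases "i = j") auto
    then show ?thesis using t that by simp
  qed
  then show ?thesis unfolding chip_value[OF e tin] by (intro sum.neutral) auto
qed

lemma chip_at: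
  assumes e: "e \<in> edges M" and i: "i < length (edge_mult c e)"
  shows "D (param M e (x e i)) = int (edge_mult c e ! i)"
proof -
  have "x e j = x e i \<longleftrightarrow> j = i" if "j < length (edge_mult c e)" for j
    using chips e i that unfolding chip_positions_def by (metis nat_neq_iff order_less_irrefl)
  then have "D (param M e (x e i)) =
      (\<Sum>j<length (edge_mult c e). if j = i then int (edge_mult c e ! i) else 0)"
    unfolding chip_value[OF e chip_interior[OF e i]] by (intro sum.cong) auto
  then show ?thesis using i by simp
qed

lemma midpt_between:
  assumes "e \<in> edges M" "j \<le> length (edge_mult c e)"
  shows "brk M c x e j < midpt M c x e j" "midpt M c x e j < brk M c x e (Suc j)"
  using brk_less[OF assms] by (auto simp: midpt_def field_simps)

lemma midpt_range:
  assumes "e \<in> edges M" "j \<le> length (edge_mult c e)"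
  shows "midpt M c x e j \<in> {0<..<len M e}"
  using midpt_between[OF assms] brk_range[OF assms(1), of j] brk_range[OF assms(1), of "Suc j"] assms(2)
  by auto

lemma chip_const_midpt:
  assumes h: "chip_const M D h" and e: "e \<in> edges M" and j: "j \<le> length (edge_mult c e)"
    and t: "brk M c x e j < t" "t < brk M c x e (Suc j)"
  shows "h (param M e t) = h (param M e (midpt M c x e j))"
proof -
  have *: "h (param M e a) = h (param M e b)"
    if "a \<le> b" "brk M c x e j < a" "b < brk M c x e (Suc j)" for a b
    using that brk_range[OF e, of j] brk_range[OF e, of "Suc j"] j
    by (intro chip_constD[OF h e]) (auto intro!: chip_free[OF e j])
  show ?thesis
  proof (cases "t \<le> midpt M c x e j")
    case True
    then show ?thesis using *[OF _ t(1)] midpt_between(2)[OF e j] by blast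
  next
    case False
    then show ?thesis using *[of "midpt M c x e j" t, symmetric] midpt_between(1)[OF e j] t(2) by simp
  qed
qed

lemma chip_const_ends:
  assumes h: "chip_const M D h" and e: "e \<in> edges M"
  shows "h (param M e 0) = h (param M e (midpt M c x e 0))"
    "h (param M e (len M e)) = h (param M e (midpt M c x e (length (edge_mult c e))))"
proof -
  let ?n = "length (edge_mult c e)"
  show "h (param M e 0) = h (param M e (midpt M c x e 0))"
    using midpt_between[OF e, of 0] midpt_range[OF e, of 0]
    by (intro chip_constD[OF h e]) (auto intro!: chip_free[OF e, of 0])
  have "h (param M e (midpt M c x e ?n)) = h (param M e (len M e))"
    using midpt_between[OF e, of ?n] midpt_range[OF e, of ?n]
    by (intro chip_constD[OF h e]) (auto intro!: chip_free[OF e, of ?n])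
  then show "h (param M e (len M e)) = h (param M e (midpt M c x e ?n))" by simp
qed

lemma velocity_perturb:
  assumes D: "D \<in> open_cell M D0 c" and h: "chip_const M D h"
  obtains \<epsilon> D' where "\<epsilon> > 0" "D' \<in> open_cell M D0 c"
    "chip_positions M c D' (x + coord_scale \<epsilon> (velocity M c x h))"
proof -
  let ?n = "\<lambda>e. length (edge_mult c e)" and ?m = "\<lambda>e i. edge_mult c e ! i"
  let ?\<delta> = "velocity M c x h"
  from D obtain f where f: "D \<in> linear_system M D0" "rational_function M f" "D = D0 + principal M f"
    "\<And>e. e \<in> edges M \<Longrightarrow> slope_right (f \<circ> param M e) 0 = init_slope c e"
    unfolding open_cell_def by blast
  have eff: "\<And>x. D x \<ge> 0" using f(1) by (auto simp: linear_system_def effective_def)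
  define S where "S = (SIGMA e:edges M. {..?n e})"
  have "finite S" using finite_edges by (auto simp: S_def)
  define \<Delta> where "\<Delta> e j = breakpoint 0 (?n e) (?\<delta> e) j" for e j
  have "\<forall>\<^sub>F r in at_right 0. \<forall>s\<in>S. (brk M c x (fst s) (Suc (snd s)) - brk M c x (fst s) (snd s)) +
      r * (\<Delta> (fst s) (Suc (snd s)) - \<Delta> (fst s) (snd s)) > 0"
    using \<open>finite S\<close> brk_less by (intro eventually_affine_pos) (auto simp: S_def)
  then obtain \<epsilon> where "\<epsilon> > 0" and small: "\<forall>s\<in>S. (brk M c x (fst s) (Suc (snd s)) - brk M c x (fst s) (snd s)) +
      \<epsilon> * (\<Delta> (fst s) (Suc (snd s)) - \<Delta> (fst s) (snd s)) > 0"
    using eventually_happens'[OF trivial_limit_at_right_real eventually_conj[OF _ eventually_at_right_less]]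
    by blast
  have \<epsilon>: "\<epsilon> > 0" "brk M c x e j + \<epsilon> * \<Delta> e j < brk M c x e (Suc j) + \<epsilon> * \<Delta> e (Suc j)"
    if "e \<in> edges M" "j \<le> ?n e" for e j
    using \<open>\<epsilon> > 0\<close> bspec[OF small, of "(e, j)"] that by (simp_all add: S_def algebra_simps)
  define x' where "x' = x + coord_scale \<epsilon> ?\<delta>"
  have x': "x' e i = x e i + \<epsilon> * ?\<delta> e i" for e i by (simp add: x'_def coord_scale_def)
  have brk': "brk M c x' e j = brk M c x e j + \<epsilon> * \<Delta> e j" for e j
    by (auto simp: breakpoint_def \<Delta>_def x')
  have less': "brk M c x' e i < brk M c x' e j" if "e \<in> edges M" "i < j" "j \<le> Suc (?n e)" for e i j
    using increasing_less[of "?n e" "brk M c x' e" i j] \<epsilon>(2)[OF that(1)] that by (simp add: brk')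
  have x'_in: "x' e i \<in> {0<..<len M e}" if "e \<in> edges M" "i < ?n e" for e i
    using less'[OF that(1), of 0 "Suc i"] less'[OF that(1), of "Suc i" "Suc (?n e)"] that by simp
  have x'_less: "x' e i < x' e j" if "e \<in> edges M" "i < j" "j < ?n e" for e i j
    using less'[OF that(1), of "Suc i" "Suc j"] that by simp
  define A where "A = (SIGMA e:edges M. {..<?n e})"
  have A: "finite A" using finite_edges by (simp add: A_def)
  obtain g where g: "rational_function M g"
    "\<And>y. principal M g y = (\<Sum>a\<in>A. int (?m (fst a) (snd a)) *
       (of_bool (param M (fst a) (x' (fst a) (snd a)) = y) - of_bool (param M (fst a) (x (fst a) (snd a)) = y)))"
    "\<And>e. e \<in> edges M \<Longrightarrow> slope_right (g \<circ> param M e) 0 =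
       (\<Sum>a | a \<in> A \<and> fst a = e. int (?m (fst a) (snd a)) *
       (of_bool (x' (fst a) (snd a) = 0) - of_bool (x (fst a) (snd a) = 0)))"
  proof (rule principal_moves[of A fst "\<lambda>a. x (fst a) (snd a)" "\<lambda>a. x' (fst a) (snd a)" "\<lambda>v. \<epsilon> * h v"
        "\<lambda>a. int (?m (fst a) (snd a))"])
    fix e assume e: "e \<in> edges M"
    have "(\<Sum>a | a \<in> A \<and> fst a = e. of_int (int (?m (fst a) (snd a))) * (x' (fst a) (snd a) - x (fst a) (snd a))) =
        (\<Sum>i<?n e. real (?m e i) * (x' e i - x e i))"
      by (rule sum.reindex_bij_witness[of _ "\<lambda>i. (e, i)" snd]) (use e in \<open>auto simp: A_def\<close>)
    also have "\<dots> = (\<Sum>i<?n e. \<epsilon> * (h (param M e (midpt M c x e i)) - h (param M e (midpt M c x e (Suc i)))))"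
      using mult_pos[OF e] e by (intro sum.cong) (auto simp: x' velocity_def)
    also have "\<dots> = \<epsilon> * (h (param M e (midpt M c x e 0)) - h (param M e (midpt M c x e (?n e))))"
      by (simp only: sum_distrib_left[symmetric]
          sum_lessThan_telescope'[of "\<lambda>i. h (param M e (midpt M c x e i))"])
    finally show "\<epsilon> * h (param M e 0) - \<epsilon> * h (param M e (len M e)) =
        (\<Sum>a | a \<in> A \<and> fst a = e. of_int (int (?m (fst a) (snd a))) * (x' (fst a) (snd a) - x (fst a) (snd a)))"
      using chip_const_ends[OF h e] by (simp add: right_diff_distrib)
  next
    fix a assume "a \<in> A"
    then show "x (fst a) (snd a) \<in> {0..len M (fst a)}" "x' (fst a) (snd a) \<in> {0..len M (fst a)}"
      using chip_interior[of "fst a" "snd a"] x'_in[of "fst a" "snd a"] by (auto simp: A_def)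
  qed (use A in \<open>auto simp: A_def\<close>)
  define D' where "D' = D + principal M g"
  have D'V: "D' v = D v" if "v \<in> verts M" for v
  proof -
    have "principal M g v = 0"
      unfolding g(2)
    proof (intro sum.neutral ballI)
      fix a assume "a \<in> A"
      then have "param M (fst a) (x' (fst a) (snd a)) \<noteq> v" "param M (fst a) (x (fst a) (snd a)) \<noteq> v"
        using that param_interior[OF _ x'_in[of "fst a" "snd a"]]
          param_interior[OF _ chip_interior[of "fst a" "snd a"]] by (auto simp: A_def)
      then show "int (?m (fst a) (snd a)) *
         (of_bool (param M (fst a) (x' (fst a) (snd a)) = v) -
          of_bool (param M (fst a) (x (fst a) (snd a)) = v)) = 0" by simp
    qed
    then show ?thesis by (simp add: D'_def)
  qed
  have D'E: "D' (param M e t) = (\<Sum>i<?n e. if x' e i = t then int (?m e i) else 0)"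
    if e: "e \<in> edges M" and t: "t \<in> {0<..<len M e}" for e t
  proof -
    have "principal M g (param M e t) = (\<Sum>a | a \<in> A \<and> fst a = e. int (?m e (snd a)) *
       (of_bool (x' e (snd a) = t) - of_bool (x e (snd a) = t)))"
      unfolding g(2)
    proof (rule sum.mono_neutral_cong_right[OF A])
      show "\<forall>a\<in>A - {a \<in> A. fst a = e}. int (?m (fst a) (snd a)) *
       (of_bool (param M (fst a) (x' (fst a) (snd a)) = param M e t) -
        of_bool (param M (fst a) (x (fst a) (snd a)) = param M e t)) = 0"
      proof
        fix a assume a: "a \<in> A - {a \<in> A. fst a = e}"
        then have "fst a \<in> edges M" "fst a \<noteq> e" "x (fst a) (snd a) \<in> {0..len M (fst a)}"
          "x' (fst a) (snd a) \<in> {0..len M (fst a)}"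
          using chip_interior[of "fst a" "snd a"] x'_in[of "fst a" "snd a"] by (auto simp: A_def)
        then have "param M (fst a) (x' (fst a) (snd a)) \<noteq> param M e t"
          "param M (fst a) (x (fst a) (snd a)) \<noteq> param M e t"
          using param_inj(1)[OF e _ t] by metis+
        then show "int (?m (fst a) (snd a)) *
         (of_bool (param M (fst a) (x' (fst a) (snd a)) = param M e t) -
          of_bool (param M (fst a) (x (fst a) (snd a)) = param M e t)) = 0" by simp
      qed
      fix a assume a: "a \<in> {a \<in> A. fst a = e}"
      then have "fst a = e" and *: "x e (snd a) \<in> {0..len M e}" "x' e (snd a) \<in> {0..len M e}"
        using chip_interior[of e "snd a"] x'_in[of e "snd a"] by (auto simp: A_def)
      have "param M e (x' e (snd a)) = param M e t \<longleftrightarrow> x' e (snd a) = t"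
        "param M e (x e (snd a)) = param M e t \<longleftrightarrow> x e (snd a) = t"
        using param_inj(2)[OF e e t *(1)] param_inj(2)[OF e e t *(2)] by metis+
      then show "int (?m (fst a) (snd a)) * (of_bool (param M (fst a) (x' (fst a) (snd a)) = param M e t) -
          of_bool (param M (fst a) (x (fst a) (snd a)) = param M e t)) =
          int (?m e (snd a)) * (of_bool (x' e (snd a) = t) - of_bool (x e (snd a) = t))"
        using \<open>fst a = e\<close> by simp
    qed auto
    also have "\<dots> = (\<Sum>i<?n e. int (?m e i) * (of_bool (x' e i = t) - of_bool (x e i = t)))"
      by (rule sum.reindex_bij_witness[of _ "\<lambda>i. (e, i)" snd]) (use e in \<open>auto simp: A_def\<close>)
    finally show ?thesis
      unfolding D'_def plus_fun_apply chip_value[OF e t] sum.distrib[symmetric]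
      by (simp only: sum.distrib[symmetric]) (intro sum.cong, auto)
  qed
  have fin: "finite {y. principal M g y \<noteq> 0}"
  proof (rule finite_subset)
    show "{y. principal M g y \<noteq> 0} \<subseteq>
        (\<lambda>a. param M (fst a) (x (fst a) (snd a))) ` A \<union> (\<lambda>a. param M (fst a) (x' (fst a) (snd a))) ` A"
        (is "_ \<subseteq> ?U")
    proof (rule subsetI, rule ccontr)
      fix y assume y: "y \<in> {y. principal M g y \<noteq> 0}" "y \<notin> ?U"
      have "principal M g y = 0"
        unfolding g(2) using y(2) by (intro sum.neutral) force
      then show False using y(1) by simp
    qed
  qed (use A in simp)
  have nonneg: "D y + principal M g y \<ge> 0" if "y \<in> points M" for y
    using that
  proof (cases rule: points_cases)
    case 1
    then show ?thesis using D'V[OF 1] eff[of y] by (simp add: D'_def)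
  next
    case (2 e t)
    then have "D' y \<ge> 0" unfolding 2(3) D'E[OF 2(1,2)] by (intro sum_nonneg) auto
    then show ?thesis by (simp add: D'_def)
  qed
  note step = linear_system_step[OF f(1-3) g(1) fin nonneg, folded D'_def]
  have pos': "chip_positions M c D' x'"
    unfolding chip_positions_def
  proof (intro conjI ballI allI impI)
    fix v assume "v \<in> verts M"
    then show "D' v = int (vert_mult c v)" using D'V chips by (simp add: chip_positions_def)
  next
    fix e m assume "e \<in> edges M" "m \<in> set (edge_mult c e)"
    then show "m > 0" using chips unfolding chip_positions_def by blast
  next
    fix e i assume "e \<notin> edges M \<or> i \<ge> ?n e"
    then show "x' e i = 0" using chips by (auto simp: x' velocity_def chip_positions_def)
  qed (use x'_in x'_less D'E in blast)+
  have "slope_right ((\<lambda>x. f x + g x) \<circ> param M e) 0 = init_slope c e" if e: "e \<in> edges M" for e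
  proof -
    have "slope_right (g \<circ> param M e) 0 = 0"
      unfolding g(3)[OF e] using chip_interior[OF e] x'_in[OF e]
      by (intro sum.neutral) (force simp: A_def)
    then show ?thesis using slopes_add(1)[OF f(2) g(1) e, of 0] len_pos[OF e] f(4)[OF e] by simp
  qed
  then have "D' \<in> open_cell M D0 c"
    unfolding open_cell_def using step pos' by blast
  then show ?thesis using that[OF \<open>\<epsilon> > 0\<close>] pos' by (simp add: x'_def)
qed

lemma velocity_zero_const:
  assumes h: "chip_const M D h" and z: "velocity M c x h = 0"
    and e: "e \<in> edges M" and t: "t \<in> {0..len M e}" "t \<in> {0<..<len M e} \<Longrightarrow> D (param M e t) = 0"
  shows "h (param M e t) = h (param M e 0)"
proof -
  let ?n = "length (edge_mult c e)"
  have step: "h (param M e (midpt M c x e (Suc i))) = h (param M e (midpt M c x e i))" if "i < ?n" for i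
    using fun_cong[OF fun_cong[OF z], of e i] mult_pos[OF e that] e that by (simp add: velocity_def)
  have mid: "h (param M e (midpt M c x e j)) = h (param M e 0)" if "j \<le> ?n" for j
    using that by (induction j) (simp_all add: step chip_const_ends(1)[OF h e])
  show ?thesis
  proof (cases "t \<in> {0<..<len M e}")
    case False
    then have "t = 0 \<or> t = len M e" using t by auto
    then show ?thesis using mid[of ?n] chip_const_ends(2)[OF h e] by auto
  next
    case True
    obtain j where j: "j \<le> ?n" "brk M c x e j \<le> t" "t < brk M c x e (Suc j)"
      using breakpoint_locate[of t "len M e" ?n "x e" ?n] True by auto
    have "brk M c x e j \<noteq> t"
    proof
      assume eq: "brk M c x e j = t"
      then obtain i where i: "j = Suc i" using True by (cases j) auto
      then show False using chip_at[OF e, of i] t(2)[OF True] mult_pos[OF e, of i] j(1) eq by simp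
    qed
    then show ?thesis using chip_const_midpt[OF h e j(1)] j mid[OF j(1)] by simp
  qed
qed

lemma velocity_zero_same:
  assumes h: "chip_const M D h" and z: "velocity M c x h = 0"
    and y: "e \<in> edges M" "t \<in> {0<..<len M e}" "D (param M e t) = 0"
    and y': "e' \<in> edges M" "t' \<in> {0<..<len M e'}" "D (param M e' t') = 0"
    and same: "same_piece M (\<lambda>_. 0) (param M e t) (param M e' t')"
  shows "h (param M e t) = h (param M e' t')"
proof -
  define k where "k y = (if y \<in> verts M then h y else
    h (param M (SOME e. e \<in> edges M \<and> y \<in> param M e ` {0<..<len M e}) 0))" for y
  have k: "k (param M e t) = h (param M e 0)" if e: "e \<in> edges M" and t: "t \<in> {0..len M e}" for e t
  proof (cases "t \<in> {0<..<len M e}")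
    case True
    have "(SOME e'. e' \<in> edges M \<and> param M e t \<in> param M e' ` {0<..<len M e'}) = e"
    proof (rule some_equality)
      fix e' assume "e' \<in> edges M \<and> param M e t \<in> param M e' ` {0<..<len M e'}"
      then obtain t' where "e' \<in> edges M" "t' \<in> {0<..<len M e'}" "param M e t = param M e' t'" by blast
      then show "e' = e" using param_inj(1)[OF e _ True, of e' t'] by simp
    qed (use True e in blast)
    then show ?thesis using param_interior[OF e True] by (simp add: k_def)
  next
    case False
    then have "t = 0 \<or> t = len M e" using t by auto
    then show ?thesis
      using velocity_zero_const[OF h z e, of t] t param_0[OF e] param_len[OF e] by (auto simp: k_def)
  qed
  have "chip_const M (\<lambda>_. 0) k"
    unfolding chip_const_def using k by (metis atLeastAtMost_iff order_trans)
  then have "k (param M e t) = k (param M e' t')" using same by (simp add: same_piece_def)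
  then show ?thesis
    using k[of e t] k[of e' t'] velocity_zero_const[OF h z, of e t] velocity_zero_const[OF h z, of e' t'] y y'
    by simp
qed

end

lemma closed_zero_coords: "closed {z :: 'e \<Rightarrow> nat \<Rightarrow> real. \<forall>e i. \<not> P e i \<longrightarrow> z e i = 0}"
proof -
  have "closed {z :: 'e \<Rightarrow> nat \<Rightarrow> real. z e i = 0}" for e i
  proof -
    have "continuous_on UNIV (\<lambda>z :: 'e \<Rightarrow> nat \<Rightarrow> real. z e)"
      by (rule continuous_on_product_coordinates)
    then have "continuous_on UNIV (\<lambda>z :: 'e \<Rightarrow> nat \<Rightarrow> real. z e i)"
      by (rule continuous_on_product_then_coordinatewise)
    then show ?thesis by (intro closed_Collect_eq) auto
  qed
  then show ?thesis
    by (intro closed_Collect_all closed_Collect_imp) auto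
qed

lemma sum_apply2:
  fixes F :: "'i \<Rightarrow> 'b \<Rightarrow> 'c \<Rightarrow> 'd :: comm_monoid_add"
  shows "(\<Sum>a\<in>A. F a) b c = (\<Sum>a\<in>A. F a b c)"
  by (induction A rule: infinite_finite_induct) auto

lemma card_le_polyhedron_dim:
  fixes w :: "'s \<Rightarrow> 'e \<Rightarrow> nat \<Rightarrow> real"
  assumes J: "finite J" and supp: "\<And>z e i. z \<in> P \<Longrightarrow> (e, i) \<notin> J \<Longrightarrow> z e i = 0"
    and S: "finite S" and w: "\<And>s. s \<in> S \<Longrightarrow> \<exists>r>0. \<exists>y\<in>P. \<exists>z\<in>P. y - z = coord_scale r (w s)"
    and ind: "\<And>a s. (\<And>e i. (\<Sum>s\<in>S. a s * w s e i) = 0) \<Longrightarrow> s \<in> S \<Longrightarrow> a s = 0"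
  shows "card S \<le> polyhedron_dim P"
proof -
  interpret V: vector_space "coord_scale :: real \<Rightarrow> ('e \<Rightarrow> nat \<Rightarrow> real) \<Rightarrow> _"
    by (rule vector_space_coord_scale)
  define W where "W = {x - y | x y. x \<in> P \<and> y \<in> P}"
  define unit where "unit p = (\<lambda>e i. of_bool ((e, i) = p) :: real)" for p :: "'e \<times> nat"
  have W: "W \<subseteq> V.span (unit ` J)"
  proof
    fix z assume "z \<in> W"
    then obtain y y' where "z = y - y'" "y \<in> P" "y' \<in> P" by (auto simp: W_def)
    then have z: "z e i = 0" if "(e, i) \<notin> J" for e i
      using supp[of y, OF _ that] supp[of y', OF _ that] by simp
    have "z = (\<Sum>p\<in>J. coord_scale (z (fst p) (snd p)) (unit p))"
    proof (intro ext)
      fix e i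
      have "(\<Sum>p\<in>J. coord_scale (z (fst p) (snd p)) (unit p)) e i = (\<Sum>p\<in>J. if p = (e, i) then z e i else 0)"
        unfolding sum_apply2 by (intro sum.cong) (auto simp: coord_scale_def unit_def)
      then show "z e i = (\<Sum>p\<in>J. coord_scale (z (fst p) (snd p)) (unit p)) e i"
        using J z[of e i] by auto
    qed
    also have "\<dots> \<in> V.span (unit ` J)"
      by (intro V.span_sum V.span_scale V.span_base) auto
    finally show "z \<in> V.span (unit ` J)" .
  qed
  obtain B where B: "B \<subseteq> W" "V.independent B" "W \<subseteq> V.span B" "card B = V.dim W"
    using V.basis_exists[of W] by blast
  have "finite B"
    using V.independent_span_bound[of "unit ` J" B] J B W by auto
  have "w s \<in> V.span B" if s: "s \<in> S" for s
  proof -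
    obtain r y z where r: "r > 0" "y \<in> P" "z \<in> P" "y - z = coord_scale r (w s)" using w[OF s] by blast
    then have "coord_scale r (w s) \<in> W" unfolding W_def by (metis (mono_tags, lifting) mem_Collect_eq)
    then have "coord_scale r (w s) \<in> V.span B" using B(3) by blast
    then have "coord_scale (1 / r) (coord_scale r (w s)) \<in> V.span B"
      by (rule V.span_scale)
    moreover have "coord_scale (1 / r) (coord_scale r (w s)) = w s"
      using r(1) by (simp add: coord_scale_def)
    ultimately show ?thesis by simp
  qed
  moreover have inj: "inj_on w S"
  proof (rule inj_onI, rule ccontr)
    fix s s' assume ss: "s \<in> S" "s' \<in> S" "w s = w s'" "s \<noteq> s'"
    define a where "a r = (of_bool (r = s) - of_bool (r = s') :: real)" for r
    have "(\<Sum>r\<in>S. a r * w r e i) = 0" for e i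
    proof -
      have "(\<Sum>r\<in>S. a r * w r e i) = (\<Sum>r\<in>S. (if r = s then w s e i else 0) - (if r = s' then w s' e i else 0))"
        by (intro sum.cong) (auto simp: a_def)
      then show ?thesis using S ss by (simp add: sum_subtractf)
    qed
    from ind[OF this ss(1)] show False using ss by (simp add: a_def)
  qed
  moreover have "V.independent (w ` S)"
  proof (rule V.independent_if_scalars_zero)
    fix f y assume f: "(\<Sum>y\<in>w ` S. coord_scale (f y) y) = 0" and "y \<in> w ` S"
    then obtain s where s: "s \<in> S" "y = w s" by blast
    have "(\<Sum>s\<in>S. f (w s) * w s e i) = 0" for e i
      using fun_cong[OF fun_cong[OF f], of e i] inj
      by (simp add: sum.reindex sum_apply2 coord_scale_def)
    from ind[OF this s(1)] show "f y = 0" using s by simp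
  qed (use S in simp)
  ultimately have "card (w ` S) \<le> card B"
    using V.independent_span_bound[OF \<open>finite B\<close>, of "w ` S"] by blast
  then show ?thesis using inj B(4) by (simp add: card_image polyhedron_dim_def W_def)
qed

lemma card_pieces_le_cell_dim:
  assumes D: "D \<in> open_cell M D0 c"
    and S: "finite S"
      "\<And>s. s \<in> S \<Longrightarrow> \<exists>e\<in>edges M. \<exists>t\<in>{0<..<len M e}. s = param M e t"
      "\<And>s. s \<in> S \<Longrightarrow> D s = 0"
      "\<And>s. s \<in> S \<Longrightarrow> same_piece M (\<lambda>_. 0) s y0"
      "\<And>s s'. s \<in> S \<Longrightarrow> s' \<in> S \<Longrightarrow> s \<noteq> s' \<Longrightarrow> \<not> same_piece M D s s'"
  shows "card S \<le> Suc (cell_dim M D0 c)"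
proof (cases "S = {}")
  case False
  then obtain s0 where s0: "s0 \<in> S" by blast
  obtain x where x: "chip_positions M c D x" using D by (auto simp: open_cell_def)
  define P where "P = {x. \<exists>D\<in>open_cell M D0 c. chip_positions M c D x}"
  define h where "h s y = (of_bool (same_piece M D y s) :: real)" for s y
  have hc: "chip_const M D (h s)" for s unfolding h_def by (rule chip_const_same_piece)
  define J where "J = (SIGMA e:edges M. {..<length (edge_mult c e)})"
  have "card (S - {s0}) \<le> polyhedron_dim (closure P)"
  proof (rule card_le_polyhedron_dim[of J _ _ "\<lambda>s. velocity M c x (h s)"])
    show "finite J" using finite_edges by (simp add: J_def)
    have "closure P \<subseteq> {z. \<forall>e i. \<not> (e, i) \<in> J \<longrightarrow> z e i = 0}"
      by (rule closure_minimal[OF _ closed_zero_coords]) (auto simp: P_def J_def chip_positions_def)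
    then show "z e i = 0" if "z \<in> closure P" "(e, i) \<notin> J" for z e i using that by blast
    show "finite (S - {s0})" using S by simp
    have "x \<in> closure P" using x D closure_subset[of P] by (auto simp: P_def)
    fix s
    obtain \<epsilon> D' where "\<epsilon> > 0" "D' \<in> open_cell M D0 c"
      "chip_positions M c D' (x + coord_scale \<epsilon> (velocity M c x (h s)))"
      by (rule velocity_perturb[OF x D hc])
    then show "\<exists>r>0. \<exists>y\<in>closure P. \<exists>z\<in>closure P. y - z = coord_scale r (velocity M c x (h s))"
      using \<open>x \<in> closure P\<close> closure_subset[of P]
      by (intro exI[of _ \<epsilon>] conjI bexI[of _ x] bexI[of _ "x + coord_scale \<epsilon> (velocity M c x (h s))"])
        (auto simp: P_def)
  next
    fix a s assume z: "\<And>e i. (\<Sum>s\<in>S - {s0}. a s * velocity M c x (h s) e i) = 0" and s: "s \<in> S - {s0}"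
    define H where "H y = (\<Sum>s\<in>S - {s0}. a s * h s y)" for y
    have H: "chip_const M D H" unfolding H_def by (rule chip_const_sum) (rule hc)
    have vz: "velocity M c x H = 0"
      unfolding H_def by (intro ext) (simp add: velocity_sum z)
    obtain e t e' t' where et: "e \<in> edges M" "t \<in> {0<..<len M e}" "s = param M e t"
      "e' \<in> edges M" "t' \<in> {0<..<len M e'}" "s0 = param M e' t'"
      using S(2)[of s] S(2)[OF s0] s by blast
    have "same_piece M (\<lambda>_. 0) s s0"
      using S(4)[of s] S(4)[OF s0] s same_piece_sym same_piece_trans by (metis DiffD1)
    then have "H s = H s0"
      using velocity_zero_same[OF x H vz et(1,2) _ et(4,5)] S(3)[of s] S(3)[OF s0] s et by simp
    moreover have "H s0 = 0"
      unfolding H_def using S(5)[OF s0] by (intro sum.neutral) (auto simp: h_def)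
    moreover have "H s = (\<Sum>r\<in>S - {s0}. if r = s then a s else 0)"
      unfolding H_def using S(5)[of s] s by (intro sum.cong refl) (auto simp: h_def same_piece_refl)
    then have "H s = a s" using S(1) s by simp
    ultimately show "a s = 0" by simp
  qed
  then show ?thesis
    using s0 S(1) by (simp add: cell_dim_def cell_polyhedron_def P_def)
qed simp

end

section \<open>Firing\<close>

text \<open>Firing a subset of \<open>\<Gamma>\<close> bounded by breakpoints: the index \<open>(e, j, True)\<close> stands for a chip leaving the
  left end of the \<open>j\<close>-th piece of \<open>e\<close>, and \<open>(e, j, False)\<close> for one leaving its right end. After the move by
  \<open>\<epsilon>\<close>, the chips of \<open>e\<close> sit in the slots \<open>(j, s)\<close> at distance \<open>s * \<epsilon>\<close> from the \<open>j\<close>-th breakpoint.\<close>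

definition fire_index :: "('a, 'e) modelled_graph \<Rightarrow> ('a, 'e) cell_data \<Rightarrow> ('e \<times> nat \<times> bool) set" where
  "fire_index M c = (SIGMA e:edges M. {..length (edge_mult c e)} \<times> UNIV)"

fun fire_from :: "nat \<times> bool \<Rightarrow> nat" where
  "fire_from (j, right) = (if right then j else Suc j)"

fun fire_to :: "nat \<times> bool \<Rightarrow> nat \<times> int" where
  "fire_to (j, right) = (if right then (j, 1) else (Suc j, - 1))"

definition slot :: "('a, 'e) modelled_graph \<Rightarrow> ('a, 'e) cell_data \<Rightarrow> ('e \<Rightarrow> nat \<Rightarrow> real) \<Rightarrow> real \<Rightarrow> 'e \<Rightarrow> nat \<times> int \<Rightarrow> real" where
  "slot M c x \<epsilon> e k = brk M c x e (fst k) + of_int (snd k) * \<epsilon>"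

definition slots :: "('a, 'e) cell_data \<Rightarrow> 'e \<Rightarrow> (nat \<times> int) set" where
  "slots c e = {(j, s). j \<le> Suc (length (edge_mult c e)) \<and> s \<in> {- 1, 0, 1} \<and>
     (j = 0 \<longrightarrow> s = 1) \<and> (j = Suc (length (edge_mult c e)) \<longrightarrow> s = - 1)}"

definition fine_step :: "('a, 'e) modelled_graph \<Rightarrow> ('a, 'e) cell_data \<Rightarrow> ('e \<Rightarrow> nat \<Rightarrow> real) \<Rightarrow> real \<Rightarrow> bool" where
  "fine_step M c x \<epsilon> \<longleftrightarrow> \<epsilon> > 0 \<and> (\<forall>e\<in>edges M. \<forall>j\<le>length (edge_mult c e).
     2 * \<epsilon> < brk M c x e (Suc j) - brk M c x e j)"

definition fired_from :: "('a, 'e) modelled_graph \<Rightarrow> ('a, 'e) cell_data \<Rightarrow> ('e \<Rightarrow> nat \<Rightarrow> real) \<Rightarrow>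
    ('e \<times> nat \<times> bool \<Rightarrow> int) \<Rightarrow> 'a \<Rightarrow> int" where
  "fired_from M c x w y = (\<Sum>a\<in>fire_index M c. w a *
     of_bool (param M (fst a) (brk M c x (fst a) (fire_from (snd a))) = y))"

definition fired_to :: "('a, 'e) modelled_graph \<Rightarrow> ('a, 'e) cell_data \<Rightarrow> ('e \<Rightarrow> nat \<Rightarrow> real) \<Rightarrow> real \<Rightarrow>
    ('e \<times> nat \<times> bool \<Rightarrow> int) \<Rightarrow> 'a \<Rightarrow> int" where
  "fired_to M c x \<epsilon> w y = (\<Sum>a\<in>fire_index M c. w a *
     of_bool (param M (fst a) (slot M c x \<epsilon> (fst a) (fire_to (snd a))) = y))"

definition fired_slope :: "('a, 'e) modelled_graph \<Rightarrow> ('a, 'e) cell_data \<Rightarrow>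
    ('e \<times> nat \<times> bool \<Rightarrow> int) \<Rightarrow> 'e \<Rightarrow> int" where
  "fired_slope M c w e = - (\<Sum>a | a \<in> fire_index M c \<and> fst a = e. w a * of_bool (fire_from (snd a) = 0))"

definition slot_value :: "('a, 'e) modelled_graph \<Rightarrow> ('a, 'e) cell_data \<Rightarrow>
    ('e \<times> nat \<times> bool \<Rightarrow> int) \<Rightarrow> 'e \<Rightarrow> nat \<times> int \<Rightarrow> int" where
  "slot_value M c w e k = (if snd k = 0 then int (edge_mult c e ! (fst k - 1)) else 0) +
     (\<Sum>a\<in>fire_index M c. w a * of_bool (fst a = e \<and> fire_to (snd a) = k)) -
     (\<Sum>a\<in>fire_index M c. w a * of_bool (fst a = e \<and> (fire_from (snd a), 0) = k))"

lemma fire_index_mem [simp]: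
  "(e, p) \<in> fire_index M c \<longleftrightarrow> e \<in> edges M \<and> fst p \<le> length (edge_mult c e)"
  by (cases p) (auto simp: fire_index_def)

lemma fire_from_le: "(e, p) \<in> fire_index M c \<Longrightarrow> fire_from p \<le> Suc (length (edge_mult c e))"
  by (cases p) auto

lemma fire_to_slots: "(e, p) \<in> fire_index M c \<Longrightarrow> fire_to p \<in> slots c e"
  by (cases p) (auto simp: slots_def)

context metrized_model
begin

lemma finite_fire_index: "finite (fire_index M c)"
  using finite_edges by (simp add: fire_index_def)

lemma fire_edge_sum:
  assumes "e \<in> edges M"
  shows "(\<Sum>a | a \<in> fire_index M c \<and> fst a = e. F a) =
    (\<Sum>j\<le>length (edge_mult c e). F (e, j, True) + F (e, j, False) :: 'b :: comm_monoid_add)"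
proof -
  have "{a. a \<in> fire_index M c \<and> fst a = e} = Pair e ` ({..length (edge_mult c e)} \<times> UNIV)"
    using assms by (auto simp: fire_index_def)
  then have "(\<Sum>a | a \<in> fire_index M c \<and> fst a = e. F a) =
      (\<Sum>p\<in>{..length (edge_mult c e)} \<times> (UNIV :: bool set). F (e, p))"
    by (simp add: sum.reindex inj_on_def)
  also have "\<dots> = (\<Sum>j\<le>length (edge_mult c e). \<Sum>b\<in>UNIV. F (e, j, b))"
    by (simp add: sum.cartesian_product)
  finally show ?thesis by (simp add: UNIV_bool add.commute)
qed

lemma fired_at_index:
  assumes "(e, p) \<in> fire_index M c" "\<And>p'. (e, p') \<in> fire_index M c \<Longrightarrow> g p' = g p \<Longrightarrow> p' = p"
  shows "(\<Sum>a\<in>fire_index M c. w a * of_bool (fst a = e \<and> g (snd a) = g p)) = (w (e, p) :: int)"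
proof -
  have "(\<Sum>a\<in>fire_index M c. w a * of_bool (fst a = e \<and> g (snd a) = g p)) =
      (\<Sum>a\<in>fire_index M c. if a = (e, p) then w (e, p) else 0)"
    using assms(2) by (intro sum.cong refl) auto
  then show ?thesis using assms(1) finite_fire_index by simp
qed

lemma fire_to_inj: "fire_to p = fire_to p' \<Longrightarrow> p = p'"
  by (cases p; cases p') (auto split: if_splits)

lemma slot_value_right:
  assumes "e \<in> edges M" "j \<le> length (edge_mult c e)"
  shows "slot_value M c w e (j, 1) = w (e, j, True)"
  using fired_at_index[of e "(j, True)" c fire_to w] assms fire_to_inj
  by (simp add: slot_value_def)

lemma slot_value_left:
  assumes "e \<in> edges M" "j \<le> length (edge_mult c e)"
  shows "slot_value M c w e (Suc j, - 1) = w (e, j, False)"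
  using fired_at_index[of e "(j, False)" c fire_to w] assms fire_to_inj
  by (simp add: slot_value_def)

lemma slot_value_centre:
  assumes "e \<in> edges M" "i < length (edge_mult c e)"
    and "w (e, Suc i, True) = 0" "w (e, i, False) = 0"
  shows "slot_value M c w e (Suc i, 0) = int (edge_mult c e ! i)"
proof -
  have "(\<Sum>a\<in>fire_index M c. w a * of_bool (fst a = e \<and> (fire_from (snd a), 0) = (Suc i, 0 :: int))) = 0"
    using assms by (intro sum.neutral) (auto split: if_splits)
  moreover have "(\<Sum>a\<in>fire_index M c. w a * of_bool (fst a = e \<and> fire_to (snd a) = (Suc i, 0))) = 0"
    by (intro sum.neutral) (auto split: if_splits)
  ultimately show ?thesis by (simp add: slot_value_def)
qed

context
  fixes c D x
  assumes chips: "chip_positions M c D x"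
begin

lemma eventually_fine_step: "\<forall>\<^sub>F \<epsilon> in at_right 0. fine_step M c x \<epsilon>"
proof -
  define S where "S = (SIGMA e:edges M. {..length (edge_mult c e)})"
  have "\<forall>\<^sub>F r in at_right 0. \<forall>s\<in>S. (brk M c x (fst s) (Suc (snd s)) - brk M c x (fst s) (snd s)) + r * (- 2) > 0"
    using finite_edges brk_less[OF chips] by (intro eventually_affine_pos) (auto simp: S_def)
  then show ?thesis
    using eventually_at_right_less[of "0 :: real"]
    by eventually_elim (auto simp: fine_step_def S_def mult.commute)
qed

lemma brk_interior:
  assumes "e \<in> edges M" "0 < j" "j \<le> length (edge_mult c e)"
  shows "brk M c x e j \<in> {0<..<len M e}"
  using brk_strict[OF chips assms(1), of 0 j] assms
    brk_strict[OF chips assms(1), of j "Suc (length (edge_mult c e))"] by simp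

lemma brk_vertex_iff:
  assumes "e \<in> edges M" "j \<le> Suc (length (edge_mult c e))" "v \<in> verts M"
  shows "param M e (brk M c x e j) = v \<longleftrightarrow>
    j = 0 \<and> param M e 0 = v \<or> j = Suc (length (edge_mult c e)) \<and> param M e (len M e) = v"
proof (cases "j = 0 \<or> j = Suc (length (edge_mult c e))")
  case False
  then show ?thesis
    using brk_interior[OF assms(1), of j] param_interior[OF assms(1), of "brk M c x e j"] assms by auto
qed auto

lemma brk_interior_iff:
  assumes e: "e \<in> edges M" "j \<le> Suc (length (edge_mult c e))"
    and e0: "e0 \<in> edges M" "0 < j0" "j0 \<le> length (edge_mult c e0)"
  shows "param M e (brk M c x e j) = param M e0 (brk M c x e0 j0) \<longleftrightarrow> e = e0 \<and> j = j0"
proof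
  assume eq: "param M e (brk M c x e j) = param M e0 (brk M c x e0 j0)"
  note inj = param_inj[OF e0(1) e(1) brk_interior[OF e0] brk_range[OF chips e] eq[symmetric]]
  have "j = j0"
    using brk_strict[OF chips e0(1), of j j0] brk_strict[OF chips e0(1), of j0 j] inj e e0(3)
    by (metis le_SucI less_irrefl linorder_neqE_nat)
  then show "e = e0 \<and> j = j0" using inj by simp
qed simp

lemma fired_from_vertex:
  assumes "v \<in> verts M"
  shows "fired_from M c x w v = (\<Sum>a\<in>fire_index M c. w a * of_bool
     (fire_from (snd a) = 0 \<and> param M (fst a) 0 = v \<or>
      fire_from (snd a) = Suc (length (edge_mult c (fst a))) \<and> param M (fst a) (len M (fst a)) = v))"
  unfolding fired_from_def
proof (rule sum.cong[OF refl])
  fix a assume a: "a \<in> fire_index M c"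
  then have "fst a \<in> edges M" "fire_from (snd a) \<le> Suc (length (edge_mult c (fst a)))"
    using fire_from_le[of "fst a" "snd a" M c] by (auto simp: fire_index_def)
  then show "w a * of_bool (param M (fst a) (brk M c x (fst a) (fire_from (snd a))) = v) = w a * of_bool
     (fire_from (snd a) = 0 \<and> param M (fst a) 0 = v \<or>
      fire_from (snd a) = Suc (length (edge_mult c (fst a))) \<and> param M (fst a) (len M (fst a)) = v)"
    using brk_vertex_iff assms by simp
qed

lemma fired_from_chip:
  assumes "e \<in> edges M" "i < length (edge_mult c e)"
  shows "fired_from M c x w (param M e (x e i)) =
    (\<Sum>a\<in>fire_index M c. w a * of_bool (fst a = e \<and> fire_from (snd a) = Suc i))"
  unfolding fired_from_def
proof (rule sum.cong[OF refl])
  fix a assume a: "a \<in> fire_index M c"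
  then have "fst a \<in> edges M" "fire_from (snd a) \<le> Suc (length (edge_mult c (fst a)))"
    using fire_from_le[of "fst a" "snd a" M c] by (auto simp: fire_index_def)
  then show "w a * of_bool (param M (fst a) (brk M c x (fst a) (fire_from (snd a))) = param M e (x e i)) =
      w a * of_bool (fst a = e \<and> fire_from (snd a) = Suc i)"
    using brk_interior_iff[of "fst a" "fire_from (snd a)" e "Suc i"] assms by simp
qed

lemma fired_from_elsewhere:
  assumes e: "e \<in> edges M" and t: "t \<in> {0<..<len M e}" and ne: "\<And>i. i < length (edge_mult c e) \<Longrightarrow> x e i \<noteq> t"
  shows "fired_from M c x w (param M e t) = 0"
  unfolding fired_from_def
proof (intro sum.neutral ballI)
  fix a assume a: "a \<in> fire_index M c"
  have "param M (fst a) (brk M c x (fst a) (fire_from (snd a))) \<noteq> param M e t"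
  proof
    assume eq: "param M (fst a) (brk M c x (fst a) (fire_from (snd a))) = param M e t"
    have a': "fst a \<in> edges M" "fire_from (snd a) \<le> Suc (length (edge_mult c (fst a)))"
      using a fire_from_le[of "fst a" "snd a" M c] by (auto simp: fire_index_def)
    note inj = param_inj[OF e a'(1) t brk_range[OF chips a'] eq[symmetric]]
    show False
    proof (cases "fire_from (snd a)")
      case 0
      then show False using inj t by simp
    next
      case (Suc i)
      then show False using inj t a'(2) ne[of i] by (cases "i < length (edge_mult c e)") (auto simp: le_less)
    qed
  qed
  then show "w a * of_bool (param M (fst a) (brk M c x (fst a) (fire_from (snd a))) = param M e t) = 0" by simp
qed

context
  fixes \<epsilon>
  assumes fine: "fine_step M c x \<epsilon>"
begin

lemma slot_less_aux:
  assumes e: "e \<in> edges M" and k: "fst k' \<le> Suc (length (edge_mult c e))" "snd k \<in> {- 1, 0, 1}" "snd k' \<in> {- 1, 0, 1}"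
    and less: "fst k < fst k'"
  shows "slot M c x \<epsilon> e k < slot M c x \<epsilon> e k'"
proof -
  have pos: "\<epsilon> > 0" and "2 * \<epsilon> < brk M c x e (Suc (fst k)) - brk M c x e (fst k)"
    using fine e less k by (auto simp: fine_step_def)
  moreover have "brk M c x e (Suc (fst k)) \<le> brk M c x e (fst k')"
    using brk_strict[OF chips e, of "Suc (fst k)" "fst k'"] less k(1)
    by (cases "Suc (fst k) = fst k'") auto
  moreover have "of_int (snd k) * \<epsilon> \<le> \<epsilon>" "of_int (snd k') * \<epsilon> \<ge> - \<epsilon>"
    using k pos by auto
  ultimately show ?thesis unfolding slot_def by linarith
qed

lemma slot_less_iff:
  assumes e: "e \<in> edges M" and k: "fst k \<le> Suc (length (edge_mult c e))" "snd k \<in> {- 1, 0, 1}"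
    "fst k' \<le> Suc (length (edge_mult c e))" "snd k' \<in> {- 1, 0, 1}"
  shows "slot M c x \<epsilon> e k < slot M c x \<epsilon> e k' \<longleftrightarrow> fst k < fst k' \<or> fst k = fst k' \<and> snd k < snd k'"
proof -
  have pos: "\<epsilon> > 0" using fine by (simp add: fine_step_def)
  consider "fst k < fst k'" | "fst k' < fst k" | "fst k = fst k'" by linarith
  then show ?thesis
  proof cases
    case 1 then show ?thesis using slot_less_aux[OF e k(3,2,4)] by simp
  next
    case 2 then show ?thesis using slot_less_aux[OF e k(1,4,2)] by simp
  next
    case 3 then show ?thesis using pos by (simp add: slot_def)
  qed
qed

lemma slot_eq_iff:
  assumes "e \<in> edges M" "fst k \<le> Suc (length (edge_mult c e))" "snd k \<in> {- 1, 0, 1}"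
    "fst k' \<le> Suc (length (edge_mult c e))" "snd k' \<in> {- 1, 0, 1}"
  shows "slot M c x \<epsilon> e k = slot M c x \<epsilon> e k' \<longleftrightarrow> k = k'"
  using slot_less_iff[OF assms] slot_less_iff[OF assms(1,4,5,2,3)]
  by (metis less_irrefl linorder_neqE prod_eqI)

lemma slot_centre: "slot M c x \<epsilon> e (j, 0) = brk M c x e j"
  by (simp add: slot_def)

lemma slot_interior:
  assumes "e \<in> edges M" "k \<in> slots c e"
  shows "slot M c x \<epsilon> e k \<in> {0<..<len M e}"
  using slot_less_iff[OF assms(1), of "(0, 0)" k] slot_less_iff[OF assms(1), of k "(Suc (length (edge_mult c e)), 0)"]
    assms(2) by (auto simp: slots_def slot_centre)

lemma slot_param_eq_iff:
  assumes e: "e \<in> edges M" "fst k \<le> Suc (length (edge_mult c e))" "snd k \<in> {- 1, 0, 1}" "slot M c x \<epsilon> e k \<in> {0..len M e}"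
    and e0: "e0 \<in> edges M" "k0 \<in> slots c e0"
  shows "param M e (slot M c x \<epsilon> e k) = param M e0 (slot M c x \<epsilon> e0 k0) \<longleftrightarrow> e = e0 \<and> k = k0"
proof
  assume eq: "param M e (slot M c x \<epsilon> e k) = param M e0 (slot M c x \<epsilon> e0 k0)"
  note inj = param_inj[OF e0(1) e(1) slot_interior[OF e0] e(4) eq[symmetric]]
  show "e = e0 \<and> k = k0"
    using slot_eq_iff[OF e(1-3), of k0] e0(2) inj by (auto simp: slots_def)
qed simp

lemma fired_to_slot:
  assumes "e0 \<in> edges M" "k0 \<in> slots c e0"
  shows "fired_to M c x \<epsilon> w (param M e0 (slot M c x \<epsilon> e0 k0)) =
    (\<Sum>a\<in>fire_index M c. w a * of_bool (fst a = e0 \<and> fire_to (snd a) = k0))"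
  unfolding fired_to_def
proof (rule sum.cong[OF refl])
  fix a assume "a \<in> fire_index M c"
  then have a: "fst a \<in> edges M" "fire_to (snd a) \<in> slots c (fst a)"
    using fire_to_slots[of "fst a" "snd a" M c] by (auto simp: fire_index_def)
  then have "slot M c x \<epsilon> (fst a) (fire_to (snd a)) \<in> {0..len M (fst a)}"
    using slot_interior[OF a] by simp
  then have "param M (fst a) (slot M c x \<epsilon> (fst a) (fire_to (snd a))) = param M e0 (slot M c x \<epsilon> e0 k0) \<longleftrightarrow>
      fst a = e0 \<and> fire_to (snd a) = k0"
    using a by (intro slot_param_eq_iff assms) (auto simp: slots_def)
  then show "w a * of_bool (param M (fst a) (slot M c x \<epsilon> (fst a) (fire_to (snd a))) = param M e0 (slot M c x \<epsilon> e0 k0)) =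
      w a * of_bool (fst a = e0 \<and> fire_to (snd a) = k0)" by simp
qed

lemma fired_to_zero:
  assumes "\<And>e k. e \<in> edges M \<Longrightarrow> k \<in> slots c e \<Longrightarrow> param M e (slot M c x \<epsilon> e k) \<noteq> y"
  shows "fired_to M c x \<epsilon> w y = 0"
  unfolding fired_to_def
proof (intro sum.neutral ballI)
  fix a assume "a \<in> fire_index M c"
  then have a: "fst a \<in> edges M" "fire_to (snd a) \<in> slots c (fst a)"
    using fire_to_slots[of "fst a" "snd a" M c] by (auto simp: fire_index_def)
  then show "w a * of_bool (param M (fst a) (slot M c x \<epsilon> (fst a) (fire_to (snd a))) = y) = 0"
    using assms by simp
qed

lemma fired_from_slot:
  assumes e0: "e0 \<in> edges M" "k0 \<in> slots c e0"
  shows "fired_from M c x w (param M e0 (slot M c x \<epsilon> e0 k0)) =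
    (\<Sum>a\<in>fire_index M c. w a * of_bool (fst a = e0 \<and> (fire_from (snd a), 0) = k0))"
  unfolding fired_from_def
proof (rule sum.cong[OF refl])
  fix a assume "a \<in> fire_index M c"
  then have a: "fst a \<in> edges M" "fire_from (snd a) \<le> Suc (length (edge_mult c (fst a)))"
    using fire_from_le[of "fst a" "snd a" M c] by (auto simp: fire_index_def)
  then have "param M (fst a) (slot M c x \<epsilon> (fst a) (fire_from (snd a), 0)) = param M e0 (slot M c x \<epsilon> e0 k0) \<longleftrightarrow>
      fst a = e0 \<and> (fire_from (snd a), 0) = k0"
    using brk_range[OF chips a] by (intro slot_param_eq_iff e0) (auto simp: slot_centre)
  then show "w a * of_bool (param M (fst a) (brk M c x (fst a) (fire_from (snd a))) = param M e0 (slot M c x \<epsilon> e0 k0)) =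
      w a * of_bool (fst a = e0 \<and> (fire_from (snd a), 0) = k0)" by (simp add: slot_centre)
qed

lemma chips_slot:
  assumes e: "e \<in> edges M" and k: "k \<in> slots c e"
  shows "D (param M e (slot M c x \<epsilon> e k)) = (if snd k = 0 then int (edge_mult c e ! (fst k - 1)) else 0)"
proof (cases "snd k = 0")
  case True
  then obtain i where i: "k = (Suc i, 0)" "i < length (edge_mult c e)"
    using k by (cases k; cases "fst k") (auto simp: slots_def)
  then show ?thesis using chip_at[OF chips e i(2)] by (simp add: slot_centre)
next
  case False
  have "x e i \<noteq> slot M c x \<epsilon> e k" if "i < length (edge_mult c e)" for i
    using slot_eq_iff[OF e, of "(Suc i, 0)" k] k that False by (auto simp: slots_def slot_centre)
  then show ?thesis
    unfolding chip_value[OF chips e slot_interior[OF e k]] using False by (auto intro: sum.neutral)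
qed

lemma fired_value_slot:
  assumes "e \<in> edges M" "k \<in> slots c e"
  shows "D (param M e (slot M c x \<epsilon> e k)) + fired_to M c x \<epsilon> w (param M e (slot M c x \<epsilon> e k)) -
    fired_from M c x w (param M e (slot M c x \<epsilon> e k)) = slot_value M c w e k"
  unfolding slot_value_def chips_slot[OF assms] fired_to_slot[OF assms] fired_from_slot[OF assms] by simp

lemma fired_value_off:
  assumes e: "e \<in> edges M" and t: "t \<in> {0<..<len M e}" "t \<notin> slot M c x \<epsilon> e ` slots c e"
  shows "D (param M e t) = 0" "fired_to M c x \<epsilon> w (param M e t) = 0" "fired_from M c x w (param M e t) = 0"
proof -
  have ne: "x e i \<noteq> t" if "i < length (edge_mult c e)" for i
  proof
    assume "x e i = t"
    then have "t = slot M c x \<epsilon> e (Suc i, 0)" using that by (simp add: slot_centre)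
    moreover have "(Suc i, 0) \<in> slots c e" using that by (simp add: slots_def)
    ultimately show False using t by blast
  qed
  show "D (param M e t) = 0"
    unfolding chip_value[OF chips e t(1)] using ne by (intro sum.neutral) auto
  show "fired_from M c x w (param M e t) = 0" by (rule fired_from_elsewhere[OF e t(1) ne])
  show "fired_to M c x \<epsilon> w (param M e t) = 0"
  proof (rule fired_to_zero)
    fix e' k assume e': "e' \<in> edges M" "k \<in> slots c e'"
    show "param M e' (slot M c x \<epsilon> e' k) \<noteq> param M e t"
      using param_inj[OF e' (1) e slot_interior[OF e'], of t] e' t by auto
  qed
qed

lemma fired_to_vertex:
  assumes "v \<in> verts M" shows "fired_to M c x \<epsilon> w v = 0"
  using slot_interior param_interior assms by (intro fired_to_zero) metis

lemma fire:
  assumes D: "D \<in> open_cell M D0 c"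
    and u: "\<And>e. e \<in> edges M \<Longrightarrow> (\<Sum>j\<le>length (edge_mult c e). w (e, j, True) - w (e, j, False)) =
      u (param M e 0) - u (param M e (len M e))"
    and w: "\<And>a. a \<in> fire_index M c \<Longrightarrow> w a \<ge> 0" and le: "\<And>y. y \<in> points M \<Longrightarrow> fired_from M c x w y \<le> D y"
  obtains D' f' where "D' \<in> linear_system M D0" "rational_function M f'" "D' = D0 + principal M f'"
    "\<And>e. e \<in> edges M \<Longrightarrow> slope_right (f' \<circ> param M e) 0 = init_slope c e + fired_slope M c w e"
    "\<And>y. D' y = D y + fired_to M c x \<epsilon> w y - fired_from M c x w y"
proof -
  from D obtain f where f: "D \<in> linear_system M D0" "rational_function M f" "D = D0 + principal M f"
    "\<And>e. e \<in> edges M \<Longrightarrow> slope_right (f \<circ> param M e) 0 = init_slope c e"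
    unfolding open_cell_def by blast
  let ?A = "fire_index M c"
  let ?p = "\<lambda>a. brk M c x (fst a) (fire_from (snd a))" and ?q = "\<lambda>a. slot M c x \<epsilon> (fst a) (fire_to (snd a))"
  have p: "?p a \<in> {0..len M (fst a)}" and q: "?q a \<in> {0<..<len M (fst a)}" if "a \<in> ?A" for a
    using that brk_range[OF chips, of "fst a"] slot_interior[of "fst a"]
      fire_from_le[of "fst a" "snd a" M c] fire_to_slots[of "fst a" "snd a" M c]
    by (auto simp: fire_index_def simp del: greaterThanLessThan_iff atLeastAtMost_iff)
  obtain g where g: "rational_function M g"
    "\<And>y. principal M g y = (\<Sum>a\<in>?A. w a *
       (of_bool (param M (fst a) (?q a) = y) - of_bool (param M (fst a) (?p a) = y)))"
    "\<And>e. e \<in> edges M \<Longrightarrow> slope_right (g \<circ> param M e) 0 =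
       (\<Sum>a | a \<in> ?A \<and> fst a = e. w a * (of_bool (?q a = 0) - of_bool (?p a = 0)))"
  proof (rule principal_moves[of ?A fst ?p ?q "\<lambda>y. \<epsilon> * of_int (u y)" w])
    fix e assume e: "e \<in> edges M"
    have "(\<Sum>a | a \<in> ?A \<and> fst a = e. of_int (w a) * (?q a - ?p a)) =
        (\<Sum>j\<le>length (edge_mult c e). \<epsilon> * of_int (w (e, j, True) - w (e, j, False)))"
      unfolding fire_edge_sum[OF e] by (intro sum.cong refl) (simp add: slot_def algebra_simps)
    also have "\<dots> = \<epsilon> * of_int (u (param M e 0) - u (param M e (len M e)))"
      by (simp only: sum_distrib_left[symmetric] of_int_sum[symmetric] u[OF e])
    finally show "\<epsilon> * of_int (u (param M e 0)) - \<epsilon> * of_int (u (param M e (len M e))) =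
        (\<Sum>a | a \<in> ?A \<and> fst a = e. of_int (w a) * (?q a - ?p a))"
      by (simp add: right_diff_distrib)
  next
    fix a assume "a \<in> ?A"
    then show "?p a \<in> {0..len M (fst a)}" "?q a \<in> {0..len M (fst a)}" using p[of a] q[of a] by auto
  qed (use finite_fire_index in \<open>auto simp: fire_index_def\<close>)
  have g2: "principal M g y = fired_to M c x \<epsilon> w y - fired_from M c x w y" for y
    unfolding g(2) fired_to_def fired_from_def by (simp add: right_diff_distrib sum_subtractf)
  have fin: "finite {y. principal M g y \<noteq> 0}"
  proof (rule finite_subset)
    show "{y. principal M g y \<noteq> 0} \<subseteq> (\<lambda>a. param M (fst a) (?q a)) ` ?A \<union> (\<lambda>a. param M (fst a) (?p a)) ` ?A"
      (is "_ \<subseteq> ?U")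
    proof (rule subsetI, rule ccontr)
      fix y assume y: "y \<in> {y. principal M g y \<noteq> 0}" "y \<notin> ?U"
      have "principal M g y = 0"
        unfolding g(2)
      proof (intro sum.neutral ballI)
        fix a assume "a \<in> ?A"
        then have "param M (fst a) (?q a) \<noteq> y" "param M (fst a) (?p a) \<noteq> y" using y(2) by blast+
        then show "w a * (of_bool (param M (fst a) (?q a) = y) - of_bool (param M (fst a) (?p a) = y)) = 0"
          by simp
      qed
      then show False using y(1) by simp
    qed
  qed (use finite_fire_index in simp)
  have to: "fired_to M c x \<epsilon> w y \<ge> 0" for y
    unfolding fired_to_def using w by (intro sum_nonneg) simp
  have nonneg: "D y + principal M g y \<ge> 0" if "y \<in> points M" for y
    using le[OF that] to[of y] by (simp add: g2)
  note step = linear_system_step[OF f(1-3) g(1) fin nonneg]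
  have "slope_right ((\<lambda>x. f x + g x) \<circ> param M e) 0 = init_slope c e + fired_slope M c w e"
    if e: "e \<in> edges M" for e
  proof -
    have "?p a = 0 \<longleftrightarrow> fire_from (snd a) = 0" "?q a \<noteq> 0" if "a \<in> ?A" for a
    proof -
      have a: "fst a \<in> edges M" "fire_from (snd a) \<le> Suc (length (edge_mult c (fst a)))"
        using that fire_from_le[of "fst a" "snd a" M c] by (auto simp: fire_index_def)
      show "?p a = 0 \<longleftrightarrow> fire_from (snd a) = 0"
        using brk_strict[OF chips a(1) _ a(2), of 0] by (cases "fire_from (snd a) = 0") auto
      show "?q a \<noteq> 0" using q[OF that] by auto
    qed
    then have "slope_right (g \<circ> param M e) 0 = fired_slope M c w e"
      unfolding g(3)[OF e] fired_slope_def sum_negf[symmetric] by (intro sum.cong refl) auto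
    then show ?thesis using slopes_add(1)[OF f(2) g(1) e, of 0] len_pos[OF e] f(4)[OF e] by simp
  qed
  moreover have "(D + principal M g) y = D y + fired_to M c x \<epsilon> w y - fired_from M c x w y" for y
    by (simp add: g2)
  ultimately show ?thesis using that[OF step] by blast
qed

end

end


lemma param_near:
  assumes e: "e \<in> edges M" and t: "t \<in> {0..len M e}" and \<eta>: "\<eta> > 0"
  obtains \<delta> where "\<delta> > 0"
    "\<And>s. s \<in> {0..len M e} \<Longrightarrow> \<bar>s - t\<bar> < \<delta> \<Longrightarrow> edist M (param M e t) (param M e s) < ennreal \<eta>"
proof -
  define U where "U = {y \<in> points M. edist M (param M e t) y < ennreal \<eta>}"
  have "openin (etopology M) U"
    unfolding U_def by (rule openin_eball[OF metric param_points[OF e t]])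
  then have "openin (top_of_set {0..len M e}) {s \<in> {0..len M e}. param M e s \<in> U}"
    using param_continuous[OF e] by (simp add: continuous_map_def)
  moreover have "t \<in> {s \<in> {0..len M e}. param M e s \<in> U}"
    using t \<eta> param_points[OF e t] by (simp add: U_def edist_refl[OF metric])
  ultimately obtain \<delta> where "\<delta> > 0" "ball t \<delta> \<inter> {0..len M e} \<subseteq> {s \<in> {0..len M e}. param M e s \<in> U}"
    unfolding openin_contains_ball by blast
  then show ?thesis
    by (intro that[of \<delta>]) (auto simp: U_def dist_real_def abs_minus_commute subset_iff)
qed

lemma eventually_fire_close:
  assumes chips: "chip_positions M c D x" and \<eta>: "\<eta> > 0"
  shows "\<forall>\<^sub>F \<epsilon> in at_right 0. fine_step M c x \<epsilon> \<and> (\<forall>a\<in>fire_index M c.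
    edist M (param M (fst a) (brk M c x (fst a) (fire_from (snd a))))
      (param M (fst a) (slot M c x \<epsilon> (fst a) (fire_to (snd a)))) < ennreal \<eta>)"
proof -
  have "\<forall>\<^sub>F \<epsilon> in at_right 0. \<forall>a\<in>fire_index M c. fine_step M c x \<epsilon> \<longrightarrow>
    edist M (param M (fst a) (brk M c x (fst a) (fire_from (snd a))))
      (param M (fst a) (slot M c x \<epsilon> (fst a) (fire_to (snd a)))) < ennreal \<eta>"
  proof (intro eventually_ball_finite finite_fire_index ballI)
    fix a assume "a \<in> fire_index M c"
    then have a: "fst a \<in> edges M" "fire_from (snd a) \<le> Suc (length (edge_mult c (fst a)))"
      "fire_to (snd a) \<in> slots c (fst a)"
      using fire_from_le[of "fst a" "snd a" M c] fire_to_slots[of "fst a" "snd a" M c]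
      by (auto simp: fire_index_def)
    obtain \<delta> where \<delta>: "\<delta> > 0" "\<And>s. s \<in> {0..len M (fst a)} \<Longrightarrow>
        \<bar>s - brk M c x (fst a) (fire_from (snd a))\<bar> < \<delta> \<Longrightarrow>
        edist M (param M (fst a) (brk M c x (fst a) (fire_from (snd a)))) (param M (fst a) s) < ennreal \<eta>"
      using param_near[OF a(1) brk_range[OF chips a(1,2)] \<eta>] by metis
    have "\<forall>\<^sub>F \<epsilon> in at_right 0. \<epsilon> \<in> {0<..<\<delta>}"
      by (rule eventually_at_right_interval[OF \<delta>(1)])
    then show "\<forall>\<^sub>F \<epsilon> in at_right 0. fine_step M c x \<epsilon> \<longrightarrow>
      edist M (param M (fst a) (brk M c x (fst a) (fire_from (snd a))))
        (param M (fst a) (slot M c x \<epsilon> (fst a) (fire_to (snd a)))) < ennreal \<eta>"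
    proof (eventually_elim, intro impI)
      fix \<epsilon> assume \<epsilon>: "\<epsilon> \<in> {0<..<\<delta>}" "fine_step M c x \<epsilon>"
      have "\<bar>slot M c x \<epsilon> (fst a) (fire_to (snd a)) - brk M c x (fst a) (fire_from (snd a))\<bar> = \<epsilon>"
        using \<epsilon> by (cases "snd a") (auto simp: slot_def)
      then show "edist M (param M (fst a) (brk M c x (fst a) (fire_from (snd a))))
        (param M (fst a) (slot M c x \<epsilon> (fst a) (fire_to (snd a)))) < ennreal \<eta>"
        using slot_interior[OF chips \<epsilon>(2) a(1,3)] \<epsilon>(1) by (intro \<delta>(2)) auto
    qed
  qed
  with eventually_fine_step[OF chips] show ?thesis by eventually_elim blast
qed

lemma close_divisors_fire:
  assumes chips: "chip_positions M c D x" and fine: "fine_step M c x \<epsilon>" and \<eta>: "\<eta> > 0"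
    and eff: "effective M D" and w: "\<And>a. a \<in> fire_index M c \<Longrightarrow> w a \<in> {0, 1}"
    and le: "\<And>y. y \<in> points M \<Longrightarrow> fired_from M c x w y \<le> D y"
    and near: "\<forall>a\<in>fire_index M c. edist M (param M (fst a) (brk M c x (fst a) (fire_from (snd a))))
      (param M (fst a) (slot M c x \<epsilon> (fst a) (fire_to (snd a)))) < ennreal \<eta>"
    and D': "\<And>y. D' y = D y + fired_to M c x \<epsilon> w y - fired_from M c x w y"
  shows "close_divisors M \<eta> D D'"
proof -
  let ?A = "fire_index M c" and ?A1 = "{a \<in> fire_index M c. w a = 1}"
  let ?p = "\<lambda>a. param M (fst a) (brk M c x (fst a) (fire_from (snd a)))"
    and ?q = "\<lambda>a. param M (fst a) (slot M c x \<epsilon> (fst a) (fire_to (snd a)))"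
  define R where "R y = D y - fired_from M c x w y" for y
  have p: "?p a \<in> points M" and q: "?q a \<in> points M" if "a \<in> ?A" for a
  proof -
    have a: "fst a \<in> edges M" "fire_from (snd a) \<le> Suc (length (edge_mult c (fst a)))"
      "fire_to (snd a) \<in> slots c (fst a)"
      using that fire_from_le[of "fst a" "snd a" M c] fire_to_slots[of "fst a" "snd a" M c]
      by (auto simp: fire_index_def)
    show "?p a \<in> points M" using param_points[OF a(1) brk_range[OF chips a(1,2)]] .
    show "?q a \<in> points M" using param_points[OF a(1)] slot_interior[OF chips fine a(1,3)] by auto
  qed
  have sum1: "(\<Sum>a\<in>?A. w a * of_bool (P a)) = (\<Sum>a\<in>?A1. of_bool (P a))" for P
    using w finite_fire_index by (intro sum.mono_neutral_cong_right) auto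
  have from0: "fired_from M c x w y = 0" if "y \<notin> ?p ` ?A" for y
    unfolding fired_from_def
  proof (intro sum.neutral ballI)
    fix a assume "a \<in> ?A"
    then have "?p a \<noteq> y" using that by blast
    then show "w a * of_bool (?p a = y) = 0" by simp
  qed
  have D: "finite {y. D y \<noteq> 0}" "{y. D y \<noteq> 0} \<subseteq> points M" "\<And>y. D y \<ge> 0"
    using eff by (auto simp: effective_def divisor_def)
  have "{y. R y \<noteq> 0} \<subseteq> {y. D y \<noteq> 0} \<union> ?p ` ?A" using from0 by (auto simp: R_def)
  moreover have "?p ` ?A \<subseteq> points M" using p by auto
  ultimately have "finite {y. R y \<noteq> 0}" "{y. R y \<noteq> 0} \<subseteq> points M"
    using D finite_fire_index by (auto intro: finite_subset)
  moreover have "R y \<ge> 0" for y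
  proof (cases "y \<in> points M")
    case False
    then have "fired_from M c x w y = 0" using from0[of y] p by blast
    then show ?thesis using D(3) by (simp add: R_def)
  qed (use le in \<open>simp add: R_def\<close>)
  ultimately have "effective M R" by (simp add: effective_def divisor_def)
  then have "close_divisors M \<eta> R R" by (rule close_divisors_refl[OF metric _ \<eta>])
  then have "close_divisors M \<eta> (\<lambda>z. R z + (\<Sum>a\<in>?A1. of_bool (?p a = z))) (\<lambda>z. R z + (\<Sum>a\<in>?A1. of_bool (?q a = z)))"
    using p q near finite_fire_index by (intro close_divisors_moves) auto
  moreover have "(\<lambda>z. R z + (\<Sum>a\<in>?A1. of_bool (?p a = z))) = D"
    unfolding sum1[symmetric] R_def fired_from_def by simp
  moreover have "(\<lambda>z. R z + (\<Sum>a\<in>?A1. of_bool (?q a = z))) = D'"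
    unfolding sum1[symmetric] R_def by (simp add: D' fired_to_def fun_eq_iff)
  ultimately show ?thesis by simp
qed

lemma fired_from_le_transfer:
  assumes x: "chip_positions M c D x" and x1: "chip_positions M c D1 x1" and eff: "effective M D1"
    and le: "\<And>y. y \<in> points M \<Longrightarrow> fired_from M c x w y \<le> D y" and y: "y \<in> points M"
  shows "fired_from M c x1 w y \<le> D1 y"
  using y
proof (cases rule: points_cases)
  case 1
  then have "D1 y = D y" using x x1 by (simp add: chip_positions_def)
  then show ?thesis
    using le[OF y] fired_from_vertex[OF x 1] fired_from_vertex[OF x1 1] by simp
next
  case (2 e t)
  show ?thesis
  proof (cases "\<exists>i<length (edge_mult c e). x1 e i = t")
    case True
    then obtain i where i: "i < length (edge_mult c e)" "x1 e i = t" by blast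
    have "param M e (x e i) \<in> points M"
      using param_points[OF 2(1)] chip_interior[OF x 2(1) i(1)] by auto
    from le[OF this] show ?thesis
      using i 2 fired_from_chip[OF x 2(1) i(1)] fired_from_chip[OF x1 2(1) i(1)]
        chip_at[OF x 2(1) i(1)] chip_at[OF x1 2(1) i(1)] by simp
  next
    case False
    then have "fired_from M c x1 w y = 0"
      unfolding 2(3) by (intro fired_from_elsewhere[OF x1 2(1,2)]) auto
    then show ?thesis using eff by (simp add: effective_def)
  qed
qed

lemma linear_system_effective: "D \<in> linear_system M D0 \<Longrightarrow> effective M D"
  by (simp add: linear_system_def)

lemma maximal_cell_fire:
  assumes maxi: "maximal_cell M D0 c" and D: "D \<in> open_cell M D0 c" and x: "chip_positions M c D x"
    and u: "\<And>e. e \<in> edges M \<Longrightarrow> (\<Sum>j\<le>length (edge_mult c e). w (e, j, True) - w (e, j, False)) =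
      u (param M e 0) - u (param M e (len M e))"
    and w: "\<And>a. a \<in> fire_index M c \<Longrightarrow> w a \<in> {0, 1 :: int}"
    and le: "\<And>y. y \<in> points M \<Longrightarrow> fired_from M c x w y \<le> D y"
    and e: "e \<in> edges M"
  shows "w (e, 0, True) = 0" "w (e, length (edge_mult c e), False) = 0"
    "\<And>i. i < length (edge_mult c e) \<Longrightarrow> w (e, Suc i, True) = 0 \<or> w (e, i, False) = 0"
proof -
  have w0: "w a \<ge> 0" if "a \<in> fire_index M c" for a using w[OF that] by auto
  obtain \<epsilon>0 where \<epsilon>0: "fine_step M c x \<epsilon>0"
    using eventually_happens'[OF trivial_limit_at_right_real eventually_fine_step[OF x]] by blast
  obtain D' f' where D': "D' \<in> linear_system M D0" "rational_function M f'" "D' = D0 + principal M f'"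
    "\<And>e. e \<in> edges M \<Longrightarrow> slope_right (f' \<circ> param M e) 0 = init_slope c e + fired_slope M c w e"
    "\<And>y. D' y = D y + fired_to M c x \<epsilon>0 w y - fired_from M c x w y"
    using fire[OF x \<epsilon>0 D u w0 le] by blast
  obtain c' x' where c': "chip_positions M c' D' x'" "\<And>e. init_slope c' e = init_slope c e + fired_slope M c w e"
    using cell_data_exists[OF D'(1), of "\<lambda>e. init_slope c e + fired_slope M c w e"] by blast
  have key: "\<exists>D1'\<in>open_cell M D0 c'. close_divisors M \<eta> D1 D1'"
    if D1: "D1 \<in> open_cell M D0 c" and \<eta>: "\<eta> > 0" for D1 \<eta>
  proof -
    obtain x1 where x1: "chip_positions M c D1 x1" using D1 by (auto simp: open_cell_def)
    have eff: "effective M D1" using D1 by (auto simp: open_cell_def intro: linear_system_effective)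
    note le1 = fired_from_le_transfer[OF x x1 eff le]
    obtain \<epsilon> where \<epsilon>: "fine_step M c x1 \<epsilon>" "\<forall>a\<in>fire_index M c.
      edist M (param M (fst a) (brk M c x1 (fst a) (fire_from (snd a))))
        (param M (fst a) (slot M c x1 \<epsilon> (fst a) (fire_to (snd a)))) < ennreal \<eta>"
      using eventually_happens'[OF trivial_limit_at_right_real eventually_fire_close[OF x1 \<eta>]] by blast
    obtain D1' f1' where D1': "D1' \<in> linear_system M D0" "rational_function M f1'" "D1' = D0 + principal M f1'"
      "\<And>e. e \<in> edges M \<Longrightarrow> slope_right (f1' \<circ> param M e) 0 = init_slope c e + fired_slope M c w e"
      "\<And>y. D1' y = D1 y + fired_to M c x1 \<epsilon> w y - fired_from M c x1 w y"
      using fire[OF x1 \<epsilon>(1) D1 u w0 le1] by blast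
    have "D1' \<in> open_cell M D0 c'"
    proof (rule open_cell_transfer[OF c'(1) D1'(1-3), where J = "slots c"
          and p = "slot M c x \<epsilon>0" and q = "slot M c x1 \<epsilon>"])
      fix v assume v: "v \<in> verts M"
      then have "D1 v = D v" using x x1 by (simp add: chip_positions_def)
      then show "D1' v = D' v"
        unfolding D1'(5) D'(5) fired_to_vertex[OF x \<epsilon>0 v] fired_to_vertex[OF x1 \<epsilon>(1) v]
          fired_from_vertex[OF x v] fired_from_vertex[OF x1 v] by simp
    next
      fix e a b assume "e \<in> edges M" "a \<in> slots c e" "b \<in> slots c e"
      then show "slot M c x \<epsilon>0 e a < slot M c x \<epsilon>0 e b \<longleftrightarrow> slot M c x1 \<epsilon> e a < slot M c x1 \<epsilon> e b"
        using slot_less_iff[OF x \<epsilon>0, of e a b] slot_less_iff[OF x1 \<epsilon>(1), of e a b] by (auto simp: slots_def)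
    next
      fix e a assume "e \<in> edges M" "a \<in> slots c e"
      then show "D1' (param M e (slot M c x1 \<epsilon> e a)) = D' (param M e (slot M c x \<epsilon>0 e a))"
        unfolding D1'(5) D'(5) using fired_value_slot[OF x \<epsilon>0] fired_value_slot[OF x1 \<epsilon>(1)] by simp
    next
      fix e t assume "e \<in> edges M" "t \<in> {0<..<len M e}" "t \<notin> slot M c x \<epsilon>0 e ` slots c e"
      then show "D' (param M e t) = 0" unfolding D'(5) using fired_value_off[OF x \<epsilon>0] by simp
    next
      fix e t assume "e \<in> edges M" "t \<in> {0<..<len M e}" "t \<notin> slot M c x1 \<epsilon> e ` slots c e"
      then show "D1' (param M e t) = 0" unfolding D1'(5) using fired_value_off[OF x1 \<epsilon>(1)] by simp
    qed (use slot_interior[OF x \<epsilon>0] slot_interior[OF x1 \<epsilon>(1)] D1'(4) c'(2) in auto)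
    moreover have "close_divisors M \<eta> D1 D1'"
      by (rule close_divisors_fire[OF x1 \<epsilon>(1) \<eta> eff w le1 \<epsilon>(2) D1'(5)])
    ultimately show ?thesis by blast
  qed
  have D'c: "D' \<in> open_cell M D0 c'"
    unfolding open_cell_def using D' c' by auto
  have "cell M D0 c \<subseteq> cell M D0 c'"
  proof
    fix D2 assume D2: "D2 \<in> cell M D0 c"
    have "\<exists>D1'\<in>open_cell M D0 c'. close_divisors M \<eta> D2 D1'" if "\<eta> > 0" for \<eta>
    proof -
      have h: "\<eta> / 2 > 0" using that by simp
      obtain D1 where D1: "D1 \<in> open_cell M D0 c" "close_divisors M (\<eta> / 2) D2 D1"
        using D2 h unfolding cell_def by blast
      obtain D1' where "D1' \<in> open_cell M D0 c'" "close_divisors M (\<eta> / 2) D1 D1'"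
        using key[OF D1(1) h] by blast
      then show ?thesis using close_divisors_trans[OF metric D1(2) _ h h] by auto
    qed
    then show "D2 \<in> cell M D0 c'" using D2 by (simp add: cell_def)
  qed
  moreover have "open_cell M D0 c' \<noteq> {}" using D'c by blast
  ultimately have "cell M D0 c' = cell M D0 c" using maxi unfolding maximal_cell_def by blast
  moreover have "D' \<in> cell M D0 c'"
    unfolding cell_def using D'c close_divisors_refl[OF metric linear_system_effective[OF D'(1)]] D'(1) by blast
  ultimately have D'cell: "D' \<in> cell M D0 c" by simp
  define Jc where "Jc = (SIGMA e:edges M. {..<length (edge_mult c e)})"
  have Jc: "finite Jc" using finite_edges by (simp add: Jc_def)
  have bound: "card {y \<in> points M - verts M. D2 y \<noteq> 0} \<le> card Jc" if D2: "D2 \<in> open_cell M D0 c" for D2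
  proof -
    obtain x2 where x2: "chip_positions M c D2 x2" using D2 by (auto simp: open_cell_def)
    have "{y \<in> points M - verts M. D2 y \<noteq> 0} \<subseteq> (\<lambda>(e, i). param M e (x2 e i)) ` Jc"
    proof
      fix y assume y: "y \<in> {y \<in> points M - verts M. D2 y \<noteq> 0}"
      then obtain e t where et: "e \<in> edges M" "t \<in> {0<..<len M e}" "y = param M e t"
        using points_cases[of y] by blast
      have "\<exists>i<length (edge_mult c e). x2 e i = t"
      proof (rule ccontr)
        assume "\<nexists>i. i < length (edge_mult c e) \<and> x2 e i = t"
        then have "D2 y = 0" unfolding et(3) chip_value[OF x2 et(1,2)] by (intro sum.neutral) auto
        then show False using y by simp
      qed
      then show "y \<in> (\<lambda>(e, i). param M e (x2 e i)) ` Jc" using et by (force simp: Jc_def)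
    qed
    then show ?thesis using surj_card_le[OF Jc] by blast
  qed
  define K where "K = {(e, k). e \<in> edges M \<and> k \<in> slots c e \<and> slot_value M c w e k \<noteq> 0}"
  have small: "card (insert z T) \<le> card Jc" if T: "finite T" "insert z T \<subseteq> K" for z T
  proof -
    let ?F = "(\<lambda>(e, k). param M e (slot M c x \<epsilon>0 e k)) ` insert z T"
    have inj: "inj_on (\<lambda>(e, k). param M e (slot M c x \<epsilon>0 e k)) K"
    proof (rule inj_onI, clarify)
      fix e k e' k' assume "(e, k) \<in> K" "(e', k') \<in> K"
        "param M e (slot M c x \<epsilon>0 e k) = param M e' (slot M c x \<epsilon>0 e' k')"
      then show "e = e' \<and> k = k'"
        using slot_param_eq_iff[OF x \<epsilon>0, of e k e' k'] slot_interior[OF x \<epsilon>0, of e k]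
        by (auto simp: K_def slots_def)
    qed
    have F: "finite ?F" "?F \<subseteq> points M - verts M" "\<And>y. y \<in> ?F \<Longrightarrow> D' y \<noteq> 0"
    proof -
      show "finite ?F" using T by simp
      have *: "y \<in> points M - verts M \<and> D' y \<noteq> 0" if "y \<in> ?F" for y
      proof -
        from that obtain z' where "z' \<in> K" "y = (case z' of (e, k) \<Rightarrow> param M e (slot M c x \<epsilon>0 e k))"
          using T(2) by blast
        then obtain e k where y: "(e, k) \<in> K" "y = param M e (slot M c x \<epsilon>0 e k)" by (cases z') simp
        then have ek: "e \<in> edges M" "k \<in> slots c e" "slot_value M c w e k \<noteq> 0" by (auto simp: K_def)
        show ?thesis
          using slot_interior[OF x \<epsilon>0 ek(1,2)] param_interior[OF ek(1)] param_points[OF ek(1)] ek(3)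
            fired_value_slot[OF x \<epsilon>0 ek(1,2), of w] y(2) D'(5)[of y] by auto
      qed
      show "?F \<subseteq> points M - verts M" "\<And>y. y \<in> ?F \<Longrightarrow> D' y \<noteq> 0" using * by blast+
    qed
    obtain \<eta> where \<eta>: "\<eta> > 0" "\<And>D2. close_divisors M \<eta> D' D2 \<Longrightarrow>
        card ?F \<le> card {y \<in> points M - verts M. D2 y \<noteq> 0}"
      using close_divisors_support_card[OF metric finite_verts verts_subset F(1,2), of D', OF F(3)] by blast
    obtain D2 where "D2 \<in> open_cell M D0 c" "close_divisors M \<eta> D' D2"
      using D'cell \<eta>(1) unfolding cell_def by blast
    then have "card ?F \<le> card Jc" using \<eta>(2) bound order_trans by blast
    moreover have "card ?F = card (insert z T)"
      by (rule card_image[OF inj_on_subset[OF inj T(2)]])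
    ultimately show ?thesis by simp
  qed
  define \<kappa> where "\<kappa> e i = (if w (e, Suc i, True) \<noteq> 0 then (Suc i, 1) else
    if w (e, i, False) \<noteq> 0 then (Suc i, - 1) else (Suc i, 0 :: int))" for e i
  define T where "T = (\<lambda>(e, i). (e, \<kappa> e i)) ` Jc"
  have T: "finite T" "T \<subseteq> K" "card T = card Jc"
  proof -
    show "finite T" using Jc by (simp add: T_def)
    show "T \<subseteq> K"
    proof
      fix z assume "z \<in> T"
      then obtain e i where ei: "e \<in> edges M" "i < length (edge_mult c e)" "z = (e, \<kappa> e i)"
        by (auto simp: T_def Jc_def)
      have "slot_value M c w e (\<kappa> e i) \<noteq> 0"
        using slot_value_right[OF ei(1), of "Suc i" c w] slot_value_left[OF ei(1), of i c w]
          slot_value_centre[OF ei(1,2), of w] mult_pos[OF x ei(1,2)] ei(2) by (auto simp: \<kappa>_def)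
      moreover have "\<kappa> e i \<in> slots c e" using ei(2) by (auto simp: \<kappa>_def slots_def)
      ultimately show "z \<in> K" using ei by (simp add: K_def)
    qed
    have "inj_on (\<lambda>(e, i). (e, \<kappa> e i)) Jc"
      by (auto simp: inj_on_def \<kappa>_def split: if_splits)
    then show "card T = card Jc" unfolding T_def by (rule card_image)
  qed
  have no_more: "z \<in> T" if "z \<in> K" for z
  proof (rule ccontr)
    assume "z \<notin> T"
    then show False using small[OF T(1), of z] T that by simp
  qed
  let ?n = "length (edge_mult c e)"
  show "w (e, 0, True) = 0"
  proof (rule ccontr)
    assume "w (e, 0, True) \<noteq> 0"
    then have "(e, (0, 1)) \<in> K" using slot_value_right[OF e, of 0 c w] e by (simp add: K_def slots_def)
    from no_more[OF this] show False by (auto simp: T_def \<kappa>_def split: if_splits)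
  qed
  show "w (e, ?n, False) = 0"
  proof (rule ccontr)
    assume "w (e, ?n, False) \<noteq> 0"
    then have "(e, (Suc ?n, - 1)) \<in> K" using slot_value_left[OF e, of ?n c w] e by (simp add: K_def slots_def)
    from no_more[OF this] show False by (auto simp: T_def Jc_def \<kappa>_def split: if_splits)
  qed
  show "w (e, Suc i, True) = 0 \<or> w (e, i, False) = 0" if i: "i < ?n" for i
  proof (rule ccontr)
    assume *: "\<not> (w (e, Suc i, True) = 0 \<or> w (e, i, False) = 0)"
    then have "(e, (Suc i, - 1)) \<in> K"
      using slot_value_left[OF e, of i c w] e i by (simp add: K_def slots_def)
    from no_more[OF this] show False using * by (auto simp: T_def \<kappa>_def split: if_splits)
  qed
qed

end

section \<open>The maximum of a rational function\<close>

lemma slope_at_max: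
  assumes F: "F \<noteq> bot" and lin: "\<forall>\<^sub>F s in F. g s = m + of_int k * d s" and pos: "\<forall>\<^sub>F s in F. d s > 0"
    and le: "\<forall>\<^sub>F s in F. g s \<le> (m :: real)"
  shows "k \<le> 0" "k = 0 \<Longrightarrow> \<forall>\<^sub>F s in F. g s = m"
proof -
  from lin pos le have "\<forall>\<^sub>F s in F. k \<le> 0"
  proof eventually_elim
    case (elim s)
    then have "of_int k * d s \<le> 0" by linarith
    then show ?case using elim(2) by (simp add: mult_le_0_iff)
  qed
  then show "k \<le> 0" using F by simp
  show "\<forall>\<^sub>F s in F. g s = m" if "k = 0" using lin that by simp
qed

lemma sum_indicator_le:
  fixes F :: "'i \<Rightarrow> int" and R :: "'t \<Rightarrow> int"
  assumes "finite T" "finite J" "inj_on g J"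
    and "\<And>j. j \<in> J \<Longrightarrow> P j \<Longrightarrow> g j \<in> T \<and> F j \<le> R (g j)" and "\<And>t. t \<in> T \<Longrightarrow> R t \<ge> 0"
  shows "(\<Sum>j\<in>J. F j * of_bool (P j)) \<le> (\<Sum>t\<in>T. R t)"
proof -
  have "(\<Sum>j\<in>J. F j * of_bool (P j)) = (\<Sum>j\<in>{j \<in> J. P j}. F j)"
    using assms(2) by (intro sum.mono_neutral_cong_right) auto
  also have "\<dots> \<le> (\<Sum>j\<in>{j \<in> J. P j}. R (g j))"
    using assms(4) by (intro sum_mono) auto
  also have "\<dots> = (\<Sum>t\<in>g ` {j \<in> J. P j}. R t)"
    by (subst sum.reindex) (auto intro: inj_on_subset[OF assms(3)])
  also have "\<dots> \<le> (\<Sum>t\<in>T. R t)"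
    using assms by (intro sum_mono2) auto
  finally show ?thesis .
qed

context metrized_model
begin

text \<open>\<open>B\<close> is the set where \<open>f\<close> attains its maximum on a union \<open>G\<close> of connected components.\<close>

context
  fixes D f G m B
  assumes eff: "effective M D"
    and f: "rational_function M f"
    and ge: "\<forall>y\<in>points M. D y + principal M f y \<ge> 0"
    and G: "\<forall>e\<in>edges M. \<forall>s\<in>{0..len M e}. \<forall>t\<in>{0..len M e}. param M e s \<in> G \<longrightarrow> param M e t \<in> G"
    and max: "\<forall>e\<in>edges M. \<forall>t\<in>{0..len M e}. param M e t \<in> G \<longrightarrow> f (param M e t) \<le> m"
  defines "B \<equiv> {y \<in> G. f y = m}"
begin

lemma argmax_le:
  assumes "e \<in> edges M" "t \<in> {0..len M e}" "param M e t \<in> B" "s \<in> {0..len M e}"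
  shows "f (param M e s) \<le> m" "param M e s \<in> B \<longleftrightarrow> f (param M e s) = m"
proof -
  have "param M e s \<in> G" using assms G unfolding B_def by blast
  then show "f (param M e s) \<le> m" "param M e s \<in> B \<longleftrightarrow> f (param M e s) = m"
    using assms max unfolding B_def by blast+
qed

lemma argmax_slope_right:
  assumes e: "e \<in> edges M" and t: "0 \<le> t" "t < len M e" and B: "param M e t \<in> B"
  shows "slope_right (f \<circ> param M e) t \<le> 0"
    "slope_right (f \<circ> param M e) t = 0 \<Longrightarrow> \<forall>\<^sub>F s in at_right t. param M e s \<in> B"
proof -
  let ?k = "slope_right (f \<circ> param M e) t"
  have tt: "t \<in> {0..len M e}" using t by simp
  have fm: "f (param M e t) = m" using B by (simp add: B_def)
  note ev = eventually_at_right_interval[OF t(2)]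
  note lin = piecewise_linear_slope_right[OF rational_function_edge[OF f e] t]
  have le: "\<forall>\<^sub>F s in at_right t. (f \<circ> param M e) s \<le> m"
    using ev by eventually_elim (use argmax_le(1)[OF e tt B] t in auto)
  have pos: "\<forall>\<^sub>F s in at_right t. s - t > 0" using ev by eventually_elim auto
  have lin': "\<forall>\<^sub>F s in at_right t. (f \<circ> param M e) s = m + of_int ?k * (s - t)"
    using lin fm by simp
  note * = slope_at_max[OF trivial_limit_at_right_real lin' pos le]
  show "?k \<le> 0" by (rule *(1))
  assume "?k = 0"
  from *(2)[OF this] ev show "\<forall>\<^sub>F s in at_right t. param M e s \<in> B"
    by eventually_elim (use argmax_le(2)[OF e tt B] t in auto)
qed

lemma argmax_slope_left:
  assumes e: "e \<in> edges M" and t: "0 < t" "t \<le> len M e" and B: "param M e t \<in> B"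
  shows "slope_left (f \<circ> param M e) t \<le> 0"
    "slope_left (f \<circ> param M e) t = 0 \<Longrightarrow> \<forall>\<^sub>F s in at_left t. param M e s \<in> B"
proof -
  let ?k = "slope_left (f \<circ> param M e) t"
  have tt: "t \<in> {0..len M e}" using t by simp
  have fm: "f (param M e t) = m" using B by (simp add: B_def)
  note ev = eventually_at_left_interval[OF t(1)]
  note lin = piecewise_linear_slope_left[OF rational_function_edge[OF f e] t]
  have le: "\<forall>\<^sub>F s in at_left t. (f \<circ> param M e) s \<le> m"
    using ev by eventually_elim (use argmax_le(1)[OF e tt B] t in auto)
  have pos: "\<forall>\<^sub>F s in at_left t. t - s > 0" using ev by eventually_elim auto
  have lin': "\<forall>\<^sub>F s in at_left t. (f \<circ> param M e) s = m + of_int ?k * (t - s)"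
    using lin fm by simp
  note * = slope_at_max[OF trivial_limit_at_left_real lin' pos le]
  show "?k \<le> 0" by (rule *(1))
  assume "?k = 0"
  from *(2)[OF this] ev show "\<forall>\<^sub>F s in at_left t. param M e s \<in> B"
    by eventually_elim (use argmax_le(2)[OF e tt B] t in auto)
qed

lemma argmax_ord_zero:
  assumes e: "e \<in> edges M" and t: "t \<in> {0<..<len M e}" and B: "param M e t \<in> B" and D: "D (param M e t) = 0"
  shows "principal M f (param M e t) = 0"
proof -
  have "param M e t \<in> points M" using param_points[OF e] t by auto
  from bspec[OF ge this] show ?thesis
    using argmax_slope_right(1)[OF e _ _ B] argmax_slope_left(1)[OF e _ _ B] t D
    by (simp add: principal_def ord_at_interior[OF e t])
qed

lemma argmax_spread:
  assumes e: "e \<in> edges M" and ab: "0 \<le> a" "b \<le> len M e"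
    and free: "\<And>t. a < t \<Longrightarrow> t < b \<Longrightarrow> D (param M e t) = 0"
    and t0: "a < t0" "t0 < b" "param M e t0 \<in> B" and t: "a \<le> t" "t \<le> b"
  shows "param M e t \<in> B"
proof -
  have t0': "t0 \<in> {0..len M e}" using t0 ab by auto
  have "(f \<circ> param M e) t = m"
  proof (rule piecewise_linear_max_const[OF rational_function_edge[OF f e] ab(1) _ ab(2), of m t0])
    fix s assume s: "a < s" "s < b"
    then have s': "s \<in> {0<..<len M e}" using ab by auto
    show "slope_right (f \<circ> param M e) s + slope_left (f \<circ> param M e) s \<ge> 0"
      using bspec[OF ge param_points[OF e, of s]] free[OF s] s' ord_at_interior[OF e s']
      by (simp add: principal_def)
    show "(f \<circ> param M e) s \<le> m" using argmax_le(1)[OF e t0' t0(3)] s' by simp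
  qed (use t0 t in \<open>auto simp: B_def\<close>)
  then show ?thesis using argmax_le(2)[OF e t0' t0(3), of t] t ab by simp
qed

context
  fixes D0 c x
  assumes maxi: "maximal_cell M D0 c" and D: "D \<in> open_cell M D0 c" and x: "chip_positions M c D x"
begin

definition out_weight :: "'e \<times> nat \<times> bool \<Rightarrow> int" where
  "out_weight a = of_bool (param M (fst a) (brk M c x (fst a) (fire_from (snd a))) \<in> B) -
     of_bool (param M (fst a) (midpt M c x (fst a) (fst (snd a))) \<in> B)"

lemma argmax_piece:
  assumes e: "e \<in> edges M" and j: "j \<le> length (edge_mult c e)"
    and t0: "brk M c x e j < t0" "t0 < brk M c x e (Suc j)" "param M e t0 \<in> B"
    and t: "brk M c x e j \<le> t" "t \<le> brk M c x e (Suc j)"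
  shows "param M e t \<in> B"
  using brk_range[OF x e, of j] brk_range[OF x e, of "Suc j"] j
  by (intro argmax_spread[OF e _ _ chip_free[OF x e j] t0 t]) auto

lemma out_weight_eq:
  assumes a: "a \<in> fire_index M c"
  shows "out_weight a = of_bool (param M (fst a) (brk M c x (fst a) (fire_from (snd a))) \<in> B \<and>
    param M (fst a) (midpt M c x (fst a) (fst (snd a))) \<notin> B)"
proof -
  obtain e j r where ejr: "a = (e, j, r)" by (cases a) auto
  then have e: "e \<in> edges M" and j: "j \<le> length (edge_mult c e)" using a by auto
  have "param M e (brk M c x e (fire_from (j, r))) \<in> B" if "param M e (midpt M c x e j) \<in> B"
    using brk_less[OF x e j] by (intro argmax_piece[OF e j midpt_between[OF x e j] that]) auto
  then show ?thesis unfolding out_weight_def ejr by auto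
qed

lemma out_weight_right:
  assumes e: "e \<in> edges M" and j: "j \<le> length (edge_mult c e)" and B: "param M e (brk M c x e j) \<in> B"
  shows "out_weight (e, j, True) \<le> - slope_right (f \<circ> param M e) (brk M c x e j)"
proof -
  have t: "0 \<le> brk M c x e j" "brk M c x e j < len M e"
    using brk_range[OF x e, of j] brk_strict[OF x e, of j "Suc (length (edge_mult c e))"] j by auto
  have le: "slope_right (f \<circ> param M e) (brk M c x e j) \<le> 0" by (rule argmax_slope_right(1)[OF e t B])
  show ?thesis
  proof (cases "slope_right (f \<circ> param M e) (brk M c x e j) = 0")
    case True
    from argmax_slope_right(2)[OF e t B True] eventually_at_right_interval[OF brk_less[OF x e j]]
    have "\<forall>\<^sub>F s in at_right (brk M c x e j). param M e s \<in> B \<and> s \<in> {brk M c x e j<..<brk M c x e (Suc j)}"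
      by eventually_elim simp
    then obtain s where s: "param M e s \<in> B" "s \<in> {brk M c x e j<..<brk M c x e (Suc j)}"
      using eventually_happens'[OF trivial_limit_at_right_real] by blast
    have "param M e (midpt M c x e j) \<in> B"
      by (rule argmax_piece[OF e j _ _ s(1)]) (use s midpt_between[OF x e j] in auto)
    then show ?thesis using True e j by (subst out_weight_eq) auto
  next
    case False
    then show ?thesis using le e j by (subst out_weight_eq) auto
  qed
qed

lemma out_weight_left:
  assumes e: "e \<in> edges M" and j: "j \<le> length (edge_mult c e)" and B: "param M e (brk M c x e (Suc j)) \<in> B"
  shows "out_weight (e, j, False) \<le> - slope_left (f \<circ> param M e) (brk M c x e (Suc j))"
proof -
  have t: "0 < brk M c x e (Suc j)" "brk M c x e (Suc j) \<le> len M e"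
    using brk_range[OF x e, of "Suc j"] brk_strict[OF x e, of 0 "Suc j"] j by auto
  have le: "slope_left (f \<circ> param M e) (brk M c x e (Suc j)) \<le> 0" by (rule argmax_slope_left(1)[OF e t B])
  show ?thesis
  proof (cases "slope_left (f \<circ> param M e) (brk M c x e (Suc j)) = 0")
    case True
    from argmax_slope_left(2)[OF e t B True] eventually_at_left_interval[OF brk_less[OF x e j]]
    have "\<forall>\<^sub>F s in at_left (brk M c x e (Suc j)). param M e s \<in> B \<and> s \<in> {brk M c x e j<..<brk M c x e (Suc j)}"
      by eventually_elim simp
    then obtain s where s: "param M e s \<in> B" "s \<in> {brk M c x e j<..<brk M c x e (Suc j)}"
      using eventually_happens'[OF trivial_limit_at_left_real] by blast
    have "param M e (midpt M c x e j) \<in> B"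
      by (rule argmax_piece[OF e j _ _ s(1)]) (use s midpt_between[OF x e j] in auto)
    then show ?thesis using True e j by (subst out_weight_eq) auto
  next
    case False
    then show ?thesis using le e j by (subst out_weight_eq) auto
  qed
qed

lemma fired_from_argmax_le:
  assumes y: "y \<in> points M"
  shows "fired_from M c x out_weight y \<le> D y"
proof (cases "y \<in> B")
  case False
  have "fired_from M c x out_weight y = 0"
    unfolding fired_from_def
  proof (intro sum.neutral ballI)
    fix a assume "a \<in> fire_index M c"
    then show "out_weight a * of_bool (param M (fst a) (brk M c x (fst a) (fire_from (snd a))) = y) = 0"
      using False by (auto simp: out_weight_eq)
  qed
  then show ?thesis using eff by (simp add: effective_def)
next
  case True
  let ?T = "\<lambda>e. {t. t \<in> {0..len M e} \<and> param M e t = y}"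
  let ?R = "\<lambda>e t. if t < len M e then - slope_right (f \<circ> param M e) t else 0"
  let ?L = "\<lambda>e t. if 0 < t then - slope_left (f \<circ> param M e) t else 0"
  let ?P = "\<lambda>e j. param M e (brk M c x e j) = y"
  have "fired_from M c x out_weight y = (\<Sum>e\<in>edges M. \<Sum>a | a \<in> fire_index M c \<and> fst a = e.
      out_weight a * of_bool (?P (fst a) (fire_from (snd a))))"
    unfolding fired_from_def
    by (rule sum.group[symmetric]) (use finite_fire_index finite_edges in \<open>auto simp: fire_index_def\<close>)
  also have "\<dots> \<le> (\<Sum>e\<in>edges M. \<Sum>t\<in>?T e. - ord_edge (f \<circ> param M e) (len M e) t)"
  proof (rule sum_mono)
    fix e assume e: "e \<in> edges M"
    let ?n = "length (edge_mult c e)"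
    have inj: "inj_on (brk M c x e) {..Suc ?n}"
      by (rule linorder_inj_onI) (use brk_strict[OF x e] in force)+
    have "(\<Sum>j\<le>?n. out_weight (e, j, True) * of_bool (?P e j)) \<le> (\<Sum>t\<in>?T e. ?R e t)"
    proof (rule sum_indicator_le[where g = "brk M c x e"])
      show "inj_on (brk M c x e) {..?n}" by (rule inj_on_subset[OF inj]) auto
      fix j assume "j \<in> {..?n}" "?P e j"
      then show "brk M c x e j \<in> ?T e \<and> out_weight (e, j, True) \<le> ?R e (brk M c x e j)"
        using out_weight_right[OF e, of j] brk_range[OF x e, of j] True
          brk_strict[OF x e, of j "Suc ?n"] by auto
    next
      fix t assume "t \<in> ?T e"
      then show "?R e t \<ge> 0" using argmax_slope_right(1)[OF e, of t] True by auto
    qed (use finite_fibre[OF e] in auto)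
    moreover have "(\<Sum>j\<le>?n. out_weight (e, j, False) * of_bool (?P e (Suc j))) \<le> (\<Sum>t\<in>?T e. ?L e t)"
    proof (rule sum_indicator_le[where g = "\<lambda>j. brk M c x e (Suc j)"])
      show "inj_on (\<lambda>j. brk M c x e (Suc j)) {..?n}"
        using inj by (auto simp: inj_on_def)
      fix j assume "j \<in> {..?n}" "?P e (Suc j)"
      then show "brk M c x e (Suc j) \<in> ?T e \<and> out_weight (e, j, False) \<le> ?L e (brk M c x e (Suc j))"
        using out_weight_left[OF e, of j] brk_range[OF x e, of "Suc j"] True
          brk_strict[OF x e, of 0 "Suc j"] by auto
    next
      fix t assume "t \<in> ?T e"
      then show "?L e t \<ge> 0" using argmax_slope_left(1)[OF e, of t] True by auto
    qed (use finite_fibre[OF e] in auto)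
    ultimately have "(\<Sum>a | a \<in> fire_index M c \<and> fst a = e. out_weight a * of_bool (?P (fst a) (fire_from (snd a))))
        \<le> (\<Sum>t\<in>?T e. ?R e t) + (\<Sum>t\<in>?T e. ?L e t)"
      unfolding fire_edge_sum[OF e] by (simp add: sum.distrib)
    also have "\<dots> = (\<Sum>t\<in>?T e. - ord_edge (f \<circ> param M e) (len M e) t)"
      unfolding sum.distrib[symmetric] by (intro sum.cong refl) (auto simp: ord_edge_def)
    finally show "(\<Sum>a | a \<in> fire_index M c \<and> fst a = e. out_weight a * of_bool (?P (fst a) (fire_from (snd a))))
        \<le> (\<Sum>t\<in>?T e. - ord_edge (f \<circ> param M e) (len M e) t)" .
  qed
  also have "\<dots> = - principal M f y"
    unfolding principal_def ord_at_eq by (simp only: sum_negf)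
  also have "\<dots> \<le> D y" using bspec[OF ge y] by simp
  finally show ?thesis .
qed

lemma argmax_balanced:
  assumes e: "e \<in> edges M"
  shows "out_weight (e, 0, True) = 0" "out_weight (e, length (edge_mult c e), False) = 0"
    "\<And>i. i < length (edge_mult c e) \<Longrightarrow> out_weight (e, Suc i, True) = 0 \<or> out_weight (e, i, False) = 0"
proof -
  have u: "(\<Sum>j\<le>length (edge_mult c e). out_weight (e, j, True) - out_weight (e, j, False)) =
      of_bool (param M e 0 \<in> B) - of_bool (param M e (len M e) \<in> B)" for e
    using sum_telescope[of "\<lambda>j. of_bool (param M e (brk M c x e j) \<in> B) :: int" "length (edge_mult c e)"]
    by (simp add: out_weight_def)
  have w: "out_weight a \<in> {0, 1}" if "a \<in> fire_index M c" for a
    using out_weight_eq[OF that] by auto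
  show "out_weight (e, 0, True) = 0"
    by (rule maximal_cell_fire(1)[OF maxi D x u _ _ e]) (fact w fired_from_argmax_le)+
  show "out_weight (e, length (edge_mult c e), False) = 0"
    by (rule maximal_cell_fire(2)[OF maxi D x u _ _ e]) (fact w fired_from_argmax_le)+
  show "out_weight (e, Suc i, True) = 0 \<or> out_weight (e, i, False) = 0" if "i < length (edge_mult c e)" for i
    by (rule maximal_cell_fire(3)[OF maxi D x u _ _ e that]) (fact w fired_from_argmax_le)+
qed

lemma argmax_first: "e \<in> edges M \<Longrightarrow> param M e 0 \<in> B \<longleftrightarrow> param M e (midpt M c x e 0) \<in> B"
  using argmax_balanced(1)[of e] by (simp add: out_weight_def of_bool_eq_iff)

lemma argmax_last: "e \<in> edges M \<Longrightarrow>
    param M e (len M e) \<in> B \<longleftrightarrow> param M e (midpt M c x e (length (edge_mult c e))) \<in> B"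
  using argmax_balanced(2)[of e] by (simp add: out_weight_def of_bool_eq_iff)

lemma argmax_chip_const: "chip_const M D (\<lambda>y. of_bool (y \<in> B))"
  unfolding chip_const_def
proof (intro ballI allI impI)
  fix e a b assume e: "e \<in> edges M" and ab: "0 \<le> a \<and> a \<le> b \<and> b \<le> len M e \<and>
     (\<forall>t. a \<le> t \<and> t \<le> b \<and> 0 < t \<and> t < len M e \<longrightarrow> D (param M e t) = 0)"
  let ?n = "length (edge_mult c e)"
  have chip: "\<not> (a \<le> brk M c x e (Suc i) \<and> brk M c x e (Suc i) \<le> b)" if "i < ?n" for i
    using ab chip_at[OF x e that] chip_interior[OF x e that] mult_pos[OF x e that] that by force
  show "(of_bool (param M e a \<in> B) :: real) = of_bool (param M e b \<in> B)"
  proof (cases "a = b")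
    case False
    then have "a < brk M c x e (Suc ?n)" using ab by simp
    then obtain j where j: "j \<le> ?n" "brk M c x e j \<le> a" "a < brk M c x e (Suc j)"
      using breakpoint_locate[of a "len M e" ?n "x e" ?n] ab by blast
    have b: "b \<le> brk M c x e (Suc j)"
      using chip[of j] j ab by (cases "j = ?n") auto
    have mid: "param M e t \<in> B \<longleftrightarrow> param M e (midpt M c x e j) \<in> B" if "brk M c x e j < t" "t < brk M c x e (Suc j)" for t
      using argmax_piece[OF e j(1) that, of "midpt M c x e j"]
        argmax_piece[OF e j(1) midpt_between[OF x e j(1)], of t] midpt_between[OF x e j(1)] that by auto
    have "param M e a \<in> B \<longleftrightarrow> param M e (midpt M c x e j) \<in> B"
    proof (cases "brk M c x e j < a")
      case True then show ?thesis using mid j by simp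
    next
      case False
      then have a: "a = brk M c x e j" using j by simp
      then have "j = 0" using chip[of "j - 1"] j ab by (cases j) auto
      then show ?thesis using a argmax_first[OF e] by simp
    qed
    moreover have "param M e b \<in> B \<longleftrightarrow> param M e (midpt M c x e j) \<in> B"
    proof (cases "b < brk M c x e (Suc j)")
      case True then show ?thesis using mid[of b] j False ab by simp
    next
      case nb: False
      then have b': "b = brk M c x e (Suc j)" using b by simp
      then have "j = ?n" using chip[of j] j ab by (cases "j < ?n") auto
      then show ?thesis using b' argmax_last[OF e] by simp
    qed
    ultimately show ?thesis by simp
  qed simp
qed

lemma argmax_chip_free:
  assumes e: "e \<in> edges M" and t: "t \<in> {0..len M e}" and B: "param M e t \<in> B"
  obtains s where "s \<in> {0<..<len M e}" "D (param M e s) = 0" "param M e s \<in> B"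
proof -
  let ?n = "length (edge_mult c e)"
  have "\<exists>j\<le>?n. param M e (midpt M c x e j) \<in> B"
  proof (cases "t = len M e")
    case True
    then show ?thesis using argmax_last[OF e] B by blast
  next
    case False
    then obtain j where j: "j \<le> ?n" "brk M c x e j \<le> t" "t < brk M c x e (Suc j)"
      using breakpoint_locate[of t "len M e" ?n "x e" ?n] t by auto
    show ?thesis
    proof (cases "brk M c x e j = t")
      case False
      then have "param M e (midpt M c x e j) \<in> B"
        using argmax_piece[OF e j(1) _ j(3) B, of "midpt M c x e j"] midpt_between[OF x e j(1)] j by simp
      then show ?thesis using j by blast
    next
      case True
      show ?thesis
      proof (cases j)
        case 0
        then show ?thesis using True argmax_first[OF e] B by auto
      next
        case (Suc i)
        then have i: "i < ?n" using j by simp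
        have "param M e (midpt M c x e (Suc i)) \<in> B \<or> param M e (midpt M c x e i) \<in> B"
          using argmax_balanced(3)[OF e i] True B Suc i by (auto simp: out_weight_def)
        then show ?thesis using i by (meson Suc_leI less_imp_le_nat)
      qed
    qed
  qed
  then obtain j where j: "j \<le> ?n" "param M e (midpt M c x e j) \<in> B" by blast
  show ?thesis
    using that[OF midpt_range[OF x e j(1)] _ j(2)] chip_free[OF x e j(1) midpt_between[OF x e j(1)]] by blast
qed

end

end

end

lemma deg_zero_effective:
  assumes "effective X E" "deg E = 0"
  shows "E = (\<lambda>_. 0)"
proof
  fix x
  have "finite {x. E x \<noteq> 0}" "\<And>x. E x \<ge> 0" using assms(1) by (auto simp: effective_def divisor_def)
  then show "E x = 0"
    using assms(2) sum_nonneg_eq_0_iff[of "{x. E x \<noteq> 0}" E] by (auto simp: deg_def)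
qed

theorem proposition2p78:
  fixes M :: "('a, 'e) modelled_graph"
    and D0 D :: "'a \<Rightarrow> int"
    and c :: "('a, 'e) cell_data"
  assumes "metric_graph M" and "model M" and "loopless M"
    and "edges M \<noteq> {}"
    and "divisor M D0"
    and "D \<in> linear_system M D0" and "generic M D0 D"
    and "D \<in> open_cell M D0 c"
  shows "int (cell_dim M D0 c) \<ge> div_rank M D"
proof -
  interpret metrized_model M
    using assms(1,2) by unfold_locales (auto simp: metric_graph_def length_space_def)
  have eff: "effective M D" by (rule linear_system_effective) fact
  then have suppD: "finite {y. D y \<noteq> 0}" by (simp add: effective_def divisor_def)
  obtain c1 where c1: "maximal_cell M D0 c1" "D \<in> open_cell M D0 c1"
    using assms(7) by (auto simp: generic_def)
  then obtain x1 where x1: "chip_positions M c1 D x1" by (auto simp: open_cell_def)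
  obtain e0 where e0: "e0 \<in> edges M" using assms(4) by blast
  obtain t0 where t0: "t0 \<in> {0<..<len M e0}" "D (param M e0 t0) = 0"
  proof -
    have "inj_on (param M e0) {0<..<len M e0}"
    proof (rule inj_onI)
      fix s t assume "s \<in> {0<..<len M e0}" "t \<in> {0<..<len M e0}" "param M e0 s = param M e0 t"
      then show "s = t" using param_inj(2)[OF e0 e0, of s t] by simp
    qed
    moreover have "infinite {0<..<len M e0}" using len_pos[OF e0] by simp
    ultimately have "infinite (param M e0 ` {0<..<len M e0})" using finite_imageD by blast
    then have "\<not> param M e0 ` {0<..<len M e0} \<subseteq> {y. D y \<noteq> 0}" using suppD finite_subset by blast
    then show ?thesis using that by blast
  qed
  define y0 where "y0 = param M e0 t0"
  define G where "G = {y. same_piece M (\<lambda>_. 0) y y0}"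
  have G: "param M e t \<in> G" if e: "e \<in> edges M" and st: "s \<in> {0..len M e}" "t \<in> {0..len M e}" "param M e s \<in> G" for e s t
  proof -
    have "h (param M e s) = h (param M e t)" if "chip_const M (\<lambda>_. 0) h" for h
    proof (cases "s \<le> t")
      case True
      then show ?thesis using st by (intro chip_constD[OF that e]) auto
    next
      case False
      then show ?thesis using st by (intro chip_constD[OF that e, symmetric]) auto
    qed
    then have "same_piece M (\<lambda>_. 0) (param M e s) (param M e t)" by (simp add: same_piece_def)
    then have "same_piece M (\<lambda>_. 0) (param M e t) (param M e s)" by (simp only: same_piece_sym)
    then show ?thesis using st(3) same_piece_trans[of M] unfolding G_def by blast
  qed
  then have G': "\<forall>e\<in>edges M. \<forall>s\<in>{0..len M e}. \<forall>t\<in>{0..len M e}. param M e s \<in> G \<longrightarrow> param M e t \<in> G"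
    by blast
  define Q where "Q = {y \<in> G. D y = 0 \<and> (\<exists>e\<in>edges M. \<exists>t\<in>{0<..<len M e}. y = param M e t)}"
  define sep where "sep S \<longleftrightarrow> finite S \<and> S \<subseteq> Q \<and> (\<forall>s\<in>S. \<forall>s'\<in>S. s \<noteq> s' \<longrightarrow> \<not> same_piece M D s s')" for S
  have bound: "card S \<le> Suc (cell_dim M D0 c)" if "sep S" for S
    using that by (intro card_pieces_le_cell_dim[OF assms(8), of S y0]) (auto simp: sep_def Q_def G_def)
  have y0: "y0 \<in> Q"
  proof -
    have "\<exists>e\<in>edges M. \<exists>t\<in>{0<..<len M e}. y0 = param M e t"
      by (intro bexI[OF _ e0] bexI[OF _ t0(1)]) (rule y0_def)
    then show ?thesis using t0(2) by (simp add: Q_def G_def y0_def same_piece_refl)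
  qed
  then have "sep {y0}" by (simp add: sep_def)
  then have "\<exists>S. sep S \<and> (\<forall>S'. sep S' \<longrightarrow> card S' \<le> card S)"
    using bound by (intro ex_has_greatest_nat[of sep "{y0}" card "Suc (Suc (cell_dim M D0 c))"]) (auto simp: less_Suc_eq_le)
  then obtain S where S: "sep S" "\<And>S'. sep S' \<Longrightarrow> card S' \<le> card S"
    by blast
  have "card S > 0" using S(2)[OF \<open>sep {y0}\<close>] by simp
  then obtain s0 where s0: "s0 \<in> S" by (metis all_not_in_conv card.empty less_irrefl)
  have finS: "finite S" and SQ: "S \<subseteq> Q" using S(1) by (auto simp: sep_def)
  have "k \<le> cell_dim M D0 c"
    if k: "\<forall>E. effective M E \<and> deg E = int k \<longrightarrow> linear_system M (D - E) \<noteq> {}" for k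
  proof (rule ccontr)
    assume "\<not> k \<le> cell_dim M D0 c"
    then have Sk: "card S \<le> k" using bound[OF S(1)] by simp
    define E where "E y = of_bool (y \<in> S) + (if y = s0 then int (k - card S) else 0)" for y
    have suppE: "{y. E y \<noteq> 0} = S" using s0 by (auto simp: E_def)
    have "S \<subseteq> points M" using SQ param_points by (fastforce simp: Q_def)
    then have "effective M E" using finS suppE by (auto simp: effective_def divisor_def E_def)
    moreover have "deg E = int k"
      unfolding deg_def suppE using finS s0 Sk by (simp add: E_def sum.distrib)
    ultimately obtain D' where "D' \<in> linear_system M (D - E)" using k by blast
    then obtain f where f: "rational_function M f" "D' - (D - E) = principal M f" and D': "\<And>y. D' y \<ge> 0"
      by (auto simp: linear_system_def lin_equiv_def effective_def)
    have eq: "D y + principal M f y = D' y + E y" for y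
      using fun_cong[OF f(2), of y] by simp
    have ge: "\<forall>y\<in>points M. D y + principal M f y \<ge> 0" unfolding eq using D' by (simp add: E_def)
    define EG where "EG = {e \<in> edges M. param M e 0 \<in> G}"
    have "\<exists>\<tau>\<in>{0..len M e}. \<forall>t\<in>{0..len M e}. f (param M e t) \<le> f (param M e \<tau>)" if "e \<in> edges M" for e
      using continuous_attains_sup[OF compact_Icc _ rational_function_edge(2)[OF f(1) that]] len_pos[OF that]
      by fastforce
    then obtain \<tau> where \<tau>: "\<And>e. e \<in> edges M \<Longrightarrow> \<tau> e \<in> {0..len M e}"
      "\<And>e t. e \<in> edges M \<Longrightarrow> t \<in> {0..len M e} \<Longrightarrow> f (param M e t) \<le> f (param M e (\<tau> e))" by metis
    have "e0 \<in> EG" using G[OF e0, of t0 0] t0 y0 e0 len_pos[OF e0] by (auto simp: EG_def Q_def y0_def)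
    define m where "m = Max ((\<lambda>e. f (param M e (\<tau> e))) ` EG)"
    have fin: "finite ((\<lambda>e. f (param M e (\<tau> e))) ` EG)" using finite_edges by (simp add: EG_def)
    have max: "f (param M e t) \<le> m" if e: "e \<in> edges M" "t \<in> {0..len M e}" "param M e t \<in> G" for e t
    proof -
      have "e \<in> EG" using G[OF e(1,2), of 0] e len_pos[OF e(1)] by (simp add: EG_def)
      then have "f (param M e (\<tau> e)) \<le> m" unfolding m_def using fin by simp
      then show ?thesis using \<tau>(2)[OF e(1,2)] by simp
    qed
    then have max': "\<forall>e\<in>edges M. \<forall>t\<in>{0..len M e}. param M e t \<in> G \<longrightarrow> f (param M e t) \<le> m"
      by blast
    have "m \<in> (\<lambda>e. f (param M e (\<tau> e))) ` EG" unfolding m_def using fin \<open>e0 \<in> EG\<close> by (intro Max_in) auto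
    then obtain e1 where e1: "e1 \<in> edges M" "param M e1 0 \<in> G" "f (param M e1 (\<tau> e1)) = m"
      by (auto simp: EG_def)
    let ?B = "{y \<in> G. f y = m}"
    have "param M e1 (\<tau> e1) \<in> ?B" using e1 G[OF e1(1) _ \<tau>(1)[OF e1(1)] e1(2)] len_pos[OF e1(1)] by simp
    then obtain s where s: "s \<in> {0<..<len M e1}" "D (param M e1 s) = 0" "param M e1 s \<in> ?B"
      using argmax_chip_free[OF eff f(1) ge G' max' c1 x1 e1(1) \<tau>(1)[OF e1(1)]] by blast
    let ?z = "param M e1 s"
    have "\<exists>e\<in>edges M. \<exists>t\<in>{0<..<len M e}. ?z = param M e t"
      by (intro bexI[OF _ e1(1)] bexI[OF _ s(1)]) (rule refl)
    then have zQ: "?z \<in> Q" using s by (simp add: Q_def)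
    have "\<exists>s'\<in>S. same_piece M D ?z s'"
    proof (rule ccontr)
      assume no: "\<not> (\<exists>s'\<in>S. same_piece M D ?z s')"
      then have "?z \<notin> S" using same_piece_refl[of M D ?z] by blast
      moreover have "sep (insert ?z S)"
        using S(1) zQ no same_piece_sym[of M D] unfolding sep_def by blast
      ultimately show False using S(2)[of "insert ?z S"] finS by simp
    qed
    then obtain s' where s': "s' \<in> S" "same_piece M D ?z s'" by blast
    have const: "chip_const M D (\<lambda>y. of_bool (y \<in> ?B))"
      by (rule argmax_chip_const[OF eff f(1) ge G' max' c1 x1])
    have "(of_bool (?z \<in> ?B) :: real) = of_bool (s' \<in> ?B)"
      by (rule s'(2)[unfolded same_piece_def, rule_format, OF const])
    then have s'B: "s' \<in> ?B" using s(3) by (simp only: of_bool_eq_iff)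
    have "s' \<in> Q" using s' SQ by blast
    then obtain e t where et: "e \<in> edges M" "t \<in> {0<..<len M e}" "s' = param M e t" "D s' = 0"
      unfolding Q_def by blast
    have "principal M f s' = 0"
      unfolding et(3) by (rule argmax_ord_zero[OF eff f(1) ge G' max' et(1,2)]) (use s'B et in simp_all)
    then show False using eq[of s'] et(4) D'[of s'] s'(1) by (simp add: E_def split: if_splits)
  qed
  moreover have ne: "linear_system M D \<noteq> {}"
  proof -
    have "lin_equiv M D D" unfolding lin_equiv_def using principal_zero by (intro exI[of _ "\<lambda>_. 0"]) simp
    then show ?thesis using eff unfolding linear_system_def by blast
  qed
  moreover have "linear_system M (D - E) \<noteq> {}" if "effective M E \<and> deg E = int 0" for E
  proof -
    have "E = (\<lambda>_. 0)" using deg_zero_effective[of M E] that by simp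
    then have "D - E = D" by (simp add: fun_eq_iff)
    then show ?thesis using ne by simp
  qed
  ultimately have "(GREATEST k. \<forall>E. effective M E \<and> deg E = int k \<longrightarrow> linear_system M (D - E) \<noteq> {}) \<le> cell_dim M D0 c"
    using GreatestI_nat[of "\<lambda>k. \<forall>E. effective M E \<and> deg E = int k \<longrightarrow> linear_system M (D - E) \<noteq> {}" 0
        "cell_dim M D0 c"] by blast
  then show ?thesis using ne by (simp add: div_rank_def)
qed

end
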